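(* Over $\mathsf{ACA}_0^\omega+\mathsf{QF\text{-}AC}^{0,1}$, the following are equivalent. (i) Every regulated function $f:[0,1]\to\mathbb{R}$ is not totally discontinuous, i.e. there is a point of $[0,1]$ at which $f$ is continuous. (ii) The principle $\mathsf{NIN}_{\mathsf{alt}}$: the unit interval $[0,1]$ is not height-countable.
   Context: $\mathsf{RCA}_0^\omega$ is Kohlenbach's base theory of higher-order Reverse Mathematics, in the language of all finite types: $\mathsf{E\text{-}PRA}^\omega$ (quantifier-free induction, primitive recursion only of type $0$) plus $\mathsf{QF\text{-}AC}^{1,0}$: $(\forall f\in\mathbb{N}^{\mathbb{N}})(\exists n\in\mathbb{N})\varphi(f,n)\to(\exists G:\mathbb{N}^{\mathbb{N}}\to\mathbb{N})(\forall f\in\mathbb{N}^{\mathbb{N}})\varphi(f,G(f))$ for quantifier-free $\varphi$. $\mathsf{ACA}_0^\omega$ is $\mathsf{RCA}_0^\omega$ plus $(\exists^2)$: $(\exists E:\mathbb{N}^{\mathbb{N}}\to\{0,1\})(\forall f\in\mathbb{N}^{\mathbb{N}})[(\exists n\in\mathbb{N})(f(n)=0)\leftrightarrow E(f)=0]$. $\mathsf{QF\text{-}AC}^{0,1}$: for quantifier-free $\varphi$ with arbitrary parameters, if $(\forall n\in\mathbb{N})(\exists f\in\mathbb{N}^{\mathbb{N}})\varphi(n,f)$ then there is a sequence $(f_n)_{n\in\mathbb{N}}$ in $\mathbb{N}^{\mathbb{N}}$ with $(\forall n)\varphi(n,f_n)$. Reals are fast-converging Cauchy sequences of rationals with defined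 equality $=_{\mathbb{R}}$; functions on reals are third-order objects respecting $=_{\mathbb{R}}$, without codes. Subsets of $\mathbb{R}$ are given by characteristic functions. A set $A\subset\mathbb{R}$ is finite if there is $N\in\mathbb{N}$ such that for any finite sequence $(x_0,\dots,x_N)$ of distinct reals there is $i\le N$ with $x_i\notin A$. $A\subset\mathbb{R}$ is height-countable if there is a height function $H:\mathbb{R}\to\mathbb{N}$ for $A$, i.e. for all $n\in\mathbb{N}$ the set $\{x\in A:H(x)<n\}$ is finite. $f:[0,1]\to\mathbb{R}$ is regulated if the left and right limits $f(x-)$, $f(x+)$ exist everywhere. *)

theory Defs
  imports Main
begin

section \<open>The language of finite types\<close>

datatype ty = T0 | Fn ty ty (infixr "\<rightarrowtail>" 65)

abbreviation ty1 :: ty where "ty1 \<equiv> T0 \<rightarrowtail> T0"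
abbreviation ty2 :: ty where "ty2 \<equiv> ty1 \<rightarrowtail> T0"

text \<open>A variable is a name together with its type, so there are infinitely many variables
  of every type, and variables of different types are different.\<close>
type_synonym var = "string \<times> ty"

text \<open>Locally nameless syntax: free variables are \<open>Var v\<close>; \<open>Bd\<close> is a de Bruijn
  index and occurs only below a quantifier.\<close>
datatype tm =
    Bd nat
  | Var var
  | Zero
  | Succ
  | CK ty ty
  | CS ty ty ty
  | Rec
  | App tm tm (infixl "\<cdot>" 80)

datatype fm =
    Eq tm tm (infix "\<^bold>=" 55)
  | Fls
  | Imp fm fm (infixr "\<^bold>\<longrightarrow>" 25)
  | All ty fm

primrec typ_of :: "ty list \<Rightarrow> tm \<Rightarrow> ty option" where
  "typ_of G (Bd i) = (if i < length G then Some (G ! i) else None)"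
| "typ_of G (Var v) = Some (snd v)"
| "typ_of G Zero = Some T0"
| "typ_of G Succ = Some ty1"
| "typ_of G (CK T U) = Some (T \<rightarrowtail> U \<rightarrowtail> T)"
| "typ_of G (CS T U W) = Some ((T \<rightarrowtail> U \<rightarrowtail> W) \<rightarrowtail> (T \<rightarrowtail> U) \<rightarrowtail> T \<rightarrowtail> W)"
| "typ_of G Rec = Some (T0 \<rightarrowtail> T0 \<rightarrowtail> (T0 \<rightarrowtail> T0 \<rightarrowtail> T0) \<rightarrowtail> T0)"
| "typ_of G (s \<cdot> t) = (case typ_of G s of
      Some (T \<rightarrowtail> U) \<Rightarrow> if typ_of G t = Some T then Some U else None
    | _ \<Rightarrow> None)"

text \<open>The only prime formulas are equations of type 0.\<close>
primrec wff_in :: "ty list \<Rightarrow> fm \<Rightarrow> bool" where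
  "wff_in G (s \<^bold>= t) \<longleftrightarrow> typ_of G s = Some T0 \<and> typ_of G t = Some T0"
| "wff_in G Fls \<longleftrightarrow> True"
| "wff_in G (A \<^bold>\<longrightarrow> B) \<longleftrightarrow> wff_in G A \<and> wff_in G B"
| "wff_in G (All T A) \<longleftrightarrow> wff_in (T # G) A"

abbreviation wff :: "fm \<Rightarrow> bool" where "wff \<equiv> wff_in []"

primrec qfree :: "fm \<Rightarrow> bool" where
  "qfree (s \<^bold>= t) \<longleftrightarrow> True"
| "qfree Fls \<longleftrightarrow> True"
| "qfree (A \<^bold>\<longrightarrow> B) \<longleftrightarrow> qfree A \<and> qfree B"
| "qfree (All T A) \<longleftrightarrow> False"

primrec fvt :: "tm \<Rightarrow> var set" where
  "fvt (Bd i) = {}"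
| "fvt (Var v) = {v}"
| "fvt Zero = {}"
| "fvt Succ = {}"
| "fvt (CK T U) = {}"
| "fvt (CS T U W) = {}"
| "fvt Rec = {}"
| "fvt (s \<cdot> t) = fvt s \<union> fvt t"

primrec fv :: "fm \<Rightarrow> var set" where
  "fv (s \<^bold>= t) = fvt s \<union> fvt t"
| "fv Fls = {}"
| "fv (A \<^bold>\<longrightarrow> B) = fv A \<union> fv B"
| "fv (All T A) = fv A"

text \<open>Simultaneous substitution for free variables. The substituted terms are meant to have
  no loose indices, so nothing can be captured and no lifting is needed.\<close>
primrec substt :: "(var \<Rightarrow> tm) \<Rightarrow> tm \<Rightarrow> tm" where
  "substt \<sigma> (Bd i) = Bd i"
| "substt \<sigma> (Var v) = \<sigma> v"
| "substt \<sigma> Zero = Zero"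
| "substt \<sigma> Succ = Succ"
| "substt \<sigma> (CK T U) = CK T U"
| "substt \<sigma> (CS T U W) = CS T U W"
| "substt \<sigma> Rec = Rec"
| "substt \<sigma> (s \<cdot> t) = substt \<sigma> s \<cdot> substt \<sigma> t"

primrec subst :: "(var \<Rightarrow> tm) \<Rightarrow> fm \<Rightarrow> fm" where
  "subst \<sigma> (s \<^bold>= t) = (substt \<sigma> s \<^bold>= substt \<sigma> t)"
| "subst \<sigma> Fls = Fls"
| "subst \<sigma> (A \<^bold>\<longrightarrow> B) = (subst \<sigma> A \<^bold>\<longrightarrow> subst \<sigma> B)"
| "subst \<sigma> (All T A) = All T (subst \<sigma> A)"

text \<open>Turning a free variable into the index of a quantifier to be put in front.\<close>
primrec closet :: "nat \<Rightarrow> var \<Rightarrow> tm \<Rightarrow> tm" where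
  "closet k v (Bd i) = Bd i"
| "closet k v (Var u) = (if u = v then Bd k else Var u)"
| "closet k v Zero = Zero"
| "closet k v Succ = Succ"
| "closet k v (CK T U) = CK T U"
| "closet k v (CS T U W) = CS T U W"
| "closet k v Rec = Rec"
| "closet k v (s \<cdot> t) = closet k v s \<cdot> closet k v t"

primrec close :: "nat \<Rightarrow> var \<Rightarrow> fm \<Rightarrow> fm" where
  "close k v (s \<^bold>= t) = (closet k v s \<^bold>= closet k v t)"
| "close k v Fls = Fls"
| "close k v (A \<^bold>\<longrightarrow> B) = (close k v A \<^bold>\<longrightarrow> close k v B)"
| "close k v (All T A) = All T (close (Suc k) v A)"

definition Allv :: "var \<Rightarrow> fm \<Rightarrow> fm" ("(3\<^bold>\<forall>_./ _)" [0, 10] 10) where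
  "(\<^bold>\<forall>v. A) = All (snd v) (close 0 v A)"

definition Neg :: "fm \<Rightarrow> fm" ("\<^bold>\<not> _" [40] 40) where
  "(\<^bold>\<not> A) = (A \<^bold>\<longrightarrow> Fls)"
definition Conj :: "fm \<Rightarrow> fm \<Rightarrow> fm" (infixr "\<^bold>\<and>" 35) where
  "(A \<^bold>\<and> B) = (\<^bold>\<not> (A \<^bold>\<longrightarrow> \<^bold>\<not> B))"
definition Disj :: "fm \<Rightarrow> fm \<Rightarrow> fm" (infixr "\<^bold>\<or>" 30) where
  "(A \<^bold>\<or> B) = (\<^bold>\<not> A \<^bold>\<longrightarrow> B)"
definition Iff :: "fm \<Rightarrow> fm \<Rightarrow> fm" (infixr "\<^bold>\<longleftrightarrow>" 25) where
  "(A \<^bold>\<longleftrightarrow> B) = ((A \<^bold>\<longrightarrow> B) \<^bold>\<and> (B \<^bold>\<longrightarrow> A))"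
definition Exv :: "var \<Rightarrow> fm \<Rightarrow> fm" ("(3\<^bold>\<exists>_./ _)" [0, 10] 10) where
  "(\<^bold>\<exists>v. A) = (\<^bold>\<not> (\<^bold>\<forall>v. \<^bold>\<not> A))"

section \<open>Provability: classical natural deduction\<close>

text \<open>Free variables of an axiom in \<open>T\<close> are read universally; the eigenvariable
  condition therefore concerns the assumptions \<open>\<Gamma>\<close> only. The premises \<open>wff A\<close> keep
  loose indices out of derivations.\<close>
inductive derives :: "fm set \<Rightarrow> fm set \<Rightarrow> fm \<Rightarrow> bool" for T where
  Ax: "A \<in> T \<Longrightarrow> derives T \<Gamma> A"
| Asm: "A \<in> \<Gamma> \<Longrightarrow> wff A \<Longrightarrow> derives T \<Gamma> A"
| ImpI: "wff A \<Longrightarrow> derives T (insert A \<Gamma>) B \<Longrightarrow> derives T \<Gamma> (A \<^bold>\<longrightarrow> B)"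
| ImpE: "derives T \<Gamma> (A \<^bold>\<longrightarrow> B) \<Longrightarrow> derives T \<Gamma> A \<Longrightarrow> derives T \<Gamma> B"
| RAA: "wff A \<Longrightarrow> derives T (insert (\<^bold>\<not> A) \<Gamma>) Fls \<Longrightarrow> derives T \<Gamma> A"
| AllI: "derives T \<Gamma> A \<Longrightarrow> \<forall>B \<in> \<Gamma>. v \<notin> fv B \<Longrightarrow> derives T \<Gamma> (\<^bold>\<forall>v. A)"
| AllE: "derives T \<Gamma> (\<^bold>\<forall>v. A) \<Longrightarrow> wff A \<Longrightarrow> typ_of [] t = Some (snd v)
    \<Longrightarrow> derives T \<Gamma> (subst (Var(v := t)) A)"

abbreviation provable :: "fm set \<Rightarrow> fm \<Rightarrow> bool" (infix "\<turnstile>" 50) where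
  "T \<turnstile> A \<equiv> derives T {} A"

section \<open>The axioms\<close>

text \<open>Equality of higher type is defined extensionally.\<close>
primrec eq_at :: "ty \<Rightarrow> tm \<Rightarrow> tm \<Rightarrow> fm" where
  "eq_at T0 s t = (s \<^bold>= t)"
| "eq_at (T \<rightarrowtail> U) s t =
    (let x = (''x'', T \<rightarrowtail> U); y = (''y'', T \<rightarrowtail> U); z = (''z'', T)
     in subst (Var(x := s, y := t)) (\<^bold>\<forall>z. eq_at U (Var x \<cdot> Var z) (Var y \<cdot> Var z)))"

inductive_set E_PRA_omega :: "fm set" where
  refl: "x = (''x'', T0) \<Longrightarrow> (Var x \<^bold>= Var x) \<in> E_PRA_omega"
| sym: "x = (''x'', T0) \<Longrightarrow> y = (''y'', T0) \<Longrightarrow>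
    (Var x \<^bold>= Var y \<^bold>\<longrightarrow> Var y \<^bold>= Var x) \<in> E_PRA_omega"
| trans: "x = (''x'', T0) \<Longrightarrow> y = (''y'', T0) \<Longrightarrow> z = (''z'', T0) \<Longrightarrow>
    (Var x \<^bold>= Var y \<^bold>\<longrightarrow> Var y \<^bold>= Var z \<^bold>\<longrightarrow> Var x \<^bold>= Var z) \<in> E_PRA_omega"
| ext: "x = (''x'', T) \<Longrightarrow> y = (''y'', T) \<Longrightarrow> z = (''z'', T \<rightarrowtail> U) \<Longrightarrow>
    (eq_at T (Var x) (Var y) \<^bold>\<longrightarrow> eq_at U (Var z \<cdot> Var x) (Var z \<cdot> Var y)) \<in> E_PRA_omega"
| Succ_nonzero: "x = (''x'', T0) \<Longrightarrow> (\<^bold>\<not> Succ \<cdot> Var x \<^bold>= Zero) \<in> E_PRA_omega"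
| Succ_inj: "x = (''x'', T0) \<Longrightarrow> y = (''y'', T0) \<Longrightarrow>
    (Succ \<cdot> Var x \<^bold>= Succ \<cdot> Var y \<^bold>\<longrightarrow> Var x \<^bold>= Var y) \<in> E_PRA_omega"
| QF_IA: "snd x = T0 \<Longrightarrow> qfree A \<Longrightarrow> wff A \<Longrightarrow>
    (subst (Var(x := Zero)) A \<^bold>\<and> (\<^bold>\<forall>x. A \<^bold>\<longrightarrow> subst (Var(x := Succ \<cdot> Var x)) A)
      \<^bold>\<longrightarrow> (\<^bold>\<forall>x. A)) \<in> E_PRA_omega"
| K: "x = (''x'', T) \<Longrightarrow> y = (''y'', U) \<Longrightarrow>
    eq_at T (CK T U \<cdot> Var x \<cdot> Var y) (Var x) \<in> E_PRA_omega"
| S: "x = (''x'', T \<rightarrowtail> U \<rightarrowtail> W) \<Longrightarrow> y = (''y'', T \<rightarrowtail> U) \<Longrightarrow> z = (''z'', T) \<Longrightarrow>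
    eq_at W (CS T U W \<cdot> Var x \<cdot> Var y \<cdot> Var z) (Var x \<cdot> Var z \<cdot> (Var y \<cdot> Var z)) \<in> E_PRA_omega"
| Rec_Zero: "y = (''y'', T0) \<Longrightarrow> z = (''z'', T0 \<rightarrowtail> T0 \<rightarrowtail> T0) \<Longrightarrow>
    (Rec \<cdot> Zero \<cdot> Var y \<cdot> Var z \<^bold>= Var y) \<in> E_PRA_omega"
| Rec_Succ: "x = (''x'', T0) \<Longrightarrow> y = (''y'', T0) \<Longrightarrow> z = (''z'', T0 \<rightarrowtail> T0 \<rightarrowtail> T0) \<Longrightarrow>
    (Rec \<cdot> (Succ \<cdot> Var x) \<cdot> Var y \<cdot> Var z
      \<^bold>= Var z \<cdot> (Rec \<cdot> Var x \<cdot> Var y \<cdot> Var z) \<cdot> Var x) \<in> E_PRA_omega"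

inductive_set QF_AC_10 :: "fm set" where
  "snd f = ty1 \<Longrightarrow> snd n = T0 \<Longrightarrow> snd G = ty2 \<Longrightarrow> G \<notin> fv A \<Longrightarrow> qfree A \<Longrightarrow> wff A \<Longrightarrow>
    ((\<^bold>\<forall>f. \<^bold>\<exists>n. A) \<^bold>\<longrightarrow> (\<^bold>\<exists>G. \<^bold>\<forall>f. subst (Var(n := Var G \<cdot> Var f)) A)) \<in> QF_AC_10"

inductive_set QF_AC_01 :: "fm set" where
  "snd n = T0 \<Longrightarrow> snd f = ty1 \<Longrightarrow> snd F = T0 \<rightarrowtail> ty1 \<Longrightarrow> F \<notin> fv A \<Longrightarrow> qfree A \<Longrightarrow> wff A \<Longrightarrow>
    ((\<^bold>\<forall>n. \<^bold>\<exists>f. A) \<^bold>\<longrightarrow> (\<^bold>\<exists>F. \<^bold>\<forall>n. subst (Var(f := Var F \<cdot> Var n)) A)) \<in> QF_AC_01"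

abbreviation One :: tm where "One \<equiv> Succ \<cdot> Zero"

definition exists2 :: fm where
  "exists2 = (let E = (''E'', ty2); f = (''f'', ty1); n = (''n'', T0) in
     \<^bold>\<exists>E. \<^bold>\<forall>f. (Var E \<cdot> Var f \<^bold>= Zero \<^bold>\<or> Var E \<cdot> Var f \<^bold>= One)
       \<^bold>\<and> ((\<^bold>\<exists>n. Var f \<cdot> Var n \<^bold>= Zero) \<^bold>\<longleftrightarrow> Var E \<cdot> Var f \<^bold>= Zero))"

definition RCA0_omega :: "fm set" where
  "RCA0_omega = E_PRA_omega \<union> QF_AC_10"

definition ACA0_omega :: "fm set" where
  "ACA0_omega = insert exists2 RCA0_omega"

section \<open>Closed terms for arithmetic\<close>

text \<open>Lambda abstraction is definable from the combinators (bracket abstraction).\<close>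
primrec lam :: "var \<Rightarrow> tm \<Rightarrow> tm" where
  "lam v (Bd i) = CK T0 (snd v) \<cdot> Bd i"
| "lam v (Var u) = (if u = v
     then CS (snd v) (snd v \<rightarrowtail> snd v) (snd v) \<cdot> CK (snd v) (snd v \<rightarrowtail> snd v) \<cdot> CK (snd v) (snd v)
     else CK (snd u) (snd v) \<cdot> Var u)"
| "lam v Zero = CK (the (typ_of [] Zero)) (snd v) \<cdot> Zero"
| "lam v Succ = CK (the (typ_of [] Succ)) (snd v) \<cdot> Succ"
| "lam v (CK T U) = CK (the (typ_of [] (CK T U))) (snd v) \<cdot> CK T U"
| "lam v (CS T U W) = CK (the (typ_of [] (CS T U W))) (snd v) \<cdot> CS T U W"
| "lam v Rec = CK (the (typ_of [] Rec)) (snd v) \<cdot> Rec"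
| "lam v (s \<cdot> t) = (if v \<notin> fvt (s \<cdot> t) then CK (the (typ_of [] (s \<cdot> t))) (snd v) \<cdot> (s \<cdot> t)
     else CS (snd v) (the (typ_of [] t)) (the (typ_of [] (s \<cdot> t))) \<cdot> lam v s \<cdot> lam v t)"

abbreviation "vi \<equiv> (''i'', T0)"
abbreviation "vj \<equiv> (''j'', T0)"
abbreviation "vk \<equiv> (''k'', T0)"
abbreviation "vm \<equiv> (''m'', T0)"
abbreviation "vn \<equiv> (''n'', T0)"
abbreviation "vN \<equiv> (''N'', T0)"
abbreviation "vp \<equiv> (''p'', T0)"
abbreviation "vq \<equiv> (''q'', T0)"
abbreviation "vx \<equiv> (''x'', ty1)"
abbreviation "vy \<equiv> (''y'', ty1)"
abbreviation "vz \<equiv> (''z'', ty1)"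
abbreviation "vf \<equiv> (''f'', ty1 \<rightarrowtail> ty1)"
abbreviation "vw \<equiv> (''w'', T0 \<rightarrowtail> ty1)"
abbreviation "vA \<equiv> (''A'', ty2)"
abbreviation "vB \<equiv> (''B'', ty2)"
abbreviation "vH \<equiv> (''H'', ty2)"

definition PLUS :: tm where
  "PLUS = lam vm (lam vn (Rec \<cdot> Var vn \<cdot> Var vm \<cdot> lam vi (lam vj (Succ \<cdot> Var vi))))"
abbreviation plus_tm (infixl "\<^bold>+" 65) where "s \<^bold>+ t \<equiv> PLUS \<cdot> s \<cdot> t"

definition TIMES :: tm where
  "TIMES = lam vm (lam vn (Rec \<cdot> Var vn \<cdot> Zero \<cdot> lam vi (lam vj (Var vi \<^bold>+ Var vm))))"
abbreviation times_tm (infixl "\<^bold>*" 70) where "s \<^bold>* t \<equiv> TIMES \<cdot> s \<cdot> t"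

definition PRED :: tm where
  "PRED = lam vn (Rec \<cdot> Var vn \<cdot> Zero \<cdot> lam vi (lam vj (Var vj)))"

text \<open>Truncated subtraction.\<close>
definition MONUS :: tm where
  "MONUS = lam vm (lam vn (Rec \<cdot> Var vn \<cdot> Var vm \<cdot> lam vi (lam vj (PRED \<cdot> Var vi))))"
abbreviation monus_tm (infixl "\<^bold>-" 65) where "s \<^bold>- t \<equiv> MONUS \<cdot> s \<cdot> t"

definition POW2 :: tm where
  "POW2 = lam vn (Rec \<cdot> Var vn \<cdot> One \<cdot> lam vi (lam vj (Var vi \<^bold>+ Var vi)))"

abbreviation le_nat (infix "\<^bold>\<le>" 55) where "s \<^bold>\<le> t \<equiv> (s \<^bold>- t \<^bold>= Zero)"
abbreviation less_nat (infix "\<^bold><" 55) where "s \<^bold>< t \<equiv> (Succ \<cdot> s \<^bold>\<le> t)"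

text \<open>Cantor pairing \<open>(m, n) \<mapsto> (m + n)(m + n + 1)/2 + m\<close>, a bijection, and its
  projections; \<open>TROOT z\<close> is the greatest \<open>r\<close> with \<open>r(r + 1)/2 \<le> z\<close>.\<close>
definition TRI :: tm where
  "TRI = lam vn (Rec \<cdot> Var vn \<cdot> Zero \<cdot> lam vi (lam vj (Var vi \<^bold>+ Succ \<cdot> Var vj)))"
definition TROOT :: tm where
  "TROOT = lam vn (Rec \<cdot> Var vn \<cdot> Zero \<cdot>
     lam vi (lam vj (Var vi \<^bold>+ (One \<^bold>- (TRI \<cdot> (Succ \<cdot> Var vi) \<^bold>- Succ \<cdot> Var vj)))))"
definition PAIR :: tm where
  "PAIR = lam vm (lam vn (TRI \<cdot> (Var vm \<^bold>+ Var vn) \<^bold>+ Var vm))"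
definition FST :: tm where
  "FST = lam vn (Var vn \<^bold>- TRI \<cdot> (TROOT \<cdot> Var vn))"
definition SND :: tm where
  "SND = lam vn (TROOT \<cdot> Var vn \<^bold>- FST \<cdot> Var vn)"

section \<open>Rational and real numbers\<close>

text \<open>Rationals are signed quotients: the code \<open>\<langle>\<langle>s, a\<rangle>, c\<rangle>\<close> stands for
  \<open>a / (c + 1)\<close> if \<open>s = 0\<close> and for \<open>- a / (c + 1)\<close> if \<open>s > 0\<close>. So every number is the code
  of a rational. \<open>POS\<close> and \<open>NEG\<close> are the positive and negative part of the signed numerator.\<close>
definition SGN :: tm where "SGN = lam vq (FST \<cdot> (FST \<cdot> Var vq))"
definition NUM :: tm where "NUM = lam vq (SND \<cdot> (FST \<cdot> Var vq))"
definition DEN :: tm where "DEN = lam vq (Succ \<cdot> (SND \<cdot> Var vq))"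
definition POS :: tm where "POS = lam vq (NUM \<cdot> Var vq \<^bold>* (One \<^bold>- SGN \<cdot> Var vq))"
definition NEG :: tm where "NEG = lam vq (NUM \<cdot> Var vq \<^bold>* (One \<^bold>- (One \<^bold>- SGN \<cdot> Var vq)))"

text \<open>\<open>p - q = (CROSS p q - CROSS q p) / (DEN p * DEN q)\<close>\<close>
definition CROSS :: tm where
  "CROSS = lam vp (lam vq
     (POS \<cdot> Var vp \<^bold>* (DEN \<cdot> Var vq) \<^bold>+ NEG \<cdot> Var vq \<^bold>* (DEN \<cdot> Var vp)))"

abbreviation lessQ (infix "<\<^sub>Q" 55) where
  "s <\<^sub>Q t \<equiv> (CROSS \<cdot> s \<cdot> t \<^bold>< CROSS \<cdot> t \<cdot> s)"
abbreviation leQ (infix "\<le>\<^sub>Q" 55) where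
  "s \<le>\<^sub>Q t \<equiv> (CROSS \<cdot> s \<cdot> t \<^bold>\<le> CROSS \<cdot> t \<cdot> s)"

definition MINUSQ :: tm where
  "MINUSQ = (let d = CROSS \<cdot> Var vp \<cdot> Var vq; e = CROSS \<cdot> Var vq \<cdot> Var vp in
     lam vp (lam vq (PAIR \<cdot> (PAIR \<cdot> (e \<^bold>- d) \<cdot> ((d \<^bold>- e) \<^bold>+ (e \<^bold>- d)))
       \<cdot> (PRED \<cdot> (DEN \<cdot> Var vp \<^bold>* (DEN \<cdot> Var vq))))))"
abbreviation minusQ (infixl "-\<^sub>Q" 65) where "s -\<^sub>Q t \<equiv> MINUSQ \<cdot> s \<cdot> t"

definition ABSQ :: tm where
  "ABSQ = lam vq (PAIR \<cdot> (PAIR \<cdot> Zero \<cdot> (NUM \<cdot> Var vq)) \<cdot> (SND \<cdot> Var vq))"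

text \<open>The rational \<open>m / 2^n\<close>.\<close>
definition DYADIC :: tm where
  "DYADIC = lam vm (lam vn
     (PAIR \<cdot> (PAIR \<cdot> Zero \<cdot> Var vm) \<cdot> (PRED \<cdot> (POW2 \<cdot> Var vn))))"

text \<open>\<open>|q\<^sub>n - q\<^sub>n\<^sub>+\<^sub>i| < 1 / 2^n\<close> for all \<open>n\<close>, \<open>i\<close>. Quantifiers
  over reals are relativised to this predicate.\<close>
definition is_real :: "tm \<Rightarrow> fm" where
  "is_real s = subst (Var(vx := s)) (\<^bold>\<forall>vn. \<^bold>\<forall>vi.
     ABSQ \<cdot> (Var vx \<cdot> Var vn -\<^sub>Q Var vx \<cdot> (Var vn \<^bold>+ Var vi)) <\<^sub>Q DYADIC \<cdot> One \<cdot> Var vn)"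

text \<open>\<open>|q\<^sub>n - r\<^sub>n| \<le> 2^(-n+1)\<close> for all \<open>n\<close>\<close>
definition eqR :: "tm \<Rightarrow> tm \<Rightarrow> fm" (infix "=\<^sub>R" 55) where
  "(s =\<^sub>R t) = subst (Var(vx := s, vy := t)) (\<^bold>\<forall>vn.
     ABSQ \<cdot> (Var vx \<cdot> Var vn -\<^sub>Q Var vy \<cdot> Var vn) \<le>\<^sub>Q DYADIC \<cdot> (Succ \<cdot> One) \<cdot> Var vn)"

text \<open>\<open>r\<^sub>n - q\<^sub>n > 2^(-n+1)\<close> for some \<open>n\<close>\<close>
definition lessR :: "tm \<Rightarrow> tm \<Rightarrow> fm" (infix "<\<^sub>R" 55) where
  "(s <\<^sub>R t) = subst (Var(vx := s, vy := t)) (\<^bold>\<exists>vn.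
     DYADIC \<cdot> (Succ \<cdot> One) \<cdot> Var vn <\<^sub>Q Var vy \<cdot> Var vn -\<^sub>Q Var vx \<cdot> Var vn)"

abbreviation leR (infix "\<le>\<^sub>R" 55) where "s \<le>\<^sub>R t \<equiv> \<^bold>\<not> t <\<^sub>R s"

text \<open>The index shift makes the difference a fast-converging sequence again.\<close>
definition MINUSR :: tm where
  "MINUSR = lam vx (lam vy (lam vn
     (Var vx \<cdot> (Succ \<cdot> Var vn) -\<^sub>Q Var vy \<cdot> (Succ \<cdot> Var vn))))"
definition ABSR :: tm where
  "ABSR = lam vx (lam vn (ABSQ \<cdot> (Var vx \<cdot> Var vn)))"
abbreviation distR :: "tm \<Rightarrow> tm \<Rightarrow> tm" where
  "distR s t \<equiv> ABSR \<cdot> (MINUSR \<cdot> s \<cdot> t)"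

definition RATR :: tm where "RATR = lam vq (lam vn (Var vq))"
abbreviation "zeroR \<equiv> RATR \<cdot> (DYADIC \<cdot> Zero \<cdot> Zero)"
abbreviation "oneR \<equiv> RATR \<cdot> (DYADIC \<cdot> One \<cdot> Zero)"
text \<open>The real \<open>1 / 2^k\<close>.\<close>
abbreviation epsR :: "tm \<Rightarrow> tm" where "epsR k \<equiv> RATR \<cdot> (DYADIC \<cdot> One \<cdot> k)"

definition in_unit :: "tm \<Rightarrow> fm" where
  "in_unit s = (is_real s \<^bold>\<and> zeroR \<le>\<^sub>R s \<^bold>\<and> s \<le>\<^sub>R oneR)"

section \<open>Regulated functions on the unit interval\<close>

definition unit_function :: "tm \<Rightarrow> fm" where
  "unit_function s = subst (Var(vf := s))
    ((\<^bold>\<forall>vx. in_unit (Var vx) \<^bold>\<longrightarrow> is_real (Var vf \<cdot> Var vx))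
     \<^bold>\<and> (\<^bold>\<forall>vx. \<^bold>\<forall>vy. in_unit (Var vx) \<^bold>\<and> in_unit (Var vy) \<^bold>\<and> Var vx =\<^sub>R Var vy
          \<^bold>\<longrightarrow> Var vf \<cdot> Var vx =\<^sub>R Var vf \<cdot> Var vy))"

text \<open>\<open>y\<close> is the left (right) limit of \<open>f\<close> at \<open>x\<close>. As \<open>z\<close> ranges over the unit interval,
  these conditions are void for the left limit at 0 and the right limit at 1.\<close>
definition left_limit :: "tm \<Rightarrow> tm \<Rightarrow> tm \<Rightarrow> fm" where
  "left_limit f x y = subst (Var(vf := f, vx := x, vy := y))
    (\<^bold>\<forall>vk. \<^bold>\<exists>vN. \<^bold>\<forall>vz. in_unit (Var vz) \<^bold>\<and> Var vz <\<^sub>R Var vx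
        \<^bold>\<and> distR (Var vx) (Var vz) <\<^sub>R epsR (Var vN)
      \<^bold>\<longrightarrow> distR (Var vf \<cdot> Var vz) (Var vy) <\<^sub>R epsR (Var vk))"

definition right_limit :: "tm \<Rightarrow> tm \<Rightarrow> tm \<Rightarrow> fm" where
  "right_limit f x y = subst (Var(vf := f, vx := x, vy := y))
    (\<^bold>\<forall>vk. \<^bold>\<exists>vN. \<^bold>\<forall>vz. in_unit (Var vz) \<^bold>\<and> Var vx <\<^sub>R Var vz
        \<^bold>\<and> distR (Var vx) (Var vz) <\<^sub>R epsR (Var vN)
      \<^bold>\<longrightarrow> distR (Var vf \<cdot> Var vz) (Var vy) <\<^sub>R epsR (Var vk))"

definition regulated :: "tm \<Rightarrow> fm" where
  "regulated f = subst (Var(vf := f))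
    (\<^bold>\<forall>vx. in_unit (Var vx) \<^bold>\<longrightarrow>
       (\<^bold>\<exists>vy. is_real (Var vy) \<^bold>\<and> left_limit (Var vf) (Var vx) (Var vy))
       \<^bold>\<and> (\<^bold>\<exists>vy. is_real (Var vy) \<^bold>\<and> right_limit (Var vf) (Var vx) (Var vy)))"

definition continuous_at :: "tm \<Rightarrow> tm \<Rightarrow> fm" where
  "continuous_at f x = subst (Var(vf := f, vx := x))
    (\<^bold>\<forall>vk. \<^bold>\<exists>vN. \<^bold>\<forall>vz. in_unit (Var vz) \<^bold>\<and> distR (Var vx) (Var vz) <\<^sub>R epsR (Var vN)
      \<^bold>\<longrightarrow> distR (Var vf \<cdot> Var vx) (Var vf \<cdot> Var vz) <\<^sub>R epsR (Var vk))"

definition regulated_has_continuity_point :: fm where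
  "regulated_has_continuity_point =
    (\<^bold>\<forall>vf. unit_function (Var vf) \<^bold>\<and> regulated (Var vf)
      \<^bold>\<longrightarrow> (\<^bold>\<exists>vx. in_unit (Var vx) \<^bold>\<and> continuous_at (Var vf) (Var vx)))"

section \<open>Height-countable sets of reals\<close>

abbreviation mem :: "tm \<Rightarrow> tm \<Rightarrow> fm" (infix "\<^bold>\<in>" 55) where
  "s \<^bold>\<in> A \<equiv> (A \<cdot> s \<^bold>= One)"

text \<open>\<open>H\<close> is a function from the reals to the natural numbers.\<close>
definition real_to_nat :: "tm \<Rightarrow> fm" where
  "real_to_nat H = subst (Var(vH := H))
    (\<^bold>\<forall>vx. \<^bold>\<forall>vy. is_real (Var vx) \<^bold>\<and> is_real (Var vy) \<^bold>\<and> Var vx =\<^sub>R Var vy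
      \<^bold>\<longrightarrow> Var vH \<cdot> Var vx \<^bold>= Var vH \<cdot> Var vy)"

text \<open>\<open>A\<close> is the characteristic function of a set of reals.\<close>
definition real_set :: "tm \<Rightarrow> fm" where
  "real_set A = subst (Var(vA := A))
    (real_to_nat (Var vA)
     \<^bold>\<and> (\<^bold>\<forall>vx. is_real (Var vx) \<^bold>\<longrightarrow> Var vA \<cdot> Var vx \<^bold>= Zero \<^bold>\<or> Var vA \<cdot> Var vx \<^bold>= One))"

text \<open>The finite sequence \<open>(x\<^sub>0, \<dots>, x\<^sub>N)\<close> is given by the values at \<open>i \<le> N\<close> of
  an object \<open>w\<close> of type \<open>T0 \<rightarrowtail> ty1\<close>.\<close>
definition finite_set :: "tm \<Rightarrow> fm" where
  "finite_set A = subst (Var(vA := A))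
    (\<^bold>\<exists>vN. \<^bold>\<forall>vw.
       (\<^bold>\<forall>vi. Var vi \<^bold>\<le> Var vN \<^bold>\<longrightarrow> is_real (Var vw \<cdot> Var vi))
       \<^bold>\<and> (\<^bold>\<forall>vi. \<^bold>\<forall>vj. Var vi \<^bold>\<le> Var vN \<^bold>\<and> Var vj \<^bold>\<le> Var vN \<^bold>\<and> \<^bold>\<not> Var vi \<^bold>= Var vj
            \<^bold>\<longrightarrow> \<^bold>\<not> Var vw \<cdot> Var vi =\<^sub>R Var vw \<cdot> Var vj)
       \<^bold>\<longrightarrow> (\<^bold>\<exists>vi. Var vi \<^bold>\<le> Var vN \<^bold>\<and> \<^bold>\<not> Var vw \<cdot> Var vi \<^bold>\<in> Var vA))"

text \<open>The set \<open>B\<close> below is \<open>{x \<in> A. H x < n}\<close>.\<close>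
definition height_function :: "tm \<Rightarrow> tm \<Rightarrow> fm" where
  "height_function H A = subst (Var(vH := H, vA := A))
    (real_to_nat (Var vH)
     \<^bold>\<and> (\<^bold>\<forall>vn. \<^bold>\<exists>vB. real_set (Var vB)
          \<^bold>\<and> (\<^bold>\<forall>vx. is_real (Var vx) \<^bold>\<longrightarrow>
               (Var vx \<^bold>\<in> Var vB \<^bold>\<longleftrightarrow> Var vx \<^bold>\<in> Var vA \<^bold>\<and> Var vH \<cdot> Var vx \<^bold>< Var vn))
          \<^bold>\<and> finite_set (Var vB)))"

definition height_countable :: "tm \<Rightarrow> fm" where
  "height_countable A = subst (Var(vA := A)) (\<^bold>\<exists>vH. height_function (Var vH) (Var vA))"

definition NIN_alt :: fm where
  "NIN_alt = (\<^bold>\<forall>vA. real_set (Var vA)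
      \<^bold>\<and> (\<^bold>\<forall>vx. is_real (Var vx) \<^bold>\<longrightarrow> (Var vx \<^bold>\<in> Var vA \<^bold>\<longleftrightarrow> in_unit (Var vx)))
    \<^bold>\<longrightarrow> \<^bold>\<not> height_countable (Var vA))"

end

theory Submission
  imports Defs "HOL-Library.Countable" "HOL-Computational_Algebra.Fraction_Field"
begin

text \<open>
  If the equivalence were unprovable, it would fail in an extensional Henkin model of the axioms.
  In such a model the functional of \<open>(\<exists>\<^sup>2)\<close> turns arithmetical formulas into terms, which yields
  arithmetical comprehension, induction and choice. The possibly nonstandard numbers of the model
  generate an ordered field, and its Cauchy completion contains the values of the reals of the
  model, so that analysis can be carried out in an ordered ring.

  A height function \<open>H\<close> for \<open>[0,1]\<close> makes \<open>2^-H\<close> a regulated function all of whose one-sided limits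
  are \<open>0\<close>, hence a nowhere continuous one. Conversely, if \<open>f\<close> is regulated and nowhere continuous, map
  \<open>x\<close> to the least \<open>k\<close> such that \<open>f\<close> jumps by more than \<open>2^-k\<close> at \<open>x\<close>. If the points of height below \<open>h\<close>
  did not form a finite set, choice would give sets \<open>W\<^sub>n\<close> of \<open>n + 1\<close> such points for all \<open>n\<close>. They
  cluster at the infimum of the dyadic rationals \<open>q\<close> for which the number of elements of \<open>W\<^sub>n\<close> below
  \<open>q\<close> is unbounded in \<open>n\<close>, contradicting the existence of one-sided limits there.
\<close>

section \<open>Locally nameless syntax\<close>

text \<open>A formal derivation would have to code all of arithmetic and analysis as formulas; in a
  model this work becomes ordinary mathematics. The language of the model is still needed at one
  kind of place: whoever wants induction, a least number or a choice sequence must exhibit an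
  arithmetical formula, since external induction fails on nonstandard numbers and external choice
  yields functions that the model need not contain. Estimates, signs and limits are instead treated
  externally, by ordered-ring reasoning about values in the completion. That reasoning rests on type
  classes, so the numbers have to form a HOL type, although they are a set that depends on a
  hypothetical countermodel. Hence the analysis is carried out for an abstract ordered semidomain
  with an embedding into the model; at the end the countermodel is fixed as a global constant and
  its numbers are made into a type. Only an ordered ring is established for the completion, because
  no real number is ever divided.\<close>

instance ty :: countable by countable_datatype
instance tm :: countable by countable_datatype
instance fm :: countable by countable_datatype

primrec opent :: "nat \<Rightarrow> tm \<Rightarrow> tm \<Rightarrow> tm" where
  "opent k u (Bd i) = (if i = k then u else Bd i)"
| "opent k u (Var v) = Var v"
| "opent k u Zero = Zero"
| "opent k u Succ = Succ"
| "opent k u (CK T U) = CK T U"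
| "opent k u (CS T U W) = CS T U W"
| "opent k u Rec = Rec"
| "opent k u (s \<cdot> t) = opent k u s \<cdot> opent k u t"

primrec openf :: "nat \<Rightarrow> tm \<Rightarrow> fm \<Rightarrow> fm" where
  "openf k u (s \<^bold>= t) = (opent k u s \<^bold>= opent k u t)"
| "openf k u Fls = Fls"
| "openf k u (A \<^bold>\<longrightarrow> B) = (openf k u A \<^bold>\<longrightarrow> openf k u B)"
| "openf k u (All T A) = All T (openf (Suc k) u A)"

primrec lct :: "nat \<Rightarrow> tm \<Rightarrow> bool" where
  "lct k (Bd i) \<longleftrightarrow> i < k"
| "lct k (Var v) \<longleftrightarrow> True"
| "lct k Zero \<longleftrightarrow> True"
| "lct k Succ \<longleftrightarrow> True"
| "lct k (CK T U) \<longleftrightarrow> True"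
| "lct k (CS T U W) \<longleftrightarrow> True"
| "lct k Rec \<longleftrightarrow> True"
| "lct k (s \<cdot> t) \<longleftrightarrow> lct k s \<and> lct k t"

primrec lcf :: "nat \<Rightarrow> fm \<Rightarrow> bool" where
  "lcf k (s \<^bold>= t) \<longleftrightarrow> lct k s \<and> lct k t"
| "lcf k Fls \<longleftrightarrow> True"
| "lcf k (A \<^bold>\<longrightarrow> B) \<longleftrightarrow> lcf k A \<and> lcf k B"
| "lcf k (All T A) \<longleftrightarrow> lcf (Suc k) A"

lemma typ_of_AppD:
  assumes "typ_of G (s \<cdot> t) = Some U"
  obtains T where "typ_of G s = Some (T \<rightarrowtail> U)" "typ_of G t = Some T"
  using assms by (auto split: option.splits ty.splits if_splits)

lemma typ_of_AppI:
  "typ_of G s = Some (T \<rightarrowtail> U) \<Longrightarrow> typ_of G t = Some T \<Longrightarrow> typ_of G (s \<cdot> t) = Some U"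
  by simp

lemma typ_of_lct: "typ_of G t = Some T \<Longrightarrow> lct (length G) t"
  by (induction t arbitrary: T) (auto elim: typ_of_AppD simp del: typ_of.simps(8) split: if_splits)

lemma wff_in_lcf: "wff_in G A \<Longrightarrow> lcf (length G) A"
  by (induction A arbitrary: G) (use typ_of_lct in fastforce)+

lemma wff_lcf: "wff A \<Longrightarrow> lcf 0 A"
  using wff_in_lcf[of "[]"] by simp

lemma typ_lct: "typ_of [] t = Some T \<Longrightarrow> lct 0 t"
  using typ_of_lct[of "[]"] by simp

lemma lct_mono: "lct k t \<Longrightarrow> k \<le> m \<Longrightarrow> lct m t"
  by (induction t) auto

lemma opent_lct: "lct k t \<Longrightarrow> opent k u t = t"
  by (induction t) auto

lemma closet_opent: "v \<notin> fvt t \<Longrightarrow> closet k v (opent k (Var v) t) = t"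
  by (induction t) auto

lemma close_openf: "v \<notin> fv A \<Longrightarrow> close k v (openf k (Var v) A) = A"
  by (induction A arbitrary: k) (auto simp: closet_opent)

text \<open>Instantiating a bound variable amounts to updating the substitution at one variable.
  Substitutions thereby play the role that assignments play in a model, which is what the term model
  needs.\<close>

lemma opent_substt_closet:
  "lct k t \<Longrightarrow> \<forall>w. lct 0 (\<sigma> w) \<Longrightarrow> opent k u (substt \<sigma> (closet k v t)) = substt (\<sigma>(v := u)) t"
  by (induction t) (auto intro!: opent_lct intro: lct_mono)

lemma openf_subst_close:
  "lcf k A \<Longrightarrow> \<forall>w. lct 0 (\<sigma> w) \<Longrightarrow> openf k u (subst \<sigma> (close k v A)) = subst (\<sigma>(v := u)) A"
  by (induction A arbitrary: k) (auto simp: opent_substt_closet)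

lemma substt_Var [simp]: "substt Var t = t"
  by (induction t) auto

lemma subst_Var [simp]: "subst Var A = A"
  by (induction A) auto

lemma substt_substt: "substt \<sigma> (substt \<tau> t) = substt (\<lambda>v. substt \<sigma> (\<tau> v)) t"
  by (induction t) auto

lemma subst_subst: "subst \<sigma> (subst \<tau> A) = subst (\<lambda>v. substt \<sigma> (\<tau> v)) A"
  by (induction A) (auto simp: substt_substt)

lemma finite_fvt [simp]: "finite (fvt t)"
  by (induction t) auto

lemma finite_fv [simp]: "finite (fv A)"
  by (induction A) auto

lemma substt_cong: "\<forall>v\<in>fvt t. \<sigma> v = \<tau> v \<Longrightarrow> substt \<sigma> t = substt \<tau> t"
  by (induction t) auto

lemma subst_cong: "\<forall>v\<in>fv A. \<sigma> v = \<tau> v \<Longrightarrow> subst \<sigma> A = subst \<tau> A"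
  by (induction A) (auto intro: substt_cong)

lemma typ_of_weaken: "typ_of [] t = Some T \<Longrightarrow> typ_of G t = Some T"
  by (induction t arbitrary: T) (auto elim!: typ_of_AppD simp del: typ_of.simps(8) intro: typ_of_AppI)

lemma typ_of_substt:
  "typ_of G t = Some T \<Longrightarrow> \<forall>v\<in>fvt t. typ_of [] (\<sigma> v) = Some (snd v)
    \<Longrightarrow> typ_of G (substt \<sigma> t) = Some T"
  by (induction t arbitrary: T)
    (auto elim!: typ_of_AppD simp del: typ_of.simps(8) intro: typ_of_AppI typ_of_weaken)

lemma wff_in_subst:
  "wff_in G A \<Longrightarrow> \<forall>v\<in>fv A. typ_of [] (\<sigma> v) = Some (snd v) \<Longrightarrow> wff_in G (subst \<sigma> A)"
  by (induction A arbitrary: G) (auto intro: typ_of_substt)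

lemma typ_of_closet:
  "typ_of G t = Some T \<Longrightarrow> typ_of (G @ [snd v]) (closet (length G) v t) = Some T"
  by (induction t arbitrary: T)
    (auto elim!: typ_of_AppD simp del: typ_of.simps(8) intro: typ_of_AppI
      simp: nth_append split: if_splits)

lemma wff_in_close: "wff_in G A \<Longrightarrow> wff_in (G @ [snd v]) (close (length G) v A)"
proof (induction A arbitrary: G)
  case (All T A)
  show ?case using All.IH[of "T # G"] All.prems by simp
qed (auto intro: typ_of_closet)

lemma wff_Allv: "wff A \<Longrightarrow> wff (\<^bold>\<forall>v. A)"
  using wff_in_close[of "[]" A v] by (simp add: Allv_def)

lemma typ_of_opent:
  "typ_of (G @ [U]) t = Some T \<Longrightarrow> typ_of [] u = Some U \<Longrightarrow> typ_of G (opent (length G) u t) = Some T"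
proof (induction t arbitrary: T)
  case (Bd i)
  then show ?case
    by (auto simp: nth_append less_Suc_eq split: if_splits intro: typ_of_weaken)
qed (auto elim!: typ_of_AppD simp del: typ_of.simps(8) intro: typ_of_AppI)

lemma wff_in_openf:
  "wff_in (G @ [U]) A \<Longrightarrow> typ_of [] u = Some U \<Longrightarrow> wff_in G (openf (length G) u A)"
proof (induction A arbitrary: G)
  case (All T A)
  show ?case using All.IH[of "T # G"] All.prems by simp
qed (auto intro: typ_of_opent)

lemma wff_openf: "wff (All U A) \<Longrightarrow> typ_of [] u = Some U \<Longrightarrow> wff (openf 0 u A)"
  using wff_in_openf[of "[]" U A u] by simp

lemma size_openf [simp]: "size (openf k u A) = size A"
  by (induction A arbitrary: k) auto

lemma ex_fresh:
  assumes "finite X"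
  shows "\<exists>v::var. snd v = T \<and> v \<notin> X"
proof -
  have "infinite (range (\<lambda>s::string. (s, T)))"
    by (simp add: finite_image_iff inj_on_def infinite_UNIV_listI)
  then have "\<exists>v \<in> range (\<lambda>s::string. (s, T)). v \<notin> X"
    using assms by (meson finite_subset subsetI)
  then show ?thesis by auto
qed

text \<open>The quantifier rules of the calculus speak of \<open>Allv\<close> only, so a raw
  \<open>All U A\<close> has to be presented with a fresh named variable before they apply.\<close>

lemma All_eq_Allv:
  assumes "v \<notin> fv A" "snd v = U"
  shows "All U A = (\<^bold>\<forall>v. openf 0 (Var v) A)"
  using assms by (simp add: Allv_def close_openf)

lemma substt_opent_fresh:
  "v \<notin> fvt t \<Longrightarrow> substt (Var(v := u)) (opent k (Var v) t) = opent k u t"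
  by (induction t) auto

lemma subst_openf_fresh:
  "v \<notin> fv A \<Longrightarrow> subst (Var(v := u)) (openf k (Var v) A) = openf k u A"
  by (induction A arbitrary: k) (auto simp: substt_opent_fresh)

lemma wff_Neg [simp]: "wff_in G (\<^bold>\<not> A) \<longleftrightarrow> wff_in G A"
  by (simp add: Neg_def)

section \<open>Maximal consistent sets\<close>

text \<open>Weakening fails for \<^const>\<open>derives\<close>: an axiom is available only for its own free variables, which
  cannot be generalized once they occur in the assumptions. Hence consistency of a list of
  assumptions is expressed by an implication that is not provable from no assumptions.\<close>

abbreviation imps :: "fm list \<Rightarrow> fm \<Rightarrow> fm" where
  "imps As B \<equiv> foldr Imp As B"

lemma wff_imps: "wff (imps As B) \<longleftrightarrow> (\<forall>A\<in>set As. wff A) \<and> wff B"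
  by (induction As) auto

lemma derives_imps:
  "\<forall>A\<in>set As. wff A \<Longrightarrow> derives T (set As \<union> \<Gamma>) B \<Longrightarrow> derives T \<Gamma> (imps As B)"
proof (induction As arbitrary: \<Gamma>)
  case (Cons A As)
  have "derives T (insert A \<Gamma>) (imps As B)"
    using Cons by (intro Cons.IH) auto
  then show ?case using Cons.prems by (auto intro: derives.ImpI)
qed simp

text \<open>Theorems cannot be moved into a context. They are therefore assumed there, and the
  resulting implication is detached outside, where the context is empty.\<close>

lemma provable_cut:
  assumes "T \<turnstile> X" "T \<turnstile> Y" "wff X" "wff Y" "derives T {X, Y} Z"
  shows "T \<turnstile> Z"
proof -
  have "T \<turnstile> imps [X, Y] Z" using assms by (intro derives_imps) auto
  then show ?thesis using assms by (auto intro: derives.ImpE)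
qed

lemma derives_contra:
  "A \<in> \<Gamma> \<Longrightarrow> (\<^bold>\<not> A) \<in> \<Gamma> \<Longrightarrow> wff A \<Longrightarrow> derives T \<Gamma> Fls"
  by (rule derives.ImpE[of _ _ A]) (auto intro: derives.Asm simp: Neg_def)

text \<open>With \<open>Z\<close> as the refutation of a list of assumptions, this says that a
  consistent list remains consistent when \<open>A\<close> or its negation is added.\<close>

lemma provable_cases:
  assumes "T \<turnstile> (A \<^bold>\<longrightarrow> Z)" "T \<turnstile> (\<^bold>\<not> A \<^bold>\<longrightarrow> Z)" "wff A" "wff Z"
  shows "T \<turnstile> Z"
proof (rule provable_cut[OF assms(1,2)])
  let ?G = "{A \<^bold>\<longrightarrow> Z, \<^bold>\<not> A \<^bold>\<longrightarrow> Z}"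
  have Z: "derives T \<Delta> Z" if "(B \<^bold>\<longrightarrow> Z) \<in> \<Delta>" "derives T \<Delta> B" "wff B" for \<Delta> B
    using that assms by (intro derives.ImpE[of _ _ B Z]) (auto intro: derives.Asm)
  show "derives T ?G Z"
  proof (rule derives.RAA[OF assms(4)])
    let ?D = "insert (\<^bold>\<not> Z) ?G"
    have nZ: "derives T \<Delta> Fls" if "derives T \<Delta> Z" "(\<^bold>\<not> Z) \<in> \<Delta>" for \<Delta>
      using that assms by (intro derives.ImpE[of _ _ Z Fls]) (auto intro: derives.Asm simp: Neg_def)
    have "derives T (insert A ?D) Z"
      using assms by (intro Z[of A]) (auto intro: derives.Asm)
    then have "derives T ?D (\<^bold>\<not> A)"
      unfolding Neg_def[of A] using assms by (intro derives.ImpI nZ) auto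
    then show "derives T ?D Fls"
      using assms by (intro nZ Z[of "\<^bold>\<not> A"]) auto
  qed
qed (use assms in auto)

text \<open>Think of \<open>Z\<close> as the refutation of a list that contains the negation of
  \<open>All U B\<close>: naming a counterexample by a fresh variable cannot make the list
  inconsistent. By contraposition the negation of \<open>Z\<close> yields the opened
  \<open>B\<close>, and since \<open>w\<close> is fresh it yields \<open>All U B\<close>, which
  gives \<open>Z\<close> again.\<close>

lemma provable_witness:
  assumes "T \<turnstile> (\<^bold>\<not> openf 0 (Var w) B \<^bold>\<longrightarrow> Z)" "w \<notin> fv B" "w \<notin> fv Z" "snd w = U"
    "wff (All U B)" "wff Z" "T \<turnstile> (All U B \<^bold>\<longrightarrow> Z)"
  shows "T \<turnstile> Z"
proof -
  let ?b = "openf 0 (Var w) B"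
  have wb: "wff ?b" using assms by (intro wff_openf[of U]) auto
  \<comment> \<open>The generalization takes place without assumptions, where the eigenvariable
    condition is void.\<close>
  have "T \<turnstile> (\<^bold>\<forall>w. \<^bold>\<not> Z \<^bold>\<longrightarrow> ?b)"
  proof (rule derives.AllI)
    show "T \<turnstile> (\<^bold>\<not> Z \<^bold>\<longrightarrow> ?b)"
    proof (rule provable_cut[OF assms(1,1)])
      let ?G = "{\<^bold>\<not> ?b \<^bold>\<longrightarrow> Z, \<^bold>\<not> ?b \<^bold>\<longrightarrow> Z}"
      let ?D = "insert (\<^bold>\<not> ?b) (insert (\<^bold>\<not> Z) ?G)"
      have "derives T ?D Z"
        using assms wb by (intro derives.ImpE[of _ _ "\<^bold>\<not> ?b" Z] derives.Asm) auto
      then have "derives T ?D Fls"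
        using assms wb by (intro derives.ImpE[of _ _ Z Fls]) (auto intro: derives.Asm simp: Neg_def)
      then show "derives T ?G (\<^bold>\<not> Z \<^bold>\<longrightarrow> ?b)"
        using assms wb by (intro derives.ImpI derives.RAA[of ?b]) auto
    qed (use assms wb in auto)
  qed simp
  then have "T \<turnstile> (\<^bold>\<not> Z \<^bold>\<longrightarrow> All U B)"
  proof (rule provable_cut[OF _ assms(7)])
    let ?X = "\<^bold>\<forall>w. \<^bold>\<not> Z \<^bold>\<longrightarrow> ?b"
    let ?D = "insert (\<^bold>\<not> Z) {?X, All U B \<^bold>\<longrightarrow> Z}"
    have wX: "wff ?X" using assms wb by (intro wff_Allv) simp
    show "wff ?X" by fact
    \<comment> \<open>Instantiating \<open>w\<close> by itself removes the quantifier, so that the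
      antecedent, which does not contain \<open>w\<close>, can be detached before \<open>w\<close>
      is generalized again.\<close>
    have "derives T ?D (subst (Var(w := Var w)) (\<^bold>\<not> Z \<^bold>\<longrightarrow> ?b))"
      using assms wb wX by (intro derives.AllE derives.Asm) auto
    then have "derives T ?D ?b"
      using assms wb by (intro derives.ImpE[of _ _ "\<^bold>\<not> Z" ?b]) (auto intro: derives.Asm)
    then have "derives T ?D (\<^bold>\<forall>w. ?b)"
    proof (rule derives.AllI)
      have "v \<notin> fv (\<^bold>\<forall>v. A)" for v A
      proof -
        have t: "v \<notin> fvt (closet k v t)" for t k by (induction t) auto
        have "v \<notin> fv (close k v A)" for k by (induction A arbitrary: k) (auto simp: t)
        then show ?thesis by (simp add: Allv_def)
      qed
      then show "\<forall>B\<in>?D. w \<notin> fv B" using assms by (auto simp: Neg_def)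
    qed
    then show "derives T {?X, All U B \<^bold>\<longrightarrow> Z} (\<^bold>\<not> Z \<^bold>\<longrightarrow> All U B)"
      using assms by (intro derives.ImpI) (auto simp: All_eq_Allv[of w B U])
  qed (use assms in auto)
  then show ?thesis
  proof (rule provable_cut[OF _ assms(7)])
    let ?G = "{\<^bold>\<not> Z \<^bold>\<longrightarrow> All U B, All U B \<^bold>\<longrightarrow> Z}"
    let ?D = "insert (\<^bold>\<not> Z) ?G"
    have "derives T ?D (All U B)"
      using assms by (intro derives.ImpE[of _ _ "\<^bold>\<not> Z" "All U B"] derives.Asm) auto
    then have "derives T ?D Z"
      using assms by (intro derives.ImpE[of _ _ "All U B" Z]) (auto intro: derives.Asm)
    then have "derives T ?D Fls"
      using assms by (intro derives.ImpE[of _ _ Z Fls]) (auto intro: derives.Asm simp: Neg_def)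
    then show "derives T ?G Z" using assms by (intro derives.RAA[of Z]) auto
  qed (use assms in auto)
qed

definition consistent :: "fm set \<Rightarrow> fm list \<Rightarrow> bool" where
  "consistent T As \<longleftrightarrow> (\<forall>A\<in>set As. wff A) \<and> \<not> T \<turnstile> imps As Fls"

lemma consistent_derives: "consistent T As \<Longrightarrow> \<not> derives T (set As) Fls"
  using derives_imps[of As T "{}" Fls] by (auto simp: consistent_def)

definition fresh_var :: "ty \<Rightarrow> fm list \<Rightarrow> var" where
  "fresh_var U As = (SOME v. snd v = U \<and> v \<notin> (\<Union>A\<in>set As. fv A))"

lemma fresh_var: "snd (fresh_var U As) = U" "A \<in> set As \<Longrightarrow> fresh_var U As \<notin> fv A"
proof -
  have "snd (fresh_var U As) = U \<and> fresh_var U As \<notin> (\<Union>A\<in>set As. fv A)"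
    unfolding fresh_var_def by (rule someI_ex) (rule ex_fresh, simp)
  then show "snd (fresh_var U As) = U" "A \<in> set As \<Longrightarrow> fresh_var U As \<notin> fv A" by auto
qed

text \<open>Equation patterns need constructors, so a negated universal formula appears as an
  implication with conclusion \<open>Fls\<close>.\<close>

fun add_witness :: "fm \<Rightarrow> fm list \<Rightarrow> fm list" where
  "add_witness (All U B \<^bold>\<longrightarrow> Fls) As = (\<^bold>\<not> openf 0 (Var (fresh_var U (All U B # As))) B) # As"
| "add_witness A As = As"

lemma consistent_add_witness:
  assumes "consistent T As" "A \<in> set As"
  shows "consistent T (add_witness A As)"
proof (cases "\<exists>U B. A = (All U B \<^bold>\<longrightarrow> Fls)")
  case True
  then obtain U B where A: "A = (All U B \<^bold>\<longrightarrow> Fls)" by blast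
  let ?w = "fresh_var U (All U B # As)"
  have fr: "?w \<notin> fv B" "?w \<notin> fv (imps As Fls)" "snd ?w = U"
  proof -
    have "fv (imps Bs Fls) = (\<Union>B\<in>set Bs. fv B)" for Bs by (induction Bs) auto
    then show "?w \<notin> fv (imps As Fls)" using fresh_var(2)[of _ "All U B # As" U] by auto
    show "?w \<notin> fv B" using fresh_var(2)[of "All U B" "All U B # As" U] by auto
  qed (rule fresh_var)
  have w: "wff (All U B)" "\<forall>A\<in>set As. wff A" using assms A by (auto simp: consistent_def)
  have "derives T (insert (All U B) (set As)) Fls"
    using assms A w by (intro derives_contra[of "All U B"]) (auto simp: Neg_def)
  then have "T \<turnstile> imps (All U B # As) Fls" using w by (intro derives_imps) auto
  then have "T \<turnstile> (\<^bold>\<not> openf 0 (Var ?w) B \<^bold>\<longrightarrow> imps As Fls) \<Longrightarrow> T \<turnstile> imps As Fls"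
    using w fr by (intro provable_witness[of T ?w B "imps As Fls" U]) (auto simp: wff_imps)
  moreover have "wff (openf 0 (Var ?w) B)" using w fr by (intro wff_openf[of U]) auto
  ultimately show ?thesis using assms A w by (auto simp: consistent_def)
next
  case False
  then have "add_witness A As = As" by (cases "(A, As)" rule: add_witness.cases) auto
  then show ?thesis using assms by simp
qed

definition extend :: "fm set \<Rightarrow> fm \<Rightarrow> fm list \<Rightarrow> fm list" where
  "extend T A As = (if \<not> wff A then As else
     let C = (if consistent T (A # As) then A else \<^bold>\<not> A) in add_witness C (C # As))"

lemma consistent_extend:
  assumes "consistent T As" shows "consistent T (extend T A As)"
proof (cases "wff A")
  case True
  have "consistent T ((if consistent T (A # As) then A else \<^bold>\<not> A) # As)"
    using True assms provable_cases[of T A "imps As Fls"]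
    by (auto simp: consistent_def wff_imps)
  then show ?thesis using True by (auto simp: extend_def Let_def intro!: consistent_add_witness)
qed (simp add: extend_def assms)

lemma add_witness_mono: "set As \<subseteq> set (add_witness A As)"
  by (cases "(A, As)" rule: add_witness.cases) auto

primrec stage :: "fm set \<Rightarrow> fm \<Rightarrow> nat \<Rightarrow> fm list" where
  "stage T G 0 = [\<^bold>\<not> G]"
| "stage T G (Suc n) = extend T (from_nat n) (stage T G n)"

text \<open>Terms with free variables count as names of elements: \<open>H_All\<close> makes a
  universal formula as strong as all its instances, so that membership in \<open>H\<close> obeys the
  clauses of truth.\<close>

locale henkin =
  fixes Th H :: "fm set"
  assumes H_Fls: "Fls \<notin> H"
    and H_Imp: "wff A \<Longrightarrow> wff B \<Longrightarrow> (A \<^bold>\<longrightarrow> B) \<in> H \<longleftrightarrow> (A \<in> H \<longrightarrow> B \<in> H)"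
    and H_All: "wff (All U B) \<Longrightarrow> All U B \<in> H \<longleftrightarrow> (\<forall>t. typ_of [] t = Some U \<longrightarrow> openf 0 t B \<in> H)"
    and H_thm: "Th \<turnstile> A \<Longrightarrow> wff A \<Longrightarrow> A \<in> H"

theorem ex_henkin:
  assumes "\<not> T \<turnstile> G" "wff G"
  obtains H where "henkin T H" "G \<notin> H"
proof
  let ?s = "stage T G"
  define H where "H = (\<Union>n. set (?s n))"
  have cons: "consistent T (?s n)" for n
  proof (induction n)
    case 0
    have "T \<turnstile> (\<^bold>\<not> G \<^bold>\<longrightarrow> Fls) \<Longrightarrow> T \<turnstile> G"
    proof (rule provable_cut[of _ "\<^bold>\<not> G \<^bold>\<longrightarrow> Fls" "\<^bold>\<not> G \<^bold>\<longrightarrow> Fls"])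
      let ?D = "{\<^bold>\<not> G \<^bold>\<longrightarrow> Fls, \<^bold>\<not> G \<^bold>\<longrightarrow> Fls}"
      have "derives T (insert (\<^bold>\<not> G) ?D) Fls"
        using assms by (intro derives_contra[of "\<^bold>\<not> G"]) (auto simp: Neg_def)
      then show "derives T ?D G" using assms by (intro derives.RAA[of G])
    qed (use assms in auto)
    then show ?case using assms by (auto simp: consistent_def)
  qed (auto intro: consistent_extend)
  have "set (?s n) \<subseteq> set (?s (Suc n))" for n
    using add_witness_mono by (fastforce simp: extend_def Let_def)
  then have mono: "set (?s m) \<subseteq> set (?s n)" if "m \<le> n" for m n
    using that by (rule lift_Suc_mono_le[of "\<lambda>n. set (?s n)"])
  have fin: "\<exists>n. F \<subseteq> set (?s n)" if "finite F" "F \<subseteq> H" for F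
    using that
  proof (induction F)
    case (insert A F)
    then obtain n m where "F \<subseteq> set (?s n)" "A \<in> set (?s m)" by (auto simp: H_def)
    then have "insert A F \<subseteq> set (?s (max m n))"
      using mono[of n "max m n"] mono[of m "max m n"] by auto
    then show ?case by blast
  qed simp
  have wff: "wff A" if "A \<in> H" for A
    using that cons by (auto simp: H_def consistent_def)
  have H_cons: "\<not> derives T (set (?s n)) Fls" for n
    using cons[of n] by (rule consistent_derives)
  have contra: "\<not> (A \<in> H \<and> (\<^bold>\<not> A) \<in> H)" for A
  proof
    assume A: "A \<in> H \<and> (\<^bold>\<not> A) \<in> H"
    then obtain n where "{A, \<^bold>\<not> A} \<subseteq> set (?s n)" using fin[of "{A, \<^bold>\<not> A}"] by auto
    then show False using H_cons[of n] wff[of A] A by (auto intro: derives_contra[of A])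
  qed
  \<comment> \<open>The formula \<open>A\<close> is treated at the stage numbered
    \<open>to_nat A\<close>; its negation is added only if \<open>A\<close> is inconsistent with
    what is there.\<close>
  have added: "\<exists>C n. C \<in> {A, \<^bold>\<not> A} \<and> ?s (Suc n) = add_witness C (C # ?s n)
      \<and> (C \<noteq> A \<longrightarrow> \<not> consistent T (A # ?s n))" if "wff A" for A
    using that by (intro exI[of _ "if consistent T (A # ?s (to_nat A)) then A else \<^bold>\<not> A"]
        exI[of _ "to_nat A"]) (auto simp: extend_def Let_def)
  have maximal: "A \<in> H \<or> (\<^bold>\<not> A) \<in> H" if A: "wff A" for A
  proof -
    obtain C n where "C \<in> {A, \<^bold>\<not> A}" "?s (Suc n) = add_witness C (C # ?s n)"
      using added[OF A] by blast
    then have "C \<in> set (?s (Suc n))" using add_witness_mono[of "C # ?s n" C] by auto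
    then have "C \<in> H" unfolding H_def by blast
    then show ?thesis using \<open>C \<in> {A, \<^bold>\<not> A}\<close> by auto
  qed
  \<comment> \<open>A derivation from \<open>F\<close> cannot be weakened to one from a stage that
    contains \<open>F\<close>, so derivations from all larger sets are asked for.\<close>
  have closed: "A \<in> H" if F: "finite F" "F \<subseteq> H" and d: "\<And>\<Delta>. F \<subseteq> \<Delta> \<Longrightarrow> derives T \<Delta> A" and A: "wff A" for A F
  proof (rule ccontr)
    assume "A \<notin> H"
    then have "insert (\<^bold>\<not> A) F \<subseteq> H" using F maximal[OF A] by auto
    then obtain n where n: "insert (\<^bold>\<not> A) F \<subseteq> set (?s n)" using fin[of "insert (\<^bold>\<not> A) F"] F by auto
    then have "derives T (set (?s n)) Fls"
      using d[of "set (?s n)"] A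
      by (intro derives.ImpE[of _ _ A Fls]) (auto intro!: derives.Asm simp: Neg_def)
    then show False using H_cons by simp
  qed
  show "henkin T H"
  proof
    show "Fls \<notin> H" using fin[of "{Fls}"] H_cons derives.Asm[of Fls] by auto
    fix A B assume w: "wff A" "wff B"
    show "(A \<^bold>\<longrightarrow> B) \<in> H \<longleftrightarrow> (A \<in> H \<longrightarrow> B \<in> H)"
    proof (intro iffI impI)
      assume "(A \<^bold>\<longrightarrow> B) \<in> H" "A \<in> H"
      then show "B \<in> H"
        using w by (intro closed[of "{A, A \<^bold>\<longrightarrow> B}"])
          (auto intro!: derives.ImpE[of _ _ A B] intro: derives.Asm)
    next
      assume *: "A \<in> H \<longrightarrow> B \<in> H"
      show "(A \<^bold>\<longrightarrow> B) \<in> H"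
      proof (cases "A \<in> H")
        case True
        then show ?thesis using * w
          by (intro closed[of "{B}"] derives.ImpI derives.Asm) auto
      next
        case False
        then have "(\<^bold>\<not> A) \<in> H" using maximal w by blast
        then show ?thesis using w
          by (intro closed[of "{\<^bold>\<not> A}"] derives.ImpI derives.RAA[of B] derives_contra[of A]) auto
      qed
    qed
  next
    fix U B assume w: "wff (All U B)"
    obtain v where v: "snd v = U" "v \<notin> fv B" using ex_fresh[of "fv B" U] by auto
    show "All U B \<in> H \<longleftrightarrow> (\<forall>t. typ_of [] t = Some U \<longrightarrow> openf 0 t B \<in> H)"
    proof (intro iffI allI impI)
      fix t assume "All U B \<in> H" and t: "typ_of [] t = Some U"
      then show "openf 0 t B \<in> H"
      proof (intro closed[of "{All U B}"])
        fix \<Delta> assume "{All U B} \<subseteq> \<Delta>"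
        then have "derives T \<Delta> (\<^bold>\<forall>v. openf 0 (Var v) B)"
          using w v by (intro derives.Asm) (auto simp: All_eq_Allv[symmetric] simp del: wff_in.simps)
        then have "derives T \<Delta> (subst (Var(v := t)) (openf 0 (Var v) B))"
          using w v t by (intro derives.AllE wff_openf[of U]) auto
        then show "derives T \<Delta> (openf 0 t B)" using v by (simp add: subst_openf_fresh)
      qed (use w t wff_openf in auto)
    next
      assume *: "\<forall>t. typ_of [] t = Some U \<longrightarrow> openf 0 t B \<in> H"
      let ?A = "All U B \<^bold>\<longrightarrow> Fls"
      show "All U B \<in> H"
      proof (rule ccontr)
        assume neg: "All U B \<notin> H"
        obtain C n where Cn: "C \<in> {?A, \<^bold>\<not> ?A}" "?s (Suc n) = add_witness C (C # ?s n)"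
          using added[of ?A] w by auto
        then have "C \<in> set (?s (Suc n))" using add_witness_mono[of "C # ?s n" C] by auto
        then have CH: "C \<in> H" unfolding H_def by blast
        show False
        proof (cases "C = ?A")
          case True
          let ?w = "fresh_var U (All U B # ?A # ?s n)"
          have "(\<^bold>\<not> openf 0 (Var ?w) B) \<in> set (?s (Suc n))" unfolding Cn(2) True by simp
          then have "(\<^bold>\<not> openf 0 (Var ?w) B) \<in> H" unfolding H_def by blast
          then show False using * contra[of "openf 0 (Var ?w) B"] fresh_var(1) by simp
        next
          case False
          then have "(\<^bold>\<not> ?A) \<in> H" using Cn CH by auto
          then show False using contra[of ?A] maximal[OF w] neg by (auto simp: Neg_def)
        qed
      qed
    qed
  next
    fix A assume A: "T \<turnstile> A" "wff A"
    show "A \<in> H"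
    proof (rule ccontr)
      assume "A \<notin> H"
      \<comment> \<open>\<open>closed\<close> would ask for derivations of \<open>A\<close> from
        arbitrary contexts. Instead: had the negation been added, \<open>A\<close> would be
        inconsistent with the stage, and detaching the theorem \<open>A\<close> would refute the
        stage itself.\<close>
      obtain C n where Cn: "C \<in> {A, \<^bold>\<not> A}" "?s (Suc n) = add_witness C (C # ?s n)"
        "C \<noteq> A \<longrightarrow> \<not> consistent T (A # ?s n)"
        using added[of A] A by auto
      then have "C \<in> set (?s (Suc n))" using add_witness_mono[of "C # ?s n" C] by auto
      then have "C \<in> H" unfolding H_def by blast
      then have "\<not> consistent T (A # ?s n)" using Cn \<open>C \<in> H\<close> \<open>A \<notin> H\<close> by auto
      then show False
        using A cons[of n] by (auto simp: consistent_def intro: derives.ImpE)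
    qed
  qed
  have "(\<^bold>\<not> G) \<in> set (?s 0)" by simp
  then have "(\<^bold>\<not> G) \<in> H" unfolding H_def by blast
  then show "G \<notin> H" using contra by blast
qed

declare split_paired_All [simp del] split_paired_Ex [simp del]

section \<open>Extensional type structures\<close>

text \<open>All finite types share one carrier, because \<open>dom\<close> is indexed by elements of
  the datatype \<open>ty\<close>. The domains are not assumed to be disjoint.\<close>

record 'u model =
  dom :: "ty \<Rightarrow> 'u set"
  ap :: "'u \<Rightarrow> 'u \<Rightarrow> 'u"
  zr :: 'u
  su :: 'u
  km :: "ty \<Rightarrow> ty \<Rightarrow> 'u"
  sm :: "ty \<Rightarrow> ty \<Rightarrow> ty \<Rightarrow> 'u"
  rm :: 'u

primrec val :: "'u model \<Rightarrow> (var \<Rightarrow> 'u) \<Rightarrow> (nat \<Rightarrow> 'u) \<Rightarrow> tm \<Rightarrow> 'u" where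
  "val M e b (Bd i) = b i"
| "val M e b (Var v) = e v"
| "val M e b Zero = zr M"
| "val M e b Succ = su M"
| "val M e b (CK T U) = km M T U"
| "val M e b (CS T U W) = sm M T U W"
| "val M e b Rec = rm M"
| "val M e b (s \<cdot> t) = ap M (val M e b s) (val M e b t)"

text \<open>Equations are read as identity, so a model made of terms has to be built from
  representatives of classes of equal terms.\<close>

primrec sat :: "'u model \<Rightarrow> (var \<Rightarrow> 'u) \<Rightarrow> (nat \<Rightarrow> 'u) \<Rightarrow> fm \<Rightarrow> bool" where
  "sat M e b (s \<^bold>= t) \<longleftrightarrow> val M e b s = val M e b t"
| "sat M e b Fls \<longleftrightarrow> False"
| "sat M e b (A \<^bold>\<longrightarrow> B) \<longleftrightarrow> (sat M e b A \<longrightarrow> sat M e b B)"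
| "sat M e b (All T A) \<longleftrightarrow> (\<forall>a\<in>dom M T. sat M e (case_nat a b) A)"

definition env :: "'u model \<Rightarrow> (var \<Rightarrow> 'u) \<Rightarrow> bool" where
  "env M e \<longleftrightarrow> (\<forall>v. e v \<in> dom M (snd v))"

definition valid :: "'u model \<Rightarrow> fm \<Rightarrow> bool" where
  "valid M A \<longleftrightarrow> (\<forall>e. env M e \<longrightarrow> sat M e (\<lambda>_. zr M) A)"

locale ext_model =
  fixes M :: "'u model"
  assumes zr_dom: "zr M \<in> dom M T0"
    and su_dom: "su M \<in> dom M ty1"
    and km_dom: "km M T U \<in> dom M (T \<rightarrowtail> U \<rightarrowtail> T)"
    and sm_dom: "sm M T U W \<in> dom M ((T \<rightarrowtail> U \<rightarrowtail> W) \<rightarrowtail> (T \<rightarrowtail> U) \<rightarrowtail> T \<rightarrowtail> W)"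
    and rm_dom: "rm M \<in> dom M (T0 \<rightarrowtail> T0 \<rightarrowtail> (T0 \<rightarrowtail> T0 \<rightarrowtail> T0) \<rightarrowtail> T0)"
    and ap_dom: "f \<in> dom M (T \<rightarrowtail> U) \<Longrightarrow> x \<in> dom M T \<Longrightarrow> ap M f x \<in> dom M U"
    and extensional: "f \<in> dom M (T \<rightarrowtail> U) \<Longrightarrow> g \<in> dom M (T \<rightarrowtail> U) \<Longrightarrow>
      (\<And>x. x \<in> dom M T \<Longrightarrow> ap M f x = ap M g x) \<Longrightarrow> f = g"

lemma val_cong: "lct k t \<Longrightarrow> \<forall>i<k. b i = b' i \<Longrightarrow> val M e b t = val M e b' t"
  by (induction t) auto

lemma sat_cong: "lcf k A \<Longrightarrow> \<forall>i<k. b i = b' i \<Longrightarrow> sat M e b A = sat M e b' A"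
proof (induction A arbitrary: k b b')
  case (Eq s t)
  then show ?case using val_cong[of k] by (metis lcf.simps(1) sat.simps(1))
next
  case (All T A)
  have "sat M e (case_nat a b) A = sat M e (case_nat a b') A" for a
    using All.prems by (intro All.IH[of "Suc k"]) (auto split: nat.split)
  then show ?case by simp
next
  case (Imp A B)
  then show ?case by (metis lcf.simps(3) sat.simps(3))
qed simp

lemma val_closet: "lct k t \<Longrightarrow> val M e b (closet k v t) = val M (e(v := b k)) b t"
  by (induction t) auto

lemma sat_close: "lcf k A \<Longrightarrow> sat M e b (close k v A) = sat M (e(v := b k)) b A"
  by (induction A arbitrary: k b) (auto simp: val_closet)

lemma sat_Allv: "lcf 0 A \<Longrightarrow> sat M e b (\<^bold>\<forall>v. A) \<longleftrightarrow> (\<forall>a\<in>dom M (snd v). sat M (e(v := a)) b A)"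
proof -
  assume A: "lcf 0 A"
  then have "sat M e' (case_nat a b) A = sat M e' b A" for e' a by (rule sat_cong) simp
  then show ?thesis using A by (simp add: Allv_def sat_close)
qed

lemma val_substt: "\<forall>v. lct 0 (\<sigma> v) \<Longrightarrow> val M e b (substt \<sigma> t) = val M (\<lambda>v. val M e b (\<sigma> v)) b t"
  by (induction t) auto

lemma sat_subst:
  "\<forall>v. lct 0 (\<sigma> v) \<Longrightarrow> sat M e b (subst \<sigma> A) = sat M (\<lambda>v. val M e b (\<sigma> v)) b A"
proof (induction A arbitrary: b)
  case (All T A)
  have "val M e (case_nat a b) (\<sigma> v) = val M e b (\<sigma> v)" for a v
    using All.prems by (intro val_cong[of 0]) auto
  then show ?case using All by simp
qed (auto simp: val_substt)

lemma typ_eq_at: "typ_of [] s = Some T \<Longrightarrow> typ_of [] t = Some T \<Longrightarrow> wff (eq_at T s t)"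
proof (induction T arbitrary: s t)
  case (Fn T U)
  then show ?case by (auto simp: Let_def intro!: wff_in_subst wff_Allv Fn.IH)
qed simp

lemma wff_Conj [simp]: "wff_in G (A \<^bold>\<and> B) \<longleftrightarrow> wff_in G A \<and> wff_in G B"
  by (simp add: Conj_def)

lemma wff_Disj [simp]: "wff_in G (A \<^bold>\<or> B) \<longleftrightarrow> wff_in G A \<and> wff_in G B"
  by (simp add: Disj_def)

lemma wff_Iff [simp]: "wff_in G (A \<^bold>\<longleftrightarrow> B) \<longleftrightarrow> wff_in G A \<and> wff_in G B"
  by (auto simp: Iff_def)

lemma wff_Exv: "wff A \<Longrightarrow> wff (\<^bold>\<exists>v. A)"
  by (simp add: Exv_def wff_Allv)

lemma wff_E_PRA: "A \<in> E_PRA_omega \<Longrightarrow> wff A"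
  by (induction rule: E_PRA_omega.induct) (auto intro!: typ_eq_at wff_Allv wff_in_subst)

section \<open>Completeness\<close>

locale henkin_pra = henkin +
  assumes E_PRA_sub: "E_PRA_omega \<subseteq> Th"
begin

abbreviation has_typ :: "tm \<Rightarrow> ty \<Rightarrow> bool" where
  "has_typ t U \<equiv> typ_of [] t = Some U"

abbreviation tsub :: "(var \<Rightarrow> tm) \<Rightarrow> bool" where
  "tsub \<sigma> \<equiv> \<forall>v. has_typ (\<sigma> v) (snd v)"

lemma H_subst_Allv:
  assumes "wff A" "tsub \<sigma>"
  shows "subst \<sigma> (\<^bold>\<forall>v. A) \<in> H \<longleftrightarrow> (\<forall>t. has_typ t (snd v) \<longrightarrow> subst (\<sigma>(v := t)) A \<in> H)"
proof -
  have "wff (subst \<sigma> (\<^bold>\<forall>v. A))" using assms by (intro wff_in_subst wff_Allv) auto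
  then have "subst \<sigma> (\<^bold>\<forall>v. A) \<in> H \<longleftrightarrow>
      (\<forall>t. has_typ t (snd v) \<longrightarrow> openf 0 t (subst \<sigma> (close 0 v A)) \<in> H)"
    by (simp add: Allv_def H_All)
  moreover have "openf 0 t (subst \<sigma> (close 0 v A)) = subst (\<sigma>(v := t)) A" for t
    using assms by (intro openf_subst_close wff_lcf) (auto intro: typ_lct)
  ultimately show ?thesis by simp
qed

text \<open>The calculus has no rule for simultaneous substitution into a theorem. The free
  variables are bound by quantifiers one after another, and the resulting theorem is instantiated
  inside \<open>H\<close>.\<close>

lemma H_thm_subst:
  assumes A: "Th \<turnstile> A" "wff A" and \<sigma>: "tsub \<sigma>"
  shows "subst \<sigma> A \<in> H"
proof -
  let ?all = "\<lambda>vs. foldr Allv vs A"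
  have all: "Th \<turnstile> ?all vs \<and> wff (?all vs)" for vs
    by (induction vs) (auto intro: A derives.AllI wff_Allv)
  \<comment> \<open>The list of variables still bound is arbitrary; \<open>\<tau>\<close> records
    what has been substituted for the others.\<close>
  have inst: "subst \<tau> (?all vs) \<in> H \<Longrightarrow> tsub \<tau> \<Longrightarrow> subst (\<lambda>v. if v \<in> set vs then \<sigma> v else \<tau> v) A \<in> H" for vs \<tau>
  proof (induction vs arbitrary: \<tau>)
    case (Cons v vs)
    have "subst (\<tau>(v := \<sigma> v)) (?all vs) \<in> H"
      using Cons.prems H_subst_Allv[of "?all vs" \<tau> v] all[of vs] \<sigma> by simp
    moreover have "tsub (\<tau>(v := \<sigma> v))" using Cons.prems \<sigma> by auto
    ultimately have "subst (\<lambda>u. if u \<in> set vs then \<sigma> u else (\<tau>(v := \<sigma> v)) u) A \<in> H"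
      by (rule Cons.IH)
    moreover have "(\<lambda>u. if u \<in> set vs then \<sigma> u else (\<tau>(v := \<sigma> v)) u)
        = (\<lambda>u. if u \<in> set (v # vs) then \<sigma> u else \<tau> u)"
      by auto
    ultimately show ?case by metis
  qed simp
  obtain vs where vs: "set vs = fv A" using finite_list[of "fv A"] by auto
  have "subst (\<lambda>v. if v \<in> set vs then \<sigma> v else Var v) A \<in> H"
    using H_thm[of "?all vs"] all[of vs] by (intro inst) auto
  then show ?thesis using vs by (subst subst_cong[of _ \<sigma>]) auto
qed

lemma H_axiom: "A \<in> Th \<Longrightarrow> wff A \<Longrightarrow> tsub \<sigma> \<Longrightarrow> subst \<sigma> A \<in> H"
  by (rule H_thm_subst) (auto intro: derives.Ax)

lemma H_pra: "A \<in> E_PRA_omega \<Longrightarrow> tsub \<sigma> \<Longrightarrow> subst \<sigma> A \<in> H"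
  using E_PRA_sub wff_E_PRA by (auto intro: H_axiom)

section \<open>Extensional equality of terms relative to \<open>H\<close>\<close>

primrec eqv :: "ty \<Rightarrow> tm \<Rightarrow> tm \<Rightarrow> bool" where
  "eqv T0 s t \<longleftrightarrow> (s \<^bold>= t) \<in> H"
| "eqv (T \<rightarrowtail> U) s t \<longleftrightarrow> (\<forall>r. has_typ r T \<longrightarrow> eqv U (s \<cdot> r) (t \<cdot> r))"

lemma H_eq_at:
  "has_typ s T \<Longrightarrow> has_typ t T \<Longrightarrow> tsub \<sigma> \<Longrightarrow>
    subst \<sigma> (eq_at T s t) \<in> H \<longleftrightarrow> eqv T (substt \<sigma> s) (substt \<sigma> t)"
proof (induction T arbitrary: s t \<sigma>)
  case (Fn T U)
  let ?x = "(''x'', T \<rightarrowtail> U)" and ?y = "(''y'', T \<rightarrowtail> U)" and ?z = "(''z'', T)"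
  let ?B = "eq_at U (Var ?x \<cdot> Var ?z) (Var ?y \<cdot> Var ?z)"
  define \<rho> where "\<rho> = (\<lambda>v. substt \<sigma> ((Var(?x := s, ?y := t)) v))"
  have \<rho>: "tsub \<rho>" using Fn.prems by (auto simp: \<rho>_def intro!: typ_of_substt)
  have B: "wff ?B" by (rule typ_eq_at) simp_all
  have 1: "subst \<sigma> (eq_at (T \<rightarrowtail> U) s t) = subst \<rho> (\<^bold>\<forall>?z. ?B)"
    by (simp add: Let_def subst_subst \<rho>_def)
  have 2: "subst \<rho> (\<^bold>\<forall>?z. ?B) \<in> H \<longleftrightarrow> (\<forall>r. has_typ r T \<longrightarrow> subst (\<rho>(?z := r)) ?B \<in> H)"
    using H_subst_Allv[OF B \<rho>, of ?z] by (simp only: snd_conv)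
  note 2 also have "(\<forall>r. has_typ r T \<longrightarrow> subst (\<rho>(?z := r)) ?B \<in> H)
      \<longleftrightarrow> (\<forall>r. has_typ r T \<longrightarrow> eqv U (substt \<sigma> s \<cdot> r) (substt \<sigma> t \<cdot> r))"
  proof (rule all_cong)
    fix r assume "has_typ r T"
    then have "tsub (\<rho>(?z := r))" using \<rho> by simp
    have "\<rho> ?x = substt \<sigma> s" "\<rho> ?y = substt \<sigma> t" by (simp_all add: \<rho>_def)
    then have "substt (\<rho>(?z := r)) (Var ?x \<cdot> Var ?z) = substt \<sigma> s \<cdot> r"
      "substt (\<rho>(?z := r)) (Var ?y \<cdot> Var ?z) = substt \<sigma> t \<cdot> r" by simp_all
    moreover have "subst (\<rho>(?z := r)) ?B \<in> H \<longleftrightarrow>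
        eqv U (substt (\<rho>(?z := r)) (Var ?x \<cdot> Var ?z)) (substt (\<rho>(?z := r)) (Var ?y \<cdot> Var ?z))"
      by (rule Fn.IH(2)) (use \<open>tsub (\<rho>(?z := r))\<close> in simp_all)
    ultimately show "subst (\<rho>(?z := r)) ?B \<in> H \<longleftrightarrow> eqv U (substt \<sigma> s \<cdot> r) (substt \<sigma> t \<cdot> r)"
      by simp
  qed
  finally show ?case using 1 by simp
qed simp

lemma eqv_refl: "has_typ s T \<Longrightarrow> eqv T s s"
proof (induction T arbitrary: s)
  case T0
  have "subst (Var((''x'', T0) := s)) (Var (''x'', T0) \<^bold>= Var (''x'', T0)) \<in> H"
    using T0 by (intro H_pra E_PRA_omega.refl) auto
  then show ?case by simp
qed simp

lemma eqv_sym: "has_typ s T \<Longrightarrow> has_typ t T \<Longrightarrow> eqv T s t \<Longrightarrow> eqv T t s"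
proof (induction T arbitrary: s t)
  case T0
  have "subst (Var((''x'', T0) := s, (''y'', T0) := t))
      (Var (''x'', T0) \<^bold>= Var (''y'', T0) \<^bold>\<longrightarrow> Var (''y'', T0) \<^bold>= Var (''x'', T0)) \<in> H"
    using T0 by (intro H_pra E_PRA_omega.sym) auto
  then show ?case using T0 H_Imp[of "s \<^bold>= t" "t \<^bold>= s"] by simp
next
  case (Fn T U)
  show ?case unfolding eqv.simps
  proof (intro allI impI)
    fix r assume "has_typ r T"
    then show "eqv U (t \<cdot> r) (s \<cdot> r)" using Fn.prems by - (rule Fn.IH(2), auto)
  qed
qed

lemma eqv_trans:
  "has_typ s T \<Longrightarrow> has_typ t T \<Longrightarrow> has_typ u T \<Longrightarrow> eqv T s t \<Longrightarrow> eqv T t u \<Longrightarrow> eqv T s u"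
proof (induction T arbitrary: s t u)
  case T0
  have "subst (Var((''x'', T0) := s, (''y'', T0) := t, (''z'', T0) := u))
      (Var (''x'', T0) \<^bold>= Var (''y'', T0) \<^bold>\<longrightarrow> Var (''y'', T0) \<^bold>= Var (''z'', T0) \<^bold>\<longrightarrow>
        Var (''x'', T0) \<^bold>= Var (''z'', T0)) \<in> H"
    using T0 by (intro H_pra E_PRA_omega.trans) auto
  then show ?case
    using T0 H_Imp[of "s \<^bold>= t" "t \<^bold>= u \<^bold>\<longrightarrow> s \<^bold>= u"] H_Imp[of "t \<^bold>= u" "s \<^bold>= u"] by simp
next
  case (Fn T U)
  show ?case unfolding eqv.simps
  proof (intro allI impI)
    fix r assume r: "has_typ r T"
    show "eqv U (s \<cdot> r) (u \<cdot> r)"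
      by (rule Fn.IH(2)[of _ "t \<cdot> r"]) (use r Fn.prems in auto)
  qed
qed

text \<open>This is where the extensionality axiom enters. It speaks of the formulas
  \<open>eq_at\<close>, which \<open>H_eq_at\<close> translates into \<open>eqv\<close>.\<close>

lemma eqv_arg:
  assumes "has_typ f (T \<rightarrowtail> U)" "has_typ s T" "has_typ t T" "eqv T s t"
  shows "eqv U (f \<cdot> s) (f \<cdot> t)"
proof -
  let ?x = "(''x'', T)" and ?y = "(''y'', T)" and ?z = "(''z'', T \<rightarrowtail> U)"
  let ?s = "Var(?x := s, ?y := t, ?z := f)"
  let ?A = "eq_at T (Var ?x) (Var ?y)" and ?B = "eq_at U (Var ?z \<cdot> Var ?x) (Var ?z \<cdot> Var ?y)"
  have ts: "tsub ?s" using assms by auto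
  have wf: "wff ?A" "wff ?B" by (auto intro: typ_eq_at)
  have "subst ?s (?A \<^bold>\<longrightarrow> ?B) \<in> H"
    using ts by (intro H_pra E_PRA_omega.ext) auto
  moreover have "wff (subst ?s ?A)" "wff (subst ?s ?B)"
    using wf ts by (blast intro: wff_in_subst)+
  ultimately have "subst ?s ?A \<in> H \<longrightarrow> subst ?s ?B \<in> H" by (simp add: H_Imp)
  then show ?thesis using ts assms by (subst (asm) (1 2) H_eq_at) auto
qed

lemma eqv_app:
  assumes "has_typ f (T \<rightarrowtail> U)" "has_typ g (T \<rightarrowtail> U)" "eqv (T \<rightarrowtail> U) f g"
    and "has_typ s T" "has_typ t T" "eqv T s t"
  shows "eqv U (f \<cdot> s) (g \<cdot> t)"
proof (rule eqv_trans)
  show "eqv U (f \<cdot> s) (f \<cdot> t)" using assms by (intro eqv_arg)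
  show "eqv U (f \<cdot> t) (g \<cdot> t)" using assms by simp
qed (use assms in auto)

text \<open>Choosing one term from each class, instead of forming the classes, keeps
  \<open>tm\<close> as the carrier of the model.\<close>

definition rep :: "tm \<Rightarrow> tm" where
  "rep t = (SOME s. typ_of [] s = typ_of [] t \<and> eqv (the (typ_of [] t)) s t)"

lemma rep:
  assumes "has_typ t T" shows "has_typ (rep t) T" "eqv T (rep t) t"
proof -
  have "typ_of [] (rep t) = typ_of [] t \<and> eqv (the (typ_of [] t)) (rep t) t"
    unfolding rep_def by (rule someI_ex) (use assms eqv_refl in auto)
  then show "has_typ (rep t) T" "eqv T (rep t) t" using assms by auto
qed

lemma rep_eqI:
  assumes "has_typ s T" "has_typ t T" "eqv T s t" shows "rep s = rep t"
proof -
  have "(typ_of [] r = typ_of [] s \<and> eqv (the (typ_of [] s)) r s) \<longleftrightarrow>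
      (typ_of [] r = typ_of [] t \<and> eqv (the (typ_of [] t)) r t)" for r
    using assms eqv_trans[of r T s t] eqv_trans[of r T t s] eqv_sym[of s T t] by auto
  then show ?thesis by (simp add: rep_def)
qed

lemma rep_eqD:
  assumes "has_typ s T" "has_typ t T" "rep s = rep t" shows "eqv T s t"
  using assms rep[of s T] rep[of t T] eqv_trans[of s T "rep s" t] eqv_sym[of "rep s" T s] by simp

lemma rep_app:
  assumes "has_typ f (T \<rightarrowtail> U)" "has_typ s T"
  shows "rep (rep f \<cdot> rep s) = rep (f \<cdot> s)"
  using assms rep[of f "T \<rightarrowtail> U"] rep[of s T] by (intro rep_eqI[of _ U] eqv_app[of _ T]) auto

section \<open>The term model and its truth lemma\<close>

definition term_model :: "tm model" where
  "term_model = \<lparr>dom = (\<lambda>T. {rep t | t. has_typ t T}), ap = (\<lambda>s t. rep (s \<cdot> t)),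
    zr = rep Zero, su = rep Succ, km = (\<lambda>T U. rep (CK T U)), sm = (\<lambda>T U W. rep (CS T U W)), rm = rep Rec\<rparr>"

lemma val_term_model:
  "tsub e \<Longrightarrow> has_typ t T \<Longrightarrow> val term_model (rep \<circ> e) b t = rep (substt e t)"
proof (induction t arbitrary: T)
  case (App s t)
  then obtain U where U: "has_typ s (U \<rightarrowtail> T)" "has_typ t U" by (elim typ_of_AppD)
  then have "has_typ (substt e s) (U \<rightarrowtail> T)" "has_typ (substt e t) U"
    using App.prems by (auto intro!: typ_of_substt)
  then show ?case using App.IH U App.prems rep_app by (simp add: term_model_def)
qed (auto simp: term_model_def)

text \<open>The induction is on the size, because the opened body of a quantified formula is not a
  subformula of it.\<close>

lemma sat_term_model:
  "wff A \<Longrightarrow> tsub e \<Longrightarrow> sat term_model (rep \<circ> e) b A \<longleftrightarrow> subst e A \<in> H"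
proof (induction A arbitrary: e b rule: measure_induct_rule[where f = size])
  case (less A)
  show ?case
  proof (cases A)
    case (Eq s t)
    then have t: "has_typ s T0" "has_typ t T0" using less.prems by auto
    then have "has_typ (substt e s) T0" "has_typ (substt e t) T0"
      using less.prems by (auto intro: typ_of_substt)
    then have "rep (substt e s) = rep (substt e t) \<longleftrightarrow> eqv T0 (substt e s) (substt e t)"
      using rep_eqI rep_eqD by blast
    then show ?thesis unfolding Eq sat.simps
      by (simp only: val_term_model[OF less.prems(2) t(1)] val_term_model[OF less.prems(2) t(2)]
        eqv.simps subst.simps)
  next
    case Fls
    then show ?thesis using H_Fls by simp
  next
    case (Imp B C)
    have "wff (subst e B)" "wff (subst e C)" using Imp less.prems by (auto intro: wff_in_subst)
    then show ?thesis using Imp less by (simp add: H_Imp)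
  next
    case (All U B)
    obtain v where v: "snd v = U" "v \<notin> fv B" using ex_fresh[of "fv B" U] by auto
    let ?C = "openf 0 (Var v) B"
    have C: "wff ?C" using All less.prems v by (intro wff_openf[of U]) auto
    have A: "A = (\<^bold>\<forall>v. ?C)" using All v by (simp add: All_eq_Allv)
    have "sat term_model (rep \<circ> e) b A \<longleftrightarrow> (\<forall>t. has_typ t U \<longrightarrow> sat term_model ((rep \<circ> e)(v := rep t)) b ?C)"
      unfolding A using v by (subst sat_Allv[OF wff_lcf[OF C]]) (auto simp: term_model_def)
    also have "\<dots> \<longleftrightarrow> (\<forall>t. has_typ t U \<longrightarrow> subst (e(v := t)) ?C \<in> H)"
    proof (rule all_cong)
      fix t assume t: "has_typ t U"
      have eq: "(rep \<circ> e)(v := rep t) = rep \<circ> (e(v := t))" by auto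
      have size: "size ?C < size A" using All by simp
      have "tsub (e(v := t))" using less.prems t v by simp
      from less.IH[OF size C this, of b] show "sat term_model ((rep \<circ> e)(v := rep t)) b ?C \<longleftrightarrow> subst (e(v := t)) ?C \<in> H"
        unfolding eq .
    qed
    also have "\<dots> \<longleftrightarrow> subst e A \<in> H"
      unfolding A using C less.prems v by (subst H_subst_Allv) auto
    finally show ?thesis .
  qed
qed

lemma ext_model_term_model: "ext_model term_model"
proof
  fix f g T U
  assume f: "f \<in> dom term_model (T \<rightarrowtail> U)" and g: "g \<in> dom term_model (T \<rightarrowtail> U)"
    and eq: "\<And>x. x \<in> dom term_model T \<Longrightarrow> ap term_model f x = ap term_model g x"
  obtain s t where s: "f = rep s" "has_typ s (T \<rightarrowtail> U)" and t: "g = rep t" "has_typ t (T \<rightarrowtail> U)"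
    using f g by (auto simp: term_model_def)
  have "eqv (T \<rightarrowtail> U) s t" unfolding eqv.simps
  proof (intro allI impI)
    fix r assume r: "has_typ r T"
    have "rep (f \<cdot> rep r) = rep (g \<cdot> rep r)" using eq[of "rep r"] r by (auto simp: term_model_def)
    then have "rep (s \<cdot> r) = rep (t \<cdot> r)" using s t r rep_app by simp
    then show "eqv U (s \<cdot> r) (t \<cdot> r)" using s t r by (intro rep_eqD) auto
  qed
  then show "f = g" using s t by (simp add: rep_eqI)
next
  fix f x T U
  assume "f \<in> dom term_model (T \<rightarrowtail> U)" "x \<in> dom term_model T"
  then obtain s t where "f = rep s" "has_typ s (T \<rightarrowtail> U)" "x = rep t" "has_typ t T"
    by (auto simp: term_model_def)
  then show "ap term_model f x \<in> dom term_model U"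
    using rep_app[of s T U t] by (auto simp: term_model_def intro!: exI[of _ "s \<cdot> t"])
qed (auto simp: term_model_def intro!: exI)

lemma valid_term_model:
  assumes "A \<in> Th" "wff A" shows "valid term_model A"
  unfolding valid_def
proof (intro allI impI)
  fix e assume "env term_model e"
  then have "\<forall>v. \<exists>t. e v = rep t \<and> has_typ t (snd v)" by (auto simp: env_def term_model_def)
  then obtain e' where "\<forall>v. e v = rep (e' v) \<and> has_typ (e' v) (snd v)" by metis
  then have "e = rep \<circ> e'" "tsub e'" by auto
  then show "sat term_model e (\<lambda>_. zr term_model) A"
    using assms by (simp add: sat_term_model H_axiom)
qed

lemma not_valid_term_model:
  assumes "A \<notin> H" "wff A" shows "\<not> valid term_model A"
proof
  assume "valid term_model A"
  moreover have "env term_model (rep \<circ> Var)" by (auto simp: env_def term_model_def)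
  ultimately show False
    using assms sat_term_model[of A Var "\<lambda>_. zr term_model"] by (simp add: valid_def)
qed

end

text \<open>Free variables of axioms are read universally in the calculus; accordingly, validity
  means truth under all assignments.\<close>

theorem completeness:
  assumes "E_PRA_omega \<subseteq> T" "\<And>A. A \<in> T \<Longrightarrow> wff A" "wff G" "\<not> T \<turnstile> G"
  shows "\<exists>M::tm model. ext_model M \<and> (\<forall>A\<in>T. valid M A) \<and> \<not> valid M G"
proof -
  obtain H where H: "henkin T H" "G \<notin> H" using ex_henkin assms(3,4) by blast
  interpret henkin_pra T H
    using H(1) assms(1) by (simp add: henkin_pra_def henkin_pra_axioms_def)
  show ?thesis
    using ext_model_term_model valid_term_model not_valid_term_model[OF H(2)] assms by blast
qed

section \<open>Evaluation of formulas\<close>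

declare lam.simps [simp del]

definition lcs :: "(var \<Rightarrow> tm) \<Rightarrow> bool" where
  "lcs \<sigma> \<longleftrightarrow> (\<forall>v. lct 0 (\<sigma> v))"

lemma lcs_Var [simp]: "lcs Var"
  by (simp add: lcs_def)

lemma lcs_upd [simp]: "lcs \<sigma> \<Longrightarrow> lct 0 s \<Longrightarrow> lcs (\<sigma>(v := s))"
  by (simp add: lcs_def)

lemma lcf_Neg [simp]: "lcf k (\<^bold>\<not> A) = lcf k A"
  by (simp add: Neg_def)

lemma lcf_Conj [simp]: "lcf k (A \<^bold>\<and> B) \<longleftrightarrow> lcf k A \<and> lcf k B"
  by (simp add: Conj_def)

lemma lcf_Disj [simp]: "lcf k (A \<^bold>\<or> B) \<longleftrightarrow> lcf k A \<and> lcf k B"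
  by (simp add: Disj_def)

lemma lcf_Iff [simp]: "lcf k (A \<^bold>\<longleftrightarrow> B) \<longleftrightarrow> lcf k A \<and> lcf k B"
  by (auto simp: Iff_def)

lemma lcf_Allv [simp]: "lcf 0 A \<Longrightarrow> lcf 0 (\<^bold>\<forall>v. A)"
proof -
  have t: "lct k t \<Longrightarrow> lct (Suc k) (closet k v t)" for t k by (induction t) auto
  have "lcf k A \<Longrightarrow> lcf (Suc k) (close k v A)" for k by (induction A arbitrary: k) (auto simp: t)
  then show "lcf 0 A \<Longrightarrow> lcf 0 (\<^bold>\<forall>v. A)" by (simp add: Allv_def)
qed

lemma lcf_Exv [simp]: "lcf 0 A \<Longrightarrow> lcf 0 (\<^bold>\<exists>v. A)"
  by (simp add: Exv_def)

lemma lcf_subst [simp]: "lcf k A \<Longrightarrow> lcs \<sigma> \<Longrightarrow> lcf k (subst \<sigma> A)"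
proof -
  have t: "lct k t \<Longrightarrow> lcs \<sigma> \<Longrightarrow> lct k (substt \<sigma> t)" for t k
    by (induction t) (auto simp: lcs_def intro: lct_mono[of 0])
  show "lcf k A \<Longrightarrow> lcs \<sigma> \<Longrightarrow> lcf k (subst \<sigma> A)"
    by (induction A arbitrary: k) (auto simp: t)
qed

definition tys :: "(var \<Rightarrow> tm) \<Rightarrow> bool" where
  "tys \<sigma> \<longleftrightarrow> (\<forall>v. typ_of [] (\<sigma> v) = Some (snd v))"

lemma tys_Var [simp]: "tys Var"
  by (simp add: tys_def)

lemma tys_upd [simp]: "tys \<sigma> \<Longrightarrow> typ_of [] s = Some (snd v) \<Longrightarrow> tys (\<sigma>(v := s))"
  by (simp add: tys_def)

lemma wff_subst [simp]: "wff A \<Longrightarrow> tys \<sigma> \<Longrightarrow> wff (subst \<sigma> A)"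
  by (rule wff_in_subst) (simp_all add: tys_def)

declare wff_Allv [simp] wff_Exv [simp]

text \<open>Quantifiers range over numbers, whereas parameters may be of any type. Being a real and
  the order of two given reals are of this form, which brings much of analysis within reach of
  comprehension.\<close>

primrec arith :: "fm \<Rightarrow> bool" where
  "arith (s \<^bold>= t) \<longleftrightarrow> True"
| "arith Fls \<longleftrightarrow> True"
| "arith (A \<^bold>\<longrightarrow> B) \<longleftrightarrow> arith A \<and> arith B"
| "arith (All T A) \<longleftrightarrow> T = T0 \<and> arith A"

lemma arith_Neg [simp]: "arith (\<^bold>\<not> A) = arith A"
  by (simp add: Neg_def)

lemma arith_Conj [simp]: "arith (A \<^bold>\<and> B) \<longleftrightarrow> arith A \<and> arith B"
  by (simp add: Conj_def)

lemma arith_Disj [simp]: "arith (A \<^bold>\<or> B) \<longleftrightarrow> arith A \<and> arith B"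
  by (simp add: Disj_def)

lemma arith_Allv [simp]: "arith (\<^bold>\<forall>v. A) \<longleftrightarrow> snd v = T0 \<and> arith A"
proof -
  have "arith (close k v A) = arith A" for k by (induction A arbitrary: k) auto
  then show ?thesis by (simp add: Allv_def)
qed

lemma arith_Exv [simp]: "arith (\<^bold>\<exists>v. A) \<longleftrightarrow> snd v = T0 \<and> arith A"
  by (simp add: Exv_def)

lemma arith_subst [simp]: "arith (subst \<sigma> A) = arith A"
  by (induction A) auto

lemma arith_openf [simp]: "arith (openf k u A) = arith A"
  by (induction A arbitrary: k) auto

lemma typ_of_lam: "typ_of [] t = Some U \<Longrightarrow> typ_of [] (lam v t) = Some (snd v \<rightarrowtail> U)"
proof (induction t arbitrary: U)
  case (App s t)
  then obtain T where "typ_of [] s = Some (T \<rightarrowtail> U)" "typ_of [] t = Some T" by (elim typ_of_AppD)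
  then show ?case using App by (simp add: lam.simps)
qed (auto simp: lam.simps)

lemma fvt_lam [simp]: "fvt (lam v t) = fvt t - {v}"
  by (induction t) (auto simp: lam.simps)

lemma lct_lam [simp]: "lct k t \<Longrightarrow> lct k (lam v t)"
  by (induction t) (auto simp: lam.simps)

lemma val_fv_cong: "\<forall>v\<in>fvt t. e v = e' v \<Longrightarrow> val M e b t = val M e' b t"
  by (induction t) auto

lemma sat_fv_cong: "\<forall>v\<in>fv A. e v = e' v \<Longrightarrow> sat M e b A = sat M e' b A"
proof (induction A arbitrary: b)
  case (Eq s t)
  then show ?case using val_fv_cong[of s e e' M b] val_fv_cong[of t e e' M b] by simp
qed auto

text \<open>Names of free variables that stand for the functional of \<open>(\<exists>\<^sup>2)\<close> and for a functional that tests
  \<open>f 0 = f 1\<close>; the terms that represent arithmetical formulas contain them.\<close>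

definition vE :: var where "vE = (''EE'', ty2)"
definition vG :: var where "vG = (''GG'', ty2)"

lemma snd_vE_vG [simp]: "snd vE = ty2" "snd vG = ty2"
  by (simp_all add: vE_def vG_def)

context ext_model
begin

abbreviation "N \<equiv> dom M T0"
abbreviation "D1 \<equiv> dom M ty1"
abbreviation "D2 \<equiv> dom M ty2"
abbreviation app (infixl "\<bullet>" 90) where "f \<bullet> x \<equiv> ap M f x"
abbreviation "V e t \<equiv> val M e (\<lambda>_. zr M) t"
abbreviation "S e A \<equiv> sat M e (\<lambda>_. zr M) A"

lemma S_Neg [simp]: "sat M e b (\<^bold>\<not> A) \<longleftrightarrow> \<not> sat M e b A"
  by (simp add: Neg_def)

lemma S_Conj [simp]: "sat M e b (A \<^bold>\<and> B) \<longleftrightarrow> sat M e b A \<and> sat M e b B"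
  by (simp add: Conj_def)

lemma S_Disj [simp]: "sat M e b (A \<^bold>\<or> B) \<longleftrightarrow> sat M e b A \<or> sat M e b B"
  by (auto simp: Disj_def)

lemma S_Iff [simp]: "sat M e b (A \<^bold>\<longleftrightarrow> B) \<longleftrightarrow> (sat M e b A \<longleftrightarrow> sat M e b B)"
  by (auto simp: Iff_def)

lemma S_Allv [simp]: "lcf 0 A \<Longrightarrow> sat M e b (\<^bold>\<forall>v. A) \<longleftrightarrow> (\<forall>a\<in>dom M (snd v). sat M (e(v := a)) b A)"
  by (rule sat_Allv)

lemma S_Exv [simp]: "lcf 0 A \<Longrightarrow> sat M e b (\<^bold>\<exists>v. A) \<longleftrightarrow> (\<exists>a\<in>dom M (snd v). sat M (e(v := a)) b A)"
  by (simp add: Exv_def)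

lemma S_subst: "lcs \<sigma> \<Longrightarrow> sat M e b (subst \<sigma> A) = sat M (\<lambda>v. val M e b (\<sigma> v)) b A"
  by (rule sat_subst) (simp add: lcs_def)

lemma S_subst1 [simp]:
  "lct 0 s \<Longrightarrow> sat M e b (subst (Var(x := s)) A) = sat M (e(x := val M e b s)) b A"
proof -
  assume "lct 0 s"
  moreover have "(\<lambda>v. val M e b ((Var(x := s)) v)) = e(x := val M e b s)" by auto
  ultimately show ?thesis by (subst S_subst) simp_all
qed

lemma S_subst2 [simp]:
  "lct 0 s \<Longrightarrow> lct 0 t \<Longrightarrow> sat M e b (subst (Var(x := s, y := t)) A)
    = sat M (e(x := val M e b s, y := val M e b t)) b A"
proof -
  assume "lct 0 s" "lct 0 t"
  moreover have "(\<lambda>v. val M e b ((Var(x := s, y := t)) v)) = e(x := val M e b s, y := val M e b t)" by auto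
  ultimately show ?thesis by (subst S_subst) simp_all
qed

lemma env_upd [simp]: "env M e \<Longrightarrow> a \<in> dom M (snd v) \<Longrightarrow> env M (e(v := a))"
  by (simp add: env_def)

lemma env_dom: "env M e \<Longrightarrow> e v \<in> dom M (snd v)"
  by (simp add: env_def)

declare zr_dom [simp] su_dom [simp] km_dom [simp] sm_dom [simp] rm_dom [simp]

lemma val_dom: "typ_of [] t = Some T \<Longrightarrow> env M e \<Longrightarrow> val M e b t \<in> dom M T"
  by (induction t arbitrary: T) (auto elim!: typ_of_AppD simp del: typ_of.simps(8) simp: env_dom intro: ap_dom)

lemma S_eq_at:
  "typ_of [] s = Some T \<Longrightarrow> typ_of [] t = Some T \<Longrightarrow> env M e \<Longrightarrow>
    sat M e b (eq_at T s t) \<longleftrightarrow> val M e b s = val M e b t"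
proof (induction T arbitrary: s t e)
  case (Fn T U)
  let ?x = "(''x'', T \<rightarrowtail> U)" and ?y = "(''y'', T \<rightarrowtail> U)" and ?z = "(''z'', T)"
  let ?B = "eq_at U (Var ?x \<cdot> Var ?z) (Var ?y \<cdot> Var ?z)"
  let ?e = "e(?x := val M e b s, ?y := val M e b t)"
  have d: "val M e b s \<in> dom M (T \<rightarrowtail> U)" "val M e b t \<in> dom M (T \<rightarrowtail> U)"
    using Fn.prems by (auto intro: val_dom)
  have B: "wff ?B" by (rule typ_eq_at) simp_all
  have "sat M e b (eq_at (T \<rightarrowtail> U) s t) \<longleftrightarrow> sat M ?e b (\<^bold>\<forall>?z. ?B)"
    using Fn.prems by (simp add: Let_def typ_lct)
  moreover have "\<dots> \<longleftrightarrow> (\<forall>a\<in>dom M T. sat M (?e(?z := a)) b ?B)"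
    using wff_lcf[OF B] by simp
  moreover have "sat M (?e(?z := a)) b ?B \<longleftrightarrow> val M e b s \<bullet> a = val M e b t \<bullet> a" if "a \<in> dom M T" for a
  proof -
    have e: "env M (?e(?z := a))" using Fn.prems d that by simp
    have "sat M (?e(?z := a)) b ?B \<longleftrightarrow>
        val M (?e(?z := a)) b (Var ?x \<cdot> Var ?z) = val M (?e(?z := a)) b (Var ?y \<cdot> Var ?z)"
      by (rule Fn.IH(2)[OF _ _ e]) simp_all
    also have "\<dots> \<longleftrightarrow> val M e b s \<bullet> a = val M e b t \<bullet> a" by simp
    finally show ?thesis .
  qed
  ultimately show ?case using extensional[OF d] by auto
qed simp

end

locale pra_model = ext_model +
  assumes valid_axiom: "A \<in> ACA0_omega \<union> QF_AC_01 \<Longrightarrow> valid M A"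
begin

lemma valid_pra: "A \<in> E_PRA_omega \<Longrightarrow> env M e \<Longrightarrow> S e A"
  using valid_axiom[of A] by (auto simp: ACA0_omega_def RCA0_omega_def valid_def)

text \<open>Constant functions, obtained from the combinator \<open>CK\<close>, show that no domain
  is empty.\<close>

lemma ex_env: "\<exists>e. env M e"
proof -
  have "dom M T \<noteq> {}" for T
  proof (induction T)
    case T0
    then show ?case using zr_dom by blast
  next
    case (Fn T U)
    then obtain a where "a \<in> dom M U" by blast
    then have "km M U T \<bullet> a \<in> dom M (T \<rightarrowtail> U)" by (rule ap_dom[OF km_dom])
    then show ?case by blast
  qed
  then have "\<exists>a. a \<in> dom M T" for T by blast
  then have "(SOME a. a \<in> dom M T) \<in> dom M T" for T by (rule someI_ex)
  then have "env M (\<lambda>v. SOME a. a \<in> dom M (snd v))" unfolding env_def by blast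
  then show ?thesis by (rule exI[of "env M"])
qed

definition "env0 = (SOME e. env M e)"

lemma env_env0 [simp]: "env M env0"
  unfolding env0_def by (rule someI_ex[OF ex_env])

lemma ap_K [simp]:
  assumes "a \<in> dom M T" "b \<in> dom M U" shows "km M T U \<bullet> a \<bullet> b = a"
proof -
  let ?x = "(''x'', T)" and ?y = "(''y'', U)"
  have e: "env M (env0(?x := a, ?y := b))" using assms by simp
  have "eq_at T (CK T U \<cdot> Var ?x \<cdot> Var ?y) (Var ?x) \<in> E_PRA_omega" by (rule E_PRA_omega.K) auto
  from valid_pra[OF this e] show ?thesis using e by (simp add: S_eq_at)
qed

lemma ap_S [simp]:
  assumes "f \<in> dom M (T \<rightarrowtail> U \<rightarrowtail> W)" "g \<in> dom M (T \<rightarrowtail> U)" "a \<in> dom M T"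
  shows "sm M T U W \<bullet> f \<bullet> g \<bullet> a = f \<bullet> a \<bullet> (g \<bullet> a)"
proof -
  let ?x = "(''x'', T \<rightarrowtail> U \<rightarrowtail> W)" and ?y = "(''y'', T \<rightarrowtail> U)" and ?z = "(''z'', T)"
  have e: "env M (env0(?x := f, ?y := g, ?z := a))" using assms by simp
  have "eq_at W (CS T U W \<cdot> Var ?x \<cdot> Var ?y \<cdot> Var ?z) (Var ?x \<cdot> Var ?z \<cdot> (Var ?y \<cdot> Var ?z)) \<in> E_PRA_omega"
    by (rule E_PRA_omega.S) auto
  from valid_pra[OF this e] show ?thesis using e by (simp add: S_eq_at)
qed

lemma ap_Rec_0 [simp]:
  assumes "a \<in> N" "f \<in> dom M (T0 \<rightarrowtail> T0 \<rightarrowtail> T0)" shows "rm M \<bullet> zr M \<bullet> a \<bullet> f = a"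
proof -
  let ?y = "(''y'', T0)" and ?z = "(''z'', T0 \<rightarrowtail> T0 \<rightarrowtail> T0)"
  have e: "env M (env0(?y := a, ?z := f))" using assms by simp
  have "Rec \<cdot> Zero \<cdot> Var ?y \<cdot> Var ?z \<^bold>= Var ?y \<in> E_PRA_omega" by (rule E_PRA_omega.Rec_Zero) auto
  from valid_pra[OF this e] show ?thesis by simp
qed

lemma ap_Rec_Suc [simp]:
  assumes "n \<in> N" "a \<in> N" "f \<in> dom M (T0 \<rightarrowtail> T0 \<rightarrowtail> T0)"
  shows "rm M \<bullet> (su M \<bullet> n) \<bullet> a \<bullet> f = f \<bullet> (rm M \<bullet> n \<bullet> a \<bullet> f) \<bullet> n"
proof -
  let ?x = "(''x'', T0)" and ?y = "(''y'', T0)" and ?z = "(''z'', T0 \<rightarrowtail> T0 \<rightarrowtail> T0)"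
  have e: "env M (env0(?x := n, ?y := a, ?z := f))" using assms by simp
  have "Rec \<cdot> (Succ \<cdot> Var ?x) \<cdot> Var ?y \<cdot> Var ?z
      \<^bold>= Var ?z \<cdot> (Rec \<cdot> Var ?x \<cdot> Var ?y \<cdot> Var ?z) \<cdot> Var ?x \<in> E_PRA_omega"
    by (rule E_PRA_omega.Rec_Succ) auto
  from valid_pra[OF this e] show ?thesis by simp
qed

lemma su_N [simp]: "n \<in> N \<Longrightarrow> su M \<bullet> n \<in> N"
  by (rule ap_dom[OF su_dom])

lemma su_nonzero [simp]:
  assumes "n \<in> N" shows "su M \<bullet> n \<noteq> zr M"
proof -
  let ?x = "(''x'', T0)"
  have e: "env M (env0(?x := n))" using assms by simp
  have "(\<^bold>\<not> Succ \<cdot> Var ?x \<^bold>= Zero) \<in> E_PRA_omega" by (rule E_PRA_omega.Succ_nonzero) auto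
  from valid_pra[OF this e] show ?thesis by simp
qed

lemma su_inj:
  assumes "m \<in> N" "n \<in> N" "su M \<bullet> m = su M \<bullet> n" shows "m = n"
proof -
  let ?x = "(''x'', T0)" and ?y = "(''y'', T0)"
  have e: "env M (env0(?x := m, ?y := n))" using assms by simp
  have "(Succ \<cdot> Var ?x \<^bold>= Succ \<cdot> Var ?y \<^bold>\<longrightarrow> Var ?x \<^bold>= Var ?y) \<in> E_PRA_omega"
    by (rule E_PRA_omega.Succ_inj) auto
  from valid_pra[OF this e] show ?thesis using assms by simp
qed

lemma qf_induct:
  assumes "qfree A" "wff A" "snd v = T0" "env M e" "n \<in> N"
    and "S (e(v := zr M)) A"
    and "\<And>n. n \<in> N \<Longrightarrow> S (e(v := n)) A \<Longrightarrow> S (e(v := su M \<bullet> n)) A"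
  shows "S (e(v := n)) A"
proof -
  let ?F = "subst (Var(v := Zero)) A \<^bold>\<and> (\<^bold>\<forall>v. A \<^bold>\<longrightarrow> subst (Var(v := Succ \<cdot> Var v)) A) \<^bold>\<longrightarrow> (\<^bold>\<forall>v. A)"
  have lc: "lcf 0 A" using assms by (simp add: wff_lcf)
  have "?F \<in> E_PRA_omega" using assms by (intro E_PRA_omega.QF_IA)
  then have "S e ?F" by (rule valid_pra) fact
  then show ?thesis using assms lc by simp
qed

text \<open>\<open>lam\<close> treats an application without the abstracted variable as a whole, as
  a constant; hence the case distinction for applications.\<close>

lemma val_lam:
  "typ_of [] t = Some U \<Longrightarrow> env M e \<Longrightarrow> a \<in> dom M (snd v) \<Longrightarrow>
    val M e b (lam v t) \<bullet> a = val M (e(v := a)) b t"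
proof (induction t arbitrary: U)
  case (App s t)
  obtain T where T: "typ_of [] s = Some (T \<rightarrowtail> U)" "typ_of [] t = Some T"
    using App.prems(1) by (elim typ_of_AppD)
  show ?case
  proof (cases "v \<in> fvt (s \<cdot> t)")
    case True
    have "val M e b (lam v s) \<in> dom M (snd v \<rightarrowtail> T \<rightarrowtail> U)" "val M e b (lam v t) \<in> dom M (snd v \<rightarrowtail> T)"
      using T App.prems by (auto intro: val_dom typ_of_lam)
    then show ?thesis using True T App by (simp add: lam.simps)
  next
    case False
    have st: "typ_of [] (s \<cdot> t) = Some U" by fact
    have "val M e b (s \<cdot> t) \<in> dom M U" using App.prems by (intro val_dom)
    then have "val M e b (lam v (s \<cdot> t)) \<bullet> a = val M e b (s \<cdot> t)"
      using False App.prems T by (simp add: lam.simps)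
    also have "\<dots> = val M (e(v := a)) b (s \<cdot> t)" using False by (intro val_fv_cong) auto
    finally show ?thesis .
  qed
next
  case (Var u)
  show ?case
  proof (cases "u = v")
    case True
    have "km M (snd v) (snd v \<rightarrowtail> snd v) \<in> dom M (snd v \<rightarrowtail> (snd v \<rightarrowtail> snd v) \<rightarrowtail> snd v)"
      and "km M (snd v) (snd v) \<in> dom M (snd v \<rightarrowtail> snd v \<rightarrowtail> snd v)" by simp_all
    moreover from this(2) have "km M (snd v) (snd v) \<bullet> a \<in> dom M (snd v \<rightarrowtail> snd v)"
      using Var by (intro ap_dom)
    ultimately show ?thesis using True Var by (simp add: lam.simps)
  qed (use Var env_dom[of e u] in \<open>auto simp: lam.simps\<close>)
qed (auto simp: lam.simps)

section \<open>Arithmetical comprehension\<close>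

lemma qf_choice_10:
  assumes A: "qfree A" "wff A" and v: "snd f = ty1" "snd n = T0" and e: "env M e"
    and ex: "\<And>x. x \<in> D1 \<Longrightarrow> \<exists>y\<in>N. S (e(f := x, n := y)) A"
  shows "\<exists>g\<in>D2. \<forall>x\<in>D1. S (e(f := x, n := g \<bullet> x)) A"
proof -
  obtain G where G: "snd G = ty2" "G \<notin> fv A" using ex_fresh[of "fv A" ty2] by auto
  have fG: "f \<noteq> G" "n \<noteq> G" "f \<noteq> n" using v G by auto
  let ?F = "(\<^bold>\<forall>f. \<^bold>\<exists>n. A) \<^bold>\<longrightarrow> (\<^bold>\<exists>G. \<^bold>\<forall>f. subst (Var(n := Var G \<cdot> Var f)) A)"
  have lc: "lcf 0 A" using A by (simp add: wff_lcf)
  have "?F \<in> ACA0_omega \<union> QF_AC_01"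
    using v G A by (auto simp: ACA0_omega_def RCA0_omega_def intro: QF_AC_10.intros)
  then have "S e ?F" using valid_axiom e unfolding valid_def by blast
  then obtain g where g: "g \<in> D2" "\<forall>x\<in>D1. S (e(G := g, f := x, n := g \<bullet> x)) A"
    using ex v G lc fG by auto
  have "S (e(G := g, f := x, n := g \<bullet> x)) A = S (e(f := x, n := g \<bullet> x)) A" for x
    using G by (intro sat_fv_cong) auto
  then show ?thesis using g by blast
qed

lemma qf_choice_01:
  assumes A: "qfree A" "wff A" and v: "snd f = ty1" "snd n = T0" and e: "env M e"
    and ex: "\<And>y. y \<in> N \<Longrightarrow> \<exists>x\<in>D1. S (e(n := y, f := x)) A"
  shows "\<exists>g\<in>dom M (T0 \<rightarrowtail> ty1). \<forall>y\<in>N. S (e(n := y, f := g \<bullet> y)) A"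
proof -
  obtain G where G: "snd G = T0 \<rightarrowtail> ty1" "G \<notin> fv A" using ex_fresh[of "fv A" "T0 \<rightarrowtail> ty1"] by auto
  have fG: "f \<noteq> G" "n \<noteq> G" "f \<noteq> n" using v G by auto
  let ?F = "(\<^bold>\<forall>n. \<^bold>\<exists>f. A) \<^bold>\<longrightarrow> (\<^bold>\<exists>G. \<^bold>\<forall>n. subst (Var(f := Var G \<cdot> Var n)) A)"
  have lc: "lcf 0 A" using A by (simp add: wff_lcf)
  have "?F \<in> ACA0_omega \<union> QF_AC_01"
    using v G A by (auto intro: QF_AC_01.intros)
  then have "S e ?F" using valid_axiom e unfolding valid_def by blast
  then obtain g where g: "g \<in> dom M (T0 \<rightarrowtail> ty1)" "\<forall>y\<in>N. S (e(G := g, n := y, f := g \<bullet> y)) A"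
    using ex v G lc fG by auto
  have "S (e(G := g, n := y, f := g \<bullet> y)) A = S (e(n := y, f := g \<bullet> y)) A" for y
    using G by (intro sat_fv_cong) auto
  then show ?thesis using g by blast
qed

lemma ex_E: "\<exists>E\<in>D2. \<forall>f\<in>D1. E \<bullet> f \<in> {zr M, su M \<bullet> zr M} \<and> (E \<bullet> f = zr M \<longleftrightarrow> (\<exists>n\<in>N. f \<bullet> n = zr M))"
proof -
  have "S env0 exists2" using valid_axiom[of exists2] by (simp add: ACA0_omega_def valid_def)
  then show ?thesis by (auto simp: exists2_def Let_def)
qed

text \<open>Equality of numbers becomes decidable by a functional before any arithmetic is
  available: choice selects 0 or 1 according to the case. As this choice takes arguments of type 1,
  the two numbers are packed into the first two values of a sequence.\<close>

lemma ex_G: "\<exists>G\<in>D2. \<forall>f\<in>D1. G \<bullet> f = zr M \<longleftrightarrow> f \<bullet> zr M = f \<bullet> (su M \<bullet> zr M)"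
proof -
  let ?B = "Var vx \<cdot> Zero \<^bold>= Var vx \<cdot> One"
  let ?A = "(?B \<^bold>\<longrightarrow> Var vn \<^bold>= Zero) \<^bold>\<and> (\<^bold>\<not> ?B \<^bold>\<longrightarrow> Var vn \<^bold>= One)"
  have "\<exists>g\<in>D2. \<forall>x\<in>D1. S (env0(vx := x, vn := g \<bullet> x)) ?A"
  proof (rule qf_choice_10)
    fix x assume "x \<in> D1"
    then show "\<exists>y\<in>N. S (env0(vx := x, vn := y)) ?A"
      by (cases "x \<bullet> zr M = x \<bullet> (su M \<bullet> zr M)") (auto intro: bexI[of _ "zr M"] bexI[of _ "su M \<bullet> zr M"])
  qed (auto simp: Conj_def Neg_def)
  then show ?thesis by auto (metis su_nonzero zr_dom)
qed

definition "Eop = (SOME E. E \<in> D2 \<and> (\<forall>f\<in>D1. E \<bullet> f \<in> {zr M, su M \<bullet> zr M} \<and> (E \<bullet> f = zr M \<longleftrightarrow> (\<exists>n\<in>N. f \<bullet> n = zr M))))"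

definition "Gop = (SOME G. G \<in> D2 \<and> (\<forall>f\<in>D1. G \<bullet> f = zr M \<longleftrightarrow> f \<bullet> zr M = f \<bullet> (su M \<bullet> zr M)))"

lemma Eop: "Eop \<in> D2" "f \<in> D1 \<Longrightarrow> Eop \<bullet> f = zr M \<longleftrightarrow> (\<exists>n\<in>N. f \<bullet> n = zr M)"
proof -
  have "Eop \<in> D2 \<and> (\<forall>f\<in>D1. Eop \<bullet> f \<in> {zr M, su M \<bullet> zr M} \<and> (Eop \<bullet> f = zr M \<longleftrightarrow> (\<exists>n\<in>N. f \<bullet> n = zr M)))"
    unfolding Eop_def by (rule someI_ex) (use ex_E in blast)
  then show "Eop \<in> D2" "f \<in> D1 \<Longrightarrow> Eop \<bullet> f = zr M \<longleftrightarrow> (\<exists>n\<in>N. f \<bullet> n = zr M)" by auto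
qed

lemma Gop: "Gop \<in> D2" "f \<in> D1 \<Longrightarrow> Gop \<bullet> f = zr M \<longleftrightarrow> f \<bullet> zr M = f \<bullet> (su M \<bullet> zr M)"
proof -
  have "Gop \<in> D2 \<and> (\<forall>f\<in>D1. Gop \<bullet> f = zr M \<longleftrightarrow> f \<bullet> zr M = f \<bullet> (su M \<bullet> zr M))"
    unfolding Gop_def by (rule someI_ex) (use ex_G in blast)
  then show "Gop \<in> D2" "f \<in> D1 \<Longrightarrow> Gop \<bullet> f = zr M \<longleftrightarrow> f \<bullet> zr M = f \<bullet> (su M \<bullet> zr M)" by auto
qed

section \<open>Characteristic terms of arithmetical formulas\<close>

definition genv :: "(var \<Rightarrow> 'a) \<Rightarrow> bool" where
  "genv e \<longleftrightarrow> env M e \<and> e vE = Eop \<and> e vG = Gop"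

lemma genv_env [simp]: "genv e \<Longrightarrow> env M e"
  by (simp add: genv_def)

lemma genv_upd [simp]:
  "genv e \<Longrightarrow> a \<in> dom M (snd v) \<Longrightarrow> v \<noteq> vE \<Longrightarrow> v \<noteq> vG \<Longrightarrow> genv (e(v := a))"
  by (simp add: genv_def)

definition "ge = env0(vE := Eop, vG := Gop)"

lemma genv_ge [simp]: "genv ge"
  using Eop Gop by (simp add: ge_def genv_def) (simp add: vE_def vG_def)

text \<open>At this point induction is available for quantifier-free formulas only, so the
  predecessor has to be given by a term rather than a quantifier. The recursion in \<open>?P\<close>
  returns the second argument of its step, which is the preceding number.\<close>

lemma N_cases:
  assumes "n \<in> N" obtains "n = zr M" | m where "m \<in> N" "n = su M \<bullet> m"
proof -
  let ?P = "Rec \<cdot> Var vn \<cdot> Zero \<cdot> lam vi (lam vj (Var vj))"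
  let ?A = "Var vn \<^bold>= Zero \<^bold>\<or> Var vn \<^bold>= Succ \<cdot> ?P"
  have d: "env M e \<Longrightarrow> V e (lam vi (lam vj (Var vj))) \<in> dom M (T0 \<rightarrowtail> T0 \<rightarrowtail> T0)" for e
    by (rule val_dom) (simp_all add: typ_of_lam)
  have P: "V e ?P \<in> N" if "env M e" for e
    using that by (intro val_dom) (simp_all add: typ_of_lam)
  have "S (env0(vn := n)) ?A"
  proof (rule qf_induct)
    fix n assume n: "n \<in> N"
    let ?e = "env0(vn := su M \<bullet> n)"
    have r: "rm M \<bullet> n \<bullet> zr M \<bullet> V ?e (lam vi (lam vj (Var vj))) \<in> N"
      using n by (intro ap_dom[OF ap_dom[OF ap_dom[OF rm_dom]]] d) auto
    show "S ?e ?A" using n r d[of ?e] by (simp add: val_lam typ_of_lam)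
  qed (use assms in \<open>simp_all add: Disj_def Neg_def typ_of_lam\<close>)
  then consider "n = zr M" | "n = su M \<bullet> V (env0(vn := n)) ?P" by auto
  then show ?thesis using that P[of "env0(vn := n)"] assms by cases auto
qed

text \<open>The functional is applied to the sequence whose value is \<open>vm\<close> at 0 and
  \<open>vn\<close> elsewhere.\<close>

definition EQT :: tm where
  "EQT = lam vm (lam vn (Var vG \<cdot> lam vi (Rec \<cdot> Var vi \<cdot> Var vm \<cdot> lam vj (lam vk (Var vn)))))"

lemma val_EQT:
  assumes "genv e" "a \<in> N" "c \<in> N"
  shows "V e EQT \<bullet> a \<bullet> c = zr M \<longleftrightarrow> a = c"
proof -
  let ?f = "lam vi (Rec \<cdot> Var vi \<cdot> Var vm \<cdot> lam vj (lam vk (Var vn)))"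
  let ?e = "e(vm := a, vn := c)"
  have e: "genv ?e" using assms by (simp add: vE_def vG_def)
  have t: "typ_of [] ?f = Some ty1" by (simp add: typ_of_lam)
  have d: "V e (lam vj (lam vk (Var vn))) \<in> dom M (T0 \<rightarrowtail> T0 \<rightarrowtail> T0)" if "env M e" for e
    using that by (intro val_dom) (simp_all add: typ_of_lam)
  have f: "V ?e ?f \<in> D1" by (intro val_dom t genv_env e)
  have "V e EQT \<bullet> a \<bullet> c = Gop \<bullet> V ?e ?f"
    using assms e t unfolding EQT_def by (simp add: val_lam typ_of_lam genv_def)
  moreover have "V ?e ?f \<bullet> zr M = a" "V ?e ?f \<bullet> (su M \<bullet> zr M) = c"
    using assms e d by (simp_all add: val_lam typ_of_lam)
  ultimately show ?thesis using Gop(2)[OF f] by simp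
qed

text \<open>With 0 as the truth value true, this is implication.\<close>

definition IFT :: tm where
  "IFT = lam vm (lam vn (Rec \<cdot> Var vm \<cdot> Var vn \<cdot> lam vi (lam vj Zero)))"

lemma val_IFT:
  assumes "env M e" "a \<in> N" "c \<in> N"
  shows "V e IFT \<bullet> a \<bullet> c = (if a = zr M then c else zr M)"
proof -
  let ?f = "lam vi (lam vj Zero)"
  let ?e = "e(vm := a, vn := c)"
  have f: "V ?e ?f \<in> dom M (T0 \<rightarrowtail> T0 \<rightarrowtail> T0)"
    using assms by (intro val_dom) (simp_all add: typ_of_lam)
  have eq: "V e IFT \<bullet> a \<bullet> c = rm M \<bullet> a \<bullet> c \<bullet> V ?e ?f"
    using assms unfolding IFT_def by (simp add: val_lam typ_of_lam)
  from assms(2) show ?thesis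
  proof (cases rule: N_cases)
    case (2 m)
    have "rm M \<bullet> m \<bullet> c \<bullet> V ?e ?f \<in> N"
      using 2 assms by (intro ap_dom[OF ap_dom[OF ap_dom[OF rm_dom]]] f) auto
    then have "V ?e ?f \<bullet> (rm M \<bullet> m \<bullet> c \<bullet> V ?e ?f) \<bullet> m = zr M"
      using 2 assms by (simp add: val_lam typ_of_lam)
    then show ?thesis using eq 2 f assms by simp
  qed (use eq f assms in simp)
qed

lemma typ_EQT: "typ_of [] EQT = Some (T0 \<rightarrowtail> T0 \<rightarrowtail> T0)"
  by (simp add: EQT_def typ_of_lam)

lemma typ_IFT: "typ_of [] IFT = Some (T0 \<rightarrowtail> T0 \<rightarrowtail> T0)"
  by (simp add: IFT_def typ_of_lam)

text \<open>A universal statement says that the sequence representing the negated body has no zero,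
  and the functional of \<open>(\<exists>^2)\<close>, held by \<open>vE\<close>, decides whether a
  sequence has a zero.\<close>

lemma arith_term:
  "arith A \<Longrightarrow> wff A \<Longrightarrow>
    \<exists>t. typ_of [] t = Some T0 \<and> (\<forall>e. genv e \<longrightarrow> (V e t = zr M \<longleftrightarrow> S e A))"
proof (induction A rule: measure_induct_rule[where f = size])
  case (less A)
  show ?case
  proof (cases A)
    case (Eq s t)
    then have "V e (EQT \<cdot> s \<cdot> t) = zr M \<longleftrightarrow> S e A" if "genv e" for e
      using less.prems that val_EQT[of e] by (simp add: val_dom)
    then show ?thesis using Eq less.prems typ_EQT by (intro exI[of _ "EQT \<cdot> s \<cdot> t"]) simp
  next
    case Fls
    then show ?thesis by (intro exI[of _ One]) simp
  next
    case (Imp B C)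
    obtain s where s: "typ_of [] s = Some T0" "\<And>e. genv e \<Longrightarrow> (V e s = zr M \<longleftrightarrow> S e B)"
      using less.IH[of B] less.prems Imp by auto
    obtain t where t: "typ_of [] t = Some T0" "\<And>e. genv e \<Longrightarrow> (V e t = zr M \<longleftrightarrow> S e C)"
      using less.IH[of C] less.prems Imp by auto
    have "V e (IFT \<cdot> s \<cdot> t) = zr M \<longleftrightarrow> S e A" if "genv e" for e
      using s t Imp that val_IFT[of e] by (simp add: val_dom)
    then show ?thesis using s t typ_IFT by (intro exI[of _ "IFT \<cdot> s \<cdot> t"]) simp
  next
    case (All U B)
    then have U: "U = T0" using less.prems by simp
    obtain v where v: "snd v = T0" "v \<notin> fv B" using ex_fresh[of "fv B" T0] by auto
    let ?C = "openf 0 (Var v) B"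
    have C: "wff ?C" using All less.prems v U by (intro wff_openf[of U]) auto
    have A: "A = (\<^bold>\<forall>v. ?C)" using All v U by (simp add: All_eq_Allv)
    obtain t where t: "typ_of [] t = Some T0" "\<And>e. genv e \<Longrightarrow> (V e t = zr M \<longleftrightarrow> S e ?C)"
      using less.IH[of ?C] less.prems All C by auto
    \<comment> \<open>\<open>One\<close> stands for falsity, so implication into it is
      negation.\<close>
    let ?not = "\<lambda>t. IFT \<cdot> t \<cdot> One"
    let ?f = "lam v (?not t)"
    have f: "typ_of [] ?f = Some ty1" using t v by (simp add: typ_of_lam typ_IFT)
    have "V e (?not (Var vE \<cdot> ?f)) = zr M \<longleftrightarrow> S e A" if e: "genv e" for e
    proof -
      have "V e (?not (Var vE \<cdot> ?f)) = zr M \<longleftrightarrow> \<not> Eop \<bullet> V e ?f = zr M"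
        using e f val_IFT[of e] ap_dom[OF Eop(1) val_dom[OF f, of e]] by (simp add: genv_def)
      also have "\<dots> \<longleftrightarrow> (\<forall>n\<in>N. V e ?f \<bullet> n \<noteq> zr M)"
        using Eop(2)[OF val_dom[OF f]] e by auto
      also have "\<dots> \<longleftrightarrow> (\<forall>n\<in>N. S (e(v := n)) ?C)"
      proof (rule ball_cong[OF HOL.refl])
        fix n assume n: "n \<in> N"
        have e': "genv (e(v := n))" using e n v by (intro genv_upd) (auto simp: vE_def vG_def)
        have "V e ?f \<bullet> n = V (e(v := n)) (?not t)"
          using e n v t by (intro val_lam) (auto simp: typ_IFT)
        then show "V e ?f \<bullet> n \<noteq> zr M \<longleftrightarrow> S (e(v := n)) ?C"
          using val_IFT[of "e(v := n)"] t e' by (simp add: val_dom)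
      qed
      also have "\<dots> \<longleftrightarrow> S e A" unfolding A using v wff_lcf[OF C] by simp
      finally show ?thesis .
    qed
    then show ?thesis using f by (intro exI[of _ "?not (Var vE \<cdot> ?f)"]) (simp add: typ_IFT)
  qed
qed

text \<open>The equation of the characteristic term with 0 is quantifier-free, so the induction
  axiom applies to it.\<close>

lemma arith_induct:
  assumes A: "arith A" "wff A" "snd v = T0" and v: "v \<noteq> vE" "v \<noteq> vG" and e: "genv e" and n: "n \<in> N"
    and 0: "S (e(v := zr M)) A"
    and Suc: "\<And>n. n \<in> N \<Longrightarrow> S (e(v := n)) A \<Longrightarrow> S (e(v := su M \<bullet> n)) A"
  shows "S (e(v := n)) A"
proof -
  obtain t where t: "typ_of [] t = Some T0" "\<And>e. genv e \<Longrightarrow> (V e t = zr M \<longleftrightarrow> S e A)"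
    using arith_term[OF A(1,2)] by auto
  have eq: "S (e(v := n)) (t \<^bold>= Zero) \<longleftrightarrow> S (e(v := n)) A" if "n \<in> N" for n
    using t(2)[of "e(v := n)"] e v A that by simp
  have "S (e(v := n)) (t \<^bold>= Zero)"
    by (rule qf_induct) (use t A e n eq 0 Suc in simp_all)
  then show ?thesis using eq n by simp
qed

end

section \<open>The natural numbers of a model\<close>

lemma eq_vE [simp]: "(s, T) = vE \<longleftrightarrow> s = ''EE'' \<and> T = ty2" "(s, T) = vG \<longleftrightarrow> s = ''GG'' \<and> T = ty2"
  "vE = (s, T) \<longleftrightarrow> s = ''EE'' \<and> T = ty2" "vG = (s, T) \<longleftrightarrow> s = ''GG'' \<and> T = ty2"
  by (auto simp: vE_def vG_def)

lemma typ_lam [simp]: "typ_of [] t = Some U \<Longrightarrow> typ_of [] (lam v t) = Some (snd v \<rightarrowtail> U)"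
  by (rule typ_of_lam)

lemma typ_closed_arith [simp]:
  "typ_of [] PLUS = Some (T0 \<rightarrowtail> T0 \<rightarrowtail> T0)" "typ_of [] TIMES = Some (T0 \<rightarrowtail> T0 \<rightarrowtail> T0)"
  "typ_of [] PRED = Some ty1" "typ_of [] MONUS = Some (T0 \<rightarrowtail> T0 \<rightarrowtail> T0)"
  "typ_of [] POW2 = Some ty1" "typ_of [] TRI = Some ty1" "typ_of [] TROOT = Some ty1"
  "typ_of [] PAIR = Some (T0 \<rightarrowtail> T0 \<rightarrowtail> T0)" "typ_of [] FST = Some ty1" "typ_of [] SND = Some ty1"
proof -
  show p: "typ_of [] PLUS = Some (T0 \<rightarrowtail> T0 \<rightarrowtail> T0)" by (simp add: PLUS_def)
  show "typ_of [] TIMES = Some (T0 \<rightarrowtail> T0 \<rightarrowtail> T0)" by (simp add: TIMES_def p)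
  show q: "typ_of [] PRED = Some ty1" by (simp add: PRED_def)
  show m: "typ_of [] MONUS = Some (T0 \<rightarrowtail> T0 \<rightarrowtail> T0)" by (simp add: MONUS_def q)
  show "typ_of [] POW2 = Some ty1" by (simp add: POW2_def p)
  show r: "typ_of [] TRI = Some ty1" by (simp add: TRI_def p)
  show t: "typ_of [] TROOT = Some ty1" by (simp add: TROOT_def p m r)
  show "typ_of [] PAIR = Some (T0 \<rightarrowtail> T0 \<rightarrowtail> T0)" by (simp add: PAIR_def p r)
  show f: "typ_of [] FST = Some ty1" by (simp add: FST_def r t m)
  show "typ_of [] SND = Some ty1" by (simp add: SND_def f t m)
qed

lemma typ_closed_rat [simp]:
  "typ_of [] SGN = Some ty1" "typ_of [] NUM = Some ty1" "typ_of [] DEN = Some ty1"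
  "typ_of [] POS = Some ty1" "typ_of [] NEG = Some ty1" "typ_of [] CROSS = Some (T0 \<rightarrowtail> T0 \<rightarrowtail> T0)"
  "typ_of [] MINUSQ = Some (T0 \<rightarrowtail> T0 \<rightarrowtail> T0)" "typ_of [] ABSQ = Some ty1"
  "typ_of [] DYADIC = Some (T0 \<rightarrowtail> T0 \<rightarrowtail> T0)" "typ_of [] MINUSR = Some (ty1 \<rightarrowtail> ty1 \<rightarrowtail> ty1)"
  "typ_of [] ABSR = Some (ty1 \<rightarrowtail> ty1)" "typ_of [] RATR = Some (T0 \<rightarrowtail> ty1)"
proof -
  show s: "typ_of [] SGN = Some ty1" by (simp add: SGN_def)
  show n: "typ_of [] NUM = Some ty1" by (simp add: NUM_def)
  show d: "typ_of [] DEN = Some ty1" by (simp add: DEN_def)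
  show p: "typ_of [] POS = Some ty1" by (simp add: POS_def s n)
  show g: "typ_of [] NEG = Some ty1" by (simp add: NEG_def s n)
  show c: "typ_of [] CROSS = Some (T0 \<rightarrowtail> T0 \<rightarrowtail> T0)" by (simp add: CROSS_def p g d)
  show m: "typ_of [] MINUSQ = Some (T0 \<rightarrowtail> T0 \<rightarrowtail> T0)" by (simp add: MINUSQ_def Let_def c d)
  show a: "typ_of [] ABSQ = Some ty1" by (simp add: ABSQ_def n)
  show "typ_of [] DYADIC = Some (T0 \<rightarrowtail> T0 \<rightarrowtail> T0)" by (simp add: DYADIC_def)
  show "typ_of [] MINUSR = Some (ty1 \<rightarrowtail> ty1 \<rightarrowtail> ty1)" by (simp add: MINUSR_def m)
  show "typ_of [] ABSR = Some (ty1 \<rightarrowtail> ty1)" by (simp add: ABSR_def a)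
  show "typ_of [] RATR = Some (T0 \<rightarrowtail> ty1)" by (simp add: RATR_def)
qed

lemma lct_typ: "typ_of [] t = Some T \<Longrightarrow> lct k t"
  using typ_lct lct_mono by blast

lemma lct_closed [simp]:
  "lct k PLUS" "lct k TIMES" "lct k PRED" "lct k MONUS" "lct k POW2" "lct k TRI" "lct k TROOT"
  "lct k PAIR" "lct k FST" "lct k SND" "lct k SGN" "lct k NUM" "lct k DEN" "lct k POS" "lct k NEG"
  "lct k CROSS" "lct k MINUSQ" "lct k ABSQ" "lct k DYADIC" "lct k MINUSR" "lct k ABSR" "lct k RATR"
  by (rule lct_typ, simp)+

lemma fvt_closed [simp]:
  "fvt PLUS = {}" "fvt TIMES = {}" "fvt PRED = {}" "fvt MONUS = {}" "fvt POW2 = {}"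
  "fvt TRI = {}" "fvt TROOT = {}" "fvt PAIR = {}" "fvt FST = {}" "fvt SND = {}"
proof -
  show p: "fvt PLUS = {}" by (auto simp: PLUS_def)
  show "fvt TIMES = {}" by (auto simp: TIMES_def p)
  show q: "fvt PRED = {}" by (auto simp: PRED_def)
  show m: "fvt MONUS = {}" by (auto simp: MONUS_def q)
  show "fvt POW2 = {}" by (auto simp: POW2_def p)
  show r: "fvt TRI = {}" by (auto simp: TRI_def p)
  show t: "fvt TROOT = {}" by (auto simp: TROOT_def p m r)
  show "fvt PAIR = {}" by (auto simp: PAIR_def p r)
  show f: "fvt FST = {}" by (auto simp: FST_def r t m)
  show "fvt SND = {}" by (auto simp: SND_def f t m)
qed

lemma fvt_closed_rat [simp]:
  "fvt SGN = {}" "fvt NUM = {}" "fvt DEN = {}" "fvt POS = {}" "fvt NEG = {}" "fvt CROSS = {}"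
  "fvt MINUSQ = {}" "fvt ABSQ = {}" "fvt DYADIC = {}" "fvt MINUSR = {}" "fvt ABSR = {}" "fvt RATR = {}"
proof -
  show s: "fvt SGN = {}" by (auto simp: SGN_def)
  show n: "fvt NUM = {}" by (auto simp: NUM_def)
  show d: "fvt DEN = {}" by (auto simp: DEN_def)
  show p: "fvt POS = {}" by (auto simp: POS_def s n fvt_closed)
  show g: "fvt NEG = {}" by (auto simp: NEG_def s n fvt_closed)
  show c: "fvt CROSS = {}" by (auto simp: CROSS_def p g d fvt_closed)
  show m: "fvt MINUSQ = {}" by (auto simp: MINUSQ_def Let_def c d fvt_closed)
  show a: "fvt ABSQ = {}" by (auto simp: ABSQ_def n)
  show "fvt DYADIC = {}" by (auto simp: DYADIC_def)
  show "fvt MINUSR = {}" by (auto simp: MINUSR_def m)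
  show "fvt ABSR = {}" by (auto simp: ABSR_def a)
  show "fvt RATR = {}" by (auto simp: RATR_def)
qed

context pra_model
begin

lemma ap_N [simp]: "f \<in> D1 \<Longrightarrow> n \<in> N \<Longrightarrow> f \<bullet> n \<in> N"
  by (rule ap_dom)

definition "cv t = V ge t"

text \<open>A closed term has the same value everywhere, so the equations proved for it under the
  assignment \<open>ge\<close> can be used under any other.\<close>

lemma val_closed: "fvt t = {} \<Longrightarrow> lct 0 t \<Longrightarrow> val M e b t = cv t"
  unfolding cv_def using val_fv_cong[of t e ge M b] val_cong[of 0 t b "\<lambda>_. zr M" M ge] by simp

lemma val_constants [simp]:
  "val M e b PLUS = cv PLUS" "val M e b TIMES = cv TIMES" "val M e b PRED = cv PRED"
  "val M e b MONUS = cv MONUS" "val M e b POW2 = cv POW2" "val M e b TRI = cv TRI"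
  "val M e b TROOT = cv TROOT" "val M e b PAIR = cv PAIR" "val M e b FST = cv FST" "val M e b SND = cv SND"
  "val M e b SGN = cv SGN" "val M e b NUM = cv NUM" "val M e b DEN = cv DEN" "val M e b POS = cv POS"
  "val M e b NEG = cv NEG" "val M e b CROSS = cv CROSS" "val M e b MINUSQ = cv MINUSQ"
  "val M e b ABSQ = cv ABSQ" "val M e b DYADIC = cv DYADIC" "val M e b MINUSR = cv MINUSR"
  "val M e b ABSR = cv ABSR" "val M e b RATR = cv RATR"
  by (rule val_closed; simp)+

lemma cv_dom: "typ_of [] t = Some T \<Longrightarrow> cv t \<in> dom M T"
  unfolding cv_def by (rule val_dom) simp_all

lemma cv_dom1 [simp]: "typ_of [] t = Some ty1 \<Longrightarrow> cv t \<in> D1"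
  by (rule cv_dom)

lemma cv_ap_dom1 [simp]: "typ_of [] t = Some (T0 \<rightarrowtail> ty1) \<Longrightarrow> a \<in> N \<Longrightarrow> cv t \<bullet> a \<in> D1"
  by (rule ap_dom[OF cv_dom])

text \<open>All terms defined by recursion have this shape. The base and the step stand under the
  abstraction of \<open>vn\<close>, and freshness of \<open>vn\<close> keeps them constant.\<close>

lemma lam_rec:
  fixes b
  assumes t: "typ_of [] a = Some T0" "typ_of [] t = Some T0" and fv: "vn \<notin> fvt a" "vn \<notin> fvt t" and e: "env M e"
  defines "r \<equiv> val M e b (lam vn (Rec \<cdot> Var vn \<cdot> a \<cdot> lam vi (lam vj t)))"
  shows "r \<bullet> zr M = val M e b a"
    and "n \<in> N \<Longrightarrow> r \<bullet> (su M \<bullet> n) = val M (e(vi := r \<bullet> n, vj := n)) b t"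
proof -
  let ?F = "lam vi (lam vj t)"
  have F: "val M e b ?F \<in> dom M (T0 \<rightarrowtail> T0 \<rightarrowtail> T0)" using t e by (intro val_dom) simp_all
  have a: "val M e b a \<in> N" using t e by (intro val_dom)
  have r: "r \<bullet> n = rm M \<bullet> n \<bullet> val M e b a \<bullet> val M e b ?F" if "n \<in> N" for n
  proof -
    have "val M (e(vn := n)) b a = val M e b a" "val M (e(vn := n)) b ?F = val M e b ?F"
      using fv by (auto intro!: val_fv_cong)
    then show ?thesis using t e that by (simp add: r_def val_lam)
  qed
  show "r \<bullet> zr M = val M e b a" using a F r by simp
  assume n: "n \<in> N"
  have rn: "r \<bullet> n \<in> N"
    unfolding r_def using e t n by (intro ap_dom[OF val_dom]) simp_all
  have "r \<bullet> (su M \<bullet> n) = val M e b ?F \<bullet> (r \<bullet> n) \<bullet> n" using n a F r by simp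
  then show "r \<bullet> (su M \<bullet> n) = val M (e(vi := r \<bullet> n, vj := n)) b t"
    using t e rn n by (simp add: val_lam)
qed

section \<open>The semiring of the numbers of a model\<close>

lemma PLUS_rec [simp]:
  assumes "a \<in> N"
  shows "cv PLUS \<bullet> a \<bullet> zr M = a" "n \<in> N \<Longrightarrow> cv PLUS \<bullet> a \<bullet> (su M \<bullet> n) = su M \<bullet> (cv PLUS \<bullet> a \<bullet> n)"
proof -
  have e: "env M (ge(vm := a))" using assms by simp
  have "cv PLUS \<bullet> a = V (ge(vm := a)) (lam vn (Rec \<cdot> Var vn \<cdot> Var vm \<cdot> lam vi (lam vj (Succ \<cdot> Var vi))))"
    unfolding cv_def PLUS_def using assms by (simp add: val_lam)
  then show "cv PLUS \<bullet> a \<bullet> zr M = a" "n \<in> N \<Longrightarrow> cv PLUS \<bullet> a \<bullet> (su M \<bullet> n) = su M \<bullet> (cv PLUS \<bullet> a \<bullet> n)"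
    using lam_rec[OF _ _ _ _ e, where a = "Var vm" and t = "Succ \<cdot> Var vi" and b = "\<lambda>_. zr M"] by simp_all
qed

lemma TIMES_rec [simp]:
  assumes "a \<in> N"
  shows "cv TIMES \<bullet> a \<bullet> zr M = zr M"
    "n \<in> N \<Longrightarrow> cv TIMES \<bullet> a \<bullet> (su M \<bullet> n) = cv PLUS \<bullet> (cv TIMES \<bullet> a \<bullet> n) \<bullet> a"
proof -
  have e: "env M (ge(vm := a))" using assms by simp
  have "cv TIMES \<bullet> a = V (ge(vm := a)) (lam vn (Rec \<cdot> Var vn \<cdot> Zero \<cdot> lam vi (lam vj (Var vi \<^bold>+ Var vm))))"
    unfolding cv_def TIMES_def using assms by (simp add: val_lam)
  then show "cv TIMES \<bullet> a \<bullet> zr M = zr M"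
    "n \<in> N \<Longrightarrow> cv TIMES \<bullet> a \<bullet> (su M \<bullet> n) = cv PLUS \<bullet> (cv TIMES \<bullet> a \<bullet> n) \<bullet> a"
    using lam_rec[OF _ _ _ _ e, where a = "Zero" and t = "Var vi \<^bold>+ Var vm" and b = "\<lambda>_. zr M"] by simp_all
qed

abbreviation pl (infixl "\<oplus>" 65) where "a \<oplus> b \<equiv> cv PLUS \<bullet> a \<bullet> b"
abbreviation ti (infixl "\<otimes>" 70) where "a \<otimes> b \<equiv> cv TIMES \<bullet> a \<bullet> b"

lemma add_0_N [simp]: "n \<in> N \<Longrightarrow> zr M \<oplus> n = n"
proof -
  assume n: "n \<in> N"
  have "S (ge(vk := n)) (Zero \<^bold>+ Var vk \<^bold>= Var vk)"
    by (rule arith_induct) (use n in simp_all)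
  then show ?thesis by simp
qed

lemma add_Suc_N [simp]: "m \<in> N \<Longrightarrow> n \<in> N \<Longrightarrow> su M \<bullet> m \<oplus> n = su M \<bullet> (m \<oplus> n)"
proof -
  assume mn: "m \<in> N" "n \<in> N"
  have "S (ge(vm := m, vk := n)) (Succ \<cdot> Var vm \<^bold>+ Var vk \<^bold>= Succ \<cdot> (Var vm \<^bold>+ Var vk))"
    by (rule arith_induct) (use mn in simp_all)
  then show ?thesis by simp
qed

lemma add_commute_N: "m \<in> N \<Longrightarrow> n \<in> N \<Longrightarrow> m \<oplus> n = n \<oplus> m"
proof -
  assume mn: "m \<in> N" "n \<in> N"
  have "S (ge(vm := m, vk := n)) (Var vm \<^bold>+ Var vk \<^bold>= Var vk \<^bold>+ Var vm)"
    by (rule arith_induct) (use mn in simp_all)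
  then show ?thesis by simp
qed

lemma add_assoc_N: "a \<in> N \<Longrightarrow> m \<in> N \<Longrightarrow> n \<in> N \<Longrightarrow> a \<oplus> m \<oplus> n = a \<oplus> (m \<oplus> n)"
proof -
  assume mn: "a \<in> N" "m \<in> N" "n \<in> N"
  have "S (ge(vn := a, vm := m, vk := n)) (Var vn \<^bold>+ Var vm \<^bold>+ Var vk \<^bold>= Var vn \<^bold>+ (Var vm \<^bold>+ Var vk))"
    by (rule arith_induct) (use mn in simp_all)
  then show ?thesis by simp
qed

lemma add_left_commute_N: "a \<in> N \<Longrightarrow> m \<in> N \<Longrightarrow> n \<in> N \<Longrightarrow> a \<oplus> (m \<oplus> n) = m \<oplus> (a \<oplus> n)"
  by (metis add_commute_N add_assoc_N)

lemma add_cancel_N: "a \<in> N \<Longrightarrow> m \<in> N \<Longrightarrow> n \<in> N \<Longrightarrow> m \<oplus> a = n \<oplus> a \<Longrightarrow> m = n"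
proof -
  assume mn: "a \<in> N" "m \<in> N" "n \<in> N" and eq: "m \<oplus> a = n \<oplus> a"
  have "S (ge(vm := m, vn := n, vk := a)) (Var vm \<^bold>+ Var vk \<^bold>= Var vn \<^bold>+ Var vk \<^bold>\<longrightarrow> Var vm \<^bold>= Var vn)"
    by (rule arith_induct) (use mn in \<open>simp_all, metis ap_N cv_ap_dom1 su_inj typ_closed_arith(1)\<close>)
  then show ?thesis using eq by simp
qed

lemma add_eq_0_N: "m \<in> N \<Longrightarrow> n \<in> N \<Longrightarrow> m \<oplus> n = zr M \<Longrightarrow> n = zr M"
  by (erule N_cases[of n]) simp_all

text \<open>Comparability is stated through a difference, before there is an order. The induction is
  on a formula with an existential quantifier, hence depends on arithmetical comprehension.\<close>

lemma total_N: "m \<in> N \<Longrightarrow> n \<in> N \<Longrightarrow> \<exists>k\<in>N. m \<oplus> k = n \<or> n \<oplus> k = m"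
proof -
  assume mn: "m \<in> N" "n \<in> N"
  have "S (ge(vn := n, vm := m)) (\<^bold>\<exists>vk. Var vm \<^bold>+ Var vk \<^bold>= Var vn \<^bold>\<or> Var vn \<^bold>+ Var vk \<^bold>= Var vm)"
  proof (rule arith_induct)
    fix m assume m: "m \<in> N" and "S (ge(vn := n, vm := m)) (\<^bold>\<exists>vk. Var vm \<^bold>+ Var vk \<^bold>= Var vn \<^bold>\<or> Var vn \<^bold>+ Var vk \<^bold>= Var vm)"
    then obtain k where k: "k \<in> N" "m \<oplus> k = n \<or> n \<oplus> k = m" by auto
    have "\<exists>k\<in>N. su M \<bullet> m \<oplus> k = n \<or> n \<oplus> k = su M \<bullet> m"
    proof (cases "m \<oplus> k = n")
      case True
      show ?thesis using k(1)
      proof (cases rule: N_cases)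
        case 1
        then have "n \<oplus> (su M \<bullet> zr M) = su M \<bullet> m" using True m mn by simp
        then show ?thesis using su_N zr_dom by blast
      next
        case (2 j)
        then have "su M \<bullet> m \<oplus> j = n" using True m by simp
        then show ?thesis using 2 by blast
      qed
    next
      case False
      then have "n \<oplus> (su M \<bullet> k) = su M \<bullet> m" using k m mn by simp
      then show ?thesis using k su_N by blast
    qed
    then show "S (ge(vn := n, vm := su M \<bullet> m)) (\<^bold>\<exists>vk. Var vm \<^bold>+ Var vk \<^bold>= Var vn \<^bold>\<or> Var vn \<^bold>+ Var vk \<^bold>= Var vm)"
      by simp
  qed (use mn in auto)
  then show ?thesis by simp
qed

lemma mult_0_N [simp]: "n \<in> N \<Longrightarrow> zr M \<otimes> n = zr M"
proof -
  assume n: "n \<in> N"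
  have "S (ge(vk := n)) (Zero \<^bold>* Var vk \<^bold>= Zero)"
    by (rule arith_induct) (use n in simp_all)
  then show ?thesis by simp
qed

lemma mult_Suc_N [simp]: "m \<in> N \<Longrightarrow> n \<in> N \<Longrightarrow> su M \<bullet> m \<otimes> n = m \<otimes> n \<oplus> n"
proof -
  assume mn: "m \<in> N" "n \<in> N"
  have "S (ge(vm := m, vk := n)) (Succ \<cdot> Var vm \<^bold>* Var vk \<^bold>= Var vm \<^bold>* Var vk \<^bold>+ Var vk)"
    by (rule arith_induct) (use mn in \<open>simp_all add: add_assoc_N, metis add_commute_N\<close>)
  then show ?thesis by simp
qed

lemma mult_commute_N: "m \<in> N \<Longrightarrow> n \<in> N \<Longrightarrow> m \<otimes> n = n \<otimes> m"
proof -
  assume mn: "m \<in> N" "n \<in> N"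
  have "S (ge(vm := m, vk := n)) (Var vm \<^bold>* Var vk \<^bold>= Var vk \<^bold>* Var vm)"
    by (rule arith_induct) (use mn in simp_all)
  then show ?thesis by simp
qed

lemma distrib_N: "a \<in> N \<Longrightarrow> m \<in> N \<Longrightarrow> n \<in> N \<Longrightarrow> (a \<oplus> m) \<otimes> n = a \<otimes> n \<oplus> m \<otimes> n"
proof -
  assume mn: "a \<in> N" "m \<in> N" "n \<in> N"
  have "S (ge(vn := a, vm := m, vk := n))
      ((Var vn \<^bold>+ Var vm) \<^bold>* Var vk \<^bold>= Var vn \<^bold>* Var vk \<^bold>+ Var vm \<^bold>* Var vk)"
    by (rule arith_induct) (use mn in \<open>simp_all add: add_assoc_N add_left_commute_N\<close>)
  then show ?thesis by simp
qed

lemma mult_assoc_N: "a \<in> N \<Longrightarrow> m \<in> N \<Longrightarrow> n \<in> N \<Longrightarrow> a \<otimes> m \<otimes> n = a \<otimes> (m \<otimes> n)"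
proof -
  assume mn: "a \<in> N" "m \<in> N" "n \<in> N"
  have r: "a \<otimes> (m \<oplus> n) = a \<otimes> m \<oplus> a \<otimes> n" if "n \<in> N" "m \<in> N" for m n
    using mn that by (simp add: mult_commute_N[of a] distrib_N)
  have "S (ge(vn := a, vm := m, vk := n))
      (Var vn \<^bold>* Var vm \<^bold>* Var vk \<^bold>= Var vn \<^bold>* (Var vm \<^bold>* Var vk))"
    by (rule arith_induct) (use mn in \<open>simp_all add: r\<close>)
  then show ?thesis by simp
qed

lemma mult_eq_0_N: "m \<in> N \<Longrightarrow> n \<in> N \<Longrightarrow> m \<otimes> n = zr M \<Longrightarrow> m = zr M \<or> n = zr M"
  by (erule N_cases[of n]; erule N_cases[of m]) simp_all

end

section \<open>Differences of an ordered semidomain\<close>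

definition diff_rel :: "'n::linordered_semidom \<times> 'n \<Rightarrow> 'n \<times> 'n \<Rightarrow> bool" where
  "diff_rel x y \<longleftrightarrow> fst x + snd y = fst y + snd x"

\<comment> \<open>The Grothendieck ring of the semiring; for the natural numbers this is the ring of
  integers.\<close>
quotient_type (overloaded) 'n gz = "'n::linordered_semidom \<times> 'n" / diff_rel
  morphisms gz_rep gz_abs
proof (rule equivpI)
  show "transp (diff_rel :: 'n \<times> 'n \<Rightarrow> 'n \<times> 'n \<Rightarrow> bool)"
  proof (rule transpI)
    fix x y z :: "'n \<times> 'n"
    assume "diff_rel x y" "diff_rel y z"
    then have "(fst x + snd z) + (snd y + fst y) = (fst z + snd x) + (snd y + fst y)"
      unfolding diff_rel_def by (metis add.assoc add.commute)
    then show "diff_rel x z" unfolding diff_rel_def by simp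
  qed
qed (auto simp: diff_rel_def reflp_def symp_def)

instantiation gz :: (linordered_semidom) linordered_idom
begin

lift_definition zero_gz :: "'a gz" is "(0, 0)" .

lift_definition one_gz :: "'a gz" is "(1, 0)" .

lift_definition plus_gz :: "'a gz \<Rightarrow> 'a gz \<Rightarrow> 'a gz" is "\<lambda>x y. (fst x + fst y, snd x + snd y)"
  by (simp add: diff_rel_def) (metis add.assoc add.left_commute)

lift_definition uminus_gz :: "'a gz \<Rightarrow> 'a gz" is "\<lambda>x. (snd x, fst x)"
  by (simp add: diff_rel_def add.commute)

lift_definition minus_gz :: "'a gz \<Rightarrow> 'a gz \<Rightarrow> 'a gz" is "\<lambda>x y. (fst x + snd y, snd x + fst y)"
  by (simp add: diff_rel_def) (metis add.assoc add.commute)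

lift_definition times_gz :: "'a gz \<Rightarrow> 'a gz \<Rightarrow> 'a gz"
  is "\<lambda>x y. (fst x * fst y + snd x * snd y, fst x * snd y + snd x * fst y)"
proof -
  fix x x' y y' :: "'a \<times> 'a"
  assume "diff_rel x x'" "diff_rel y y'"
  then have *: "fst x + snd x' = fst x' + snd x" "fst y + snd y' = fst y' + snd y"
    by (simp_all add: diff_rel_def)
  obtain a b c d where x: "x = (a, b)" "x' = (c, d)" by (metis surj_pair)
  obtain e f g h where y: "y = (e, f)" "y' = (g, h)" by (metis surj_pair)
  have 1: "a + d = c + b" "e + h = g + f" using * x y by simp_all
  \<comment> \<open>The summand \<open>d * e + c * f\<close> allows both equalities to be applied to
    whole factors and is cancelled at the end.\<close>
  have "(a * e + b * f + (c * h + d * g)) + (d * e + c * f)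
      = (a + d) * e + (c + b) * f + (c * h + d * g)" by (simp add: algebra_simps)
  also have "\<dots> = (c + b) * e + (a + d) * f + (c * h + d * g)" by (simp add: 1)
  also have "\<dots> = c * (e + h) + d * (g + f) + (a * f + b * e)" by (simp add: algebra_simps)
  also have "\<dots> = c * (g + f) + d * (e + h) + (a * f + b * e)" by (simp add: 1)
  also have "\<dots> = (c * g + d * h + (a * f + b * e)) + (d * e + c * f)" by (simp add: algebra_simps)
  finally have "a * e + b * f + (c * h + d * g) = c * g + d * h + (a * f + b * e)"
    by (simp only: add_right_cancel)
  then show "diff_rel (fst x * fst y + snd x * snd y, fst x * snd y + snd x * fst y)
      (fst x' * fst y' + snd x' * snd y', fst x' * snd y' + snd x' * fst y')"
    by (simp add: diff_rel_def x y ac_simps)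
qed

lift_definition less_eq_gz :: "'a gz \<Rightarrow> 'a gz \<Rightarrow> bool" is "\<lambda>x y. fst x + snd y \<le> fst y + snd x"
proof -
  fix x x' y y' :: "'a \<times> 'a"
  assume "diff_rel x x'" "diff_rel y y'"
  then have *: "fst x + snd x' = fst x' + snd x" "fst y + snd y' = fst y' + snd y"
    by (simp_all add: diff_rel_def)
  have "fst x + snd y \<le> fst y + snd x \<longleftrightarrow>
      (fst x + snd y) + (snd x' + snd y') \<le> (fst y + snd x) + (snd x' + snd y')" by simp
  also have "\<dots> \<longleftrightarrow> (fst x + snd x') + (snd y + snd y') \<le> (fst y + snd y') + (snd x + snd x')"
    by (simp add: ac_simps)
  also have "\<dots> \<longleftrightarrow> (fst x' + snd y') + (snd x + snd y) \<le> (fst y' + snd x') + (snd x + snd y)"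
    unfolding * by (simp add: ac_simps)
  finally show "fst x + snd y \<le> fst y + snd x \<longleftrightarrow> fst x' + snd y' \<le> fst y' + snd x'" by simp
qed

definition less_gz :: "'a gz \<Rightarrow> 'a gz \<Rightarrow> bool" where
  "less_gz x y \<longleftrightarrow> x \<le> y \<and> \<not> y \<le> x"

definition abs_gz :: "'a gz \<Rightarrow> 'a gz" where "abs_gz x = (if x < 0 then - x else x)"

definition sgn_gz :: "'a gz \<Rightarrow> 'a gz" where "sgn_gz x = (if x = 0 then 0 else if 0 < x then 1 else - 1)"

instance
proof
  fix x y z :: "'a gz"
  show "x \<le> y \<Longrightarrow> y \<le> z \<Longrightarrow> x \<le> z"
  proof transfer
    fix x y z :: "'a \<times> 'a"
    assume "fst x + snd y \<le> fst y + snd x" "fst y + snd z \<le> fst z + snd y"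
    then have "(fst x + snd y) + (fst y + snd z) \<le> (fst y + snd x) + (fst z + snd y)" by (rule add_mono)
    then have "(fst x + snd z) + (snd y + fst y) \<le> (fst z + snd x) + (snd y + fst y)" by (simp add: ac_simps)
    then show "fst x + snd z \<le> fst z + snd x" by simp
  qed
  show "x < y \<Longrightarrow> 0 < z \<Longrightarrow> z * x < z * y"
    unfolding less_gz_def
  proof (transfer, simp add: not_le)
    fix x y z :: "'a \<times> 'a"
    assume xy: "fst x + snd y \<le> fst y + snd x \<and> fst x + snd y < fst y + snd x"
      and z: "snd z \<le> fst z \<and> snd z < fst z"
    \<comment> \<open>Comparable elements of the semidomain have a difference, so multiplication by
      \<open>z\<close> reduces to multiplication by the positive \<open>d\<close>; the rest
      \<open>r\<close> is common to both sides.\<close>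
    define d where "d = fst z - snd z"
    have d: "fst z = snd z + d" using z by (simp add: d_def add.commute)
    have "0 < d"
    proof (rule ccontr)
      assume "\<not> 0 < d"
      then have "fst z \<le> snd z" unfolding d by (simp add: not_less)
      then show False using z by auto
    qed
    then have less: "(fst x + snd y) * d < (fst y + snd x) * d" using xy by (intro mult_strict_right_mono) auto
    define r where "r = (fst x + fst y + snd x + snd y) * snd z"
    have "fst z * fst x + snd z * snd x + (fst z * snd y + snd z * fst y) = (fst x + snd y) * d + r"
      "fst z * fst y + snd z * snd y + (fst z * snd x + snd z * fst x) = (fst y + snd x) * d + r"
      unfolding d r_def by (simp_all add: algebra_simps)
    then show "fst z * fst x + snd z * snd x + (fst z * snd y + snd z * fst y)
          \<le> fst z * fst y + snd z * snd y + (fst z * snd x + snd z * fst x) \<and>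
        fst z * fst x + snd z * snd x + (fst z * snd y + snd z * fst y)
          < fst z * fst y + snd z * snd y + (fst z * snd x + snd z * fst x)"
      using less by (simp only: add_less_cancel_right add_le_cancel_right less_imp_le)
  qed
qed (transfer; force simp: diff_rel_def less_gz_def abs_gz_def sgn_gz_def algebra_simps)+

end

lift_definition of_N :: "'n::linordered_semidom \<Rightarrow> 'n gz" is "\<lambda>n. (n, 0)" .

lemma of_N_simps [simp]:
  "of_N 0 = 0" "of_N 1 = 1" "of_N (a + b) = of_N a + of_N b" "of_N (a * b) = of_N a * of_N b"
  "of_N a \<le> of_N b \<longleftrightarrow> a \<le> b" "of_N a = of_N b \<longleftrightarrow> a = b"
  by (transfer; simp add: diff_rel_def)+

lemma of_N_less [simp]: "of_N a < of_N b \<longleftrightarrow> a < b"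
  by (simp add: less_le_not_le)

lemma gz_cases: obtains a b where "x = of_N a - of_N b"
proof -
  have "\<exists>a b. x = of_N a - of_N b" by transfer (auto simp: diff_rel_def)
  then show ?thesis using that by blast
qed

section \<open>Completion of the field of fractions\<close>

type_synonym 'n qq = "'n gz fract"

definition qn :: "'n::linordered_semidom \<Rightarrow> 'n qq" where
  "qn n = Fract (of_N n) 1"

lemma qn_simps [simp]:
  "qn 0 = 0" "qn 1 = 1" "qn (a + b) = qn a + qn b" "qn (a * b) = qn a * qn b"
  "qn a \<le> qn b \<longleftrightarrow> a \<le> b" "qn a = qn b \<longleftrightarrow> a = b" "qn a < qn b \<longleftrightarrow> a < b"
  by (simp_all add: qn_def Zero_fract_def One_fract_def eq_fract)

text \<open>The index type is general because the numbers of the model will serve as indices: in a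
  nonstandard model the values \<open>2^-n\<close> for standard \<open>n\<close> do not tend to
  0.\<close>

definition cauchy :: "('i::linorder \<Rightarrow> 'f::linordered_field) \<Rightarrow> bool" where
  "cauchy X \<longleftrightarrow> (\<forall>e>0. \<exists>k. \<forall>m\<ge>k. \<forall>n\<ge>k. \<bar>X m - X n\<bar> < e)"

definition vanish :: "('i::linorder \<Rightarrow> 'f::linordered_field) \<Rightarrow> bool" where
  "vanish X \<longleftrightarrow> (\<forall>e>0. \<forall>\<^sub>F n in at_top. \<bar>X n\<bar> < e)"

text \<open>A uniform lower bound is required, as a null sequence with positive terms represents
  0.\<close>

definition positive :: "('i::linorder \<Rightarrow> 'f::linordered_field) \<Rightarrow> bool" where
  "positive X \<longleftrightarrow> (\<exists>e>0. \<forall>\<^sub>F n in at_top. e < X n)"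

lemma cauchyD:
  assumes "cauchy X" "0 < e" obtains k where "\<And>m n. m \<ge> k \<Longrightarrow> n \<ge> k \<Longrightarrow> \<bar>X m - X n\<bar> < e"
  using assms unfolding cauchy_def by meson

lemma vanishD: "vanish X \<Longrightarrow> 0 < e \<Longrightarrow> \<forall>\<^sub>F n in at_top. \<bar>X n\<bar> < e"
  by (simp add: vanish_def)

lemma cauchy_const: "cauchy (\<lambda>_. c)"
  by (simp add: cauchy_def)

lemma cauchy_add:
  assumes "cauchy X" "cauchy Y" shows "cauchy (\<lambda>n. X n + Y n)"
  unfolding cauchy_def
proof (intro allI impI)
  fix e :: 'b assume e: "0 < e"
  obtain k where k: "\<And>m n. m \<ge> k \<Longrightarrow> n \<ge> k \<Longrightarrow> \<bar>X m - X n\<bar> < e / 2"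
    using cauchyD[OF assms(1), of "e / 2"] e by auto
  obtain l where l: "\<And>m n. m \<ge> l \<Longrightarrow> n \<ge> l \<Longrightarrow> \<bar>Y m - Y n\<bar> < e / 2"
    using cauchyD[OF assms(2), of "e / 2"] e by auto
  have "\<bar>(X m + Y m) - (X n + Y n)\<bar> < e" if "m \<ge> max k l" "n \<ge> max k l" for m n
  proof -
    have "\<bar>X m - X n\<bar> < e / 2" "\<bar>Y m - Y n\<bar> < e / 2" using k l that by simp_all
    then show ?thesis by linarith
  qed
  then show "\<exists>k. \<forall>m\<ge>k. \<forall>n\<ge>k. \<bar>(X m + Y m) - (X n + Y n)\<bar> < e" by blast
qed

lemma cauchy_minus: "cauchy X \<Longrightarrow> cauchy (\<lambda>n. - X n)"
  by (simp add: cauchy_def abs_minus_commute)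

lemma cauchy_diff: "cauchy X \<Longrightarrow> cauchy Y \<Longrightarrow> cauchy (\<lambda>n. X n - Y n)"
  using cauchy_add[of X "\<lambda>n. - Y n"] by (simp add: cauchy_minus)

lemma cauchy_bounded:
  assumes "cauchy X" obtains b k where "0 < b" "\<And>n. n \<ge> k \<Longrightarrow> \<bar>X n\<bar> < b"
proof -
  obtain k where k: "\<And>m n. m \<ge> k \<Longrightarrow> n \<ge> k \<Longrightarrow> \<bar>X m - X n\<bar> < 1"
    using cauchyD[OF assms, of 1] by auto
  have *: "\<bar>X n\<bar> < \<bar>X k\<bar> + 1" if "n \<ge> k" for n using k[OF that order_refl] by linarith
  show ?thesis by (rule that[OF _ *]) linarith
qed

lemma cauchy_mult:
  assumes "cauchy X" "cauchy Y" shows "cauchy (\<lambda>n. X n * Y n)"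
  unfolding cauchy_def
proof (intro allI impI)
  fix e :: 'b assume e: "0 < e"
  obtain a i where a: "0 < a" "\<And>n. n \<ge> i \<Longrightarrow> \<bar>X n\<bar> < a" using cauchy_bounded assms(1) by blast
  obtain b j where b: "0 < b" "\<And>n. n \<ge> j \<Longrightarrow> \<bar>Y n\<bar> < b" using cauchy_bounded assms(2) by blast
  obtain k where k: "\<And>m n. m \<ge> k \<Longrightarrow> n \<ge> k \<Longrightarrow> \<bar>X m - X n\<bar> < e / 2 / b"
    using cauchyD[OF assms(1), of "e / 2 / b"] e b by auto
  obtain l where l: "\<And>m n. m \<ge> l \<Longrightarrow> n \<ge> l \<Longrightarrow> \<bar>Y m - Y n\<bar> < e / 2 / a"
    using cauchyD[OF assms(2), of "e / 2 / a"] e a by auto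
  let ?k = "max (max i j) (max k l)"
  have "\<bar>X m * Y m - X n * Y n\<bar> < e" if "m \<ge> ?k" "n \<ge> ?k" for m n
  proof -
    have "\<bar>X m\<bar> * \<bar>Y m - Y n\<bar> \<le> a * (e / 2 / a)"
      using a(2)[of m] l[of m n] that by (intro mult_mono) (auto intro: less_imp_le)
    moreover have "\<bar>X m - X n\<bar> * \<bar>Y n\<bar> < (e / 2 / b) * b"
      using b(2)[of n] k[of m n] that by (intro mult_strict_mono) (auto simp: e b)
    moreover have "X m * Y m - X n * Y n = X m * (Y m - Y n) + (X m - X n) * Y n"
      by (simp add: algebra_simps)
    then have "\<bar>X m * Y m - X n * Y n\<bar> \<le> \<bar>X m\<bar> * \<bar>Y m - Y n\<bar> + \<bar>X m - X n\<bar> * \<bar>Y n\<bar>"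
      by (metis abs_triangle_ineq abs_mult)
    ultimately show ?thesis using a b by simp
  qed
  then show "\<exists>k. \<forall>m\<ge>k. \<forall>n\<ge>k. \<bar>X m * Y m - X n * Y n\<bar> < e" by blast
qed

lemma vanish_0 [simp]: "vanish (\<lambda>n. 0)"
  by (simp add: vanish_def)

lemma vanish_add:
  assumes "vanish X" "vanish Y" shows "vanish (\<lambda>n. X n + Y n)"
  unfolding vanish_def
proof (intro allI impI)
  fix e :: 'b assume "0 < e"
  then have "\<forall>\<^sub>F n in at_top. \<bar>X n\<bar> < e / 2" "\<forall>\<^sub>F n in at_top. \<bar>Y n\<bar> < e / 2"
    using assms vanishD half_gt_zero by blast+
  then show "\<forall>\<^sub>F n in at_top. \<bar>X n + Y n\<bar> < e"
    by eventually_elim (auto simp: field_simps abs_if split: if_splits)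
qed

lemma vanish_minus: "vanish X \<Longrightarrow> vanish (\<lambda>n. - X n)"
  by (simp add: vanish_def)

lemma vanish_diff_commute: "vanish (\<lambda>n. X n - Y n) \<Longrightarrow> vanish (\<lambda>n. Y n - X n)"
  using vanish_minus[of "\<lambda>n. X n - Y n"] by simp

lemma vanish_mult:
  assumes "cauchy X" "vanish Y" shows "vanish (\<lambda>n. X n * Y n)"
  unfolding vanish_def
proof (intro allI impI)
  fix e :: 'b assume e: "0 < e"
  obtain a i where a: "0 < a" "\<And>n. n \<ge> i \<Longrightarrow> \<bar>X n\<bar> < a" using cauchy_bounded assms(1) by blast
  have "\<forall>\<^sub>F n in at_top. \<bar>Y n\<bar> < e / a" using a e by (intro vanishD assms) simp
  moreover have "\<forall>\<^sub>F n in at_top. \<bar>X n\<bar> < a"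
    using eventually_ge_at_top[of i] by eventually_elim (rule a)
  ultimately show "\<forall>\<^sub>F n in at_top. \<bar>X n * Y n\<bar> < e"
  proof eventually_elim
    case (elim n)
    have "\<bar>X n\<bar> * \<bar>Y n\<bar> < a * (e / a)" using elim a by (intro mult_strict_mono) auto
    then show ?case using a by (simp add: abs_mult)
  qed
qed

text \<open>At some late index the absolute value is at least \<open>e\<close>, and from then on the
  sequence moves by less than \<open>e / 2\<close>. So its sign is eventually fixed, which makes the
  order of the completion linear.\<close>

lemma not_vanish:
  assumes X: "cauchy X" and nv: "\<not> vanish X" shows "positive X \<or> positive (\<lambda>n. - X n)"
proof -
  obtain e where e: "0 < e" "\<not> (\<forall>\<^sub>F n in at_top. \<bar>X n\<bar> < e)" using nv by (auto simp: vanish_def)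
  obtain k where k: "\<And>m n. m \<ge> k \<Longrightarrow> n \<ge> k \<Longrightarrow> \<bar>X m - X n\<bar> < e / 2"
    using cauchyD[OF X, of "e / 2"] e by auto
  obtain m where m: "m \<ge> k" "\<bar>X m\<bar> \<ge> e"
    using e(2) by (auto simp: eventually_at_top_linorder not_less)
  have *: "(e / 2 < X n \<and> 0 \<le> X m) \<or> (e / 2 < - X n \<and> X m < 0)" if "n \<ge> k" for n
    using k[of m n] m that e by (auto simp: abs_if field_simps split: if_splits)
  then show ?thesis
    using e by (cases "0 \<le> X m")
      (auto simp: positive_def eventually_at_top_linorder intro!: exI[of _ "e / 2"] exI[of _ k])
qed

lemma positive_add_vanish:
  assumes "positive X" "vanish (\<lambda>n. X n - Y n)" shows "positive Y"
proof -
  obtain e where e: "0 < e" "\<forall>\<^sub>F n in at_top. e < X n" using assms by (auto simp: positive_def)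
  have "\<forall>\<^sub>F n in at_top. \<bar>X n - Y n\<bar> < e / 2" using e assms by (intro vanishD) simp_all
  with e(2) have "\<forall>\<^sub>F n in at_top. e / 2 < Y n"
    by eventually_elim (auto simp: field_simps abs_if split: if_splits)
  then show ?thesis using e by (auto simp: positive_def intro!: exI[of _ "e / 2"])
qed

lemma positive_not_vanish: "positive X \<Longrightarrow> \<not> vanish X"
proof
  assume "positive X" "vanish X"
  then have "positive (\<lambda>_::'a. 0::'b)" using positive_add_vanish[of X "\<lambda>_. 0"] by simp
  then show False by (auto simp: positive_def eventually_at_top_linorder)
qed

lemma positive_add: "positive X \<Longrightarrow> positive Y \<Longrightarrow> positive (\<lambda>n. X n + Y n)"
proof -
  assume "positive X" "positive Y"
  then obtain d e where "0 < d" "\<forall>\<^sub>F n in at_top. d < X n" "0 < e" "\<forall>\<^sub>F n in at_top. e < Y n"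
    by (auto simp: positive_def)
  then have "\<forall>\<^sub>F n in at_top. d + e < X n + Y n" "0 < d + e"
    by (auto elim: eventually_elim2 intro: add_strict_mono)
  then show ?thesis by (auto simp: positive_def)
qed

lemma positive_mult: "positive X \<Longrightarrow> positive Y \<Longrightarrow> positive (\<lambda>n. X n * Y n)"
proof -
  assume "positive X" "positive Y"
  then obtain d e where de: "0 < d" "\<forall>\<^sub>F n in at_top. d < X n" "0 < e" "\<forall>\<^sub>F n in at_top. e < Y n"
    by (auto simp: positive_def)
  from de(2,4) have "\<forall>\<^sub>F n in at_top. d * e < X n * Y n"
    by eventually_elim (use de in \<open>auto intro!: mult_strict_mono\<close>)
  then show ?thesis using de by (auto simp: positive_def intro!: exI[of _ "d * e"])
qed

section \<open>The completion as an ordered ring\<close>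

definition lim_rel :: "('n::linordered_semidom \<Rightarrow> 'n qq) \<Rightarrow> ('n \<Rightarrow> 'n qq) \<Rightarrow> bool" where
  "lim_rel X Y \<longleftrightarrow> cauchy X \<and> cauchy Y \<and> vanish (\<lambda>n. X n - Y n)"

quotient_type (overloaded) 'n rr = "'n::linordered_semidom \<Rightarrow> 'n qq" / partial: lim_rel
  morphisms rr_rep rr_abs
proof (rule part_equivpI)
  show "\<exists>X :: 'n \<Rightarrow> 'n qq. lim_rel X X" by (auto simp: lim_rel_def intro: exI[of _ "\<lambda>_. 0"] cauchy_const)
  show "symp (lim_rel :: ('n \<Rightarrow> 'n qq) \<Rightarrow> _)"
    by (auto simp: lim_rel_def symp_def intro: vanish_diff_commute)
  show "transp (lim_rel :: ('n \<Rightarrow> 'n qq) \<Rightarrow> _)"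
  proof (rule transpI)
    fix X Y Z :: "'n \<Rightarrow> 'n qq"
    assume "lim_rel X Y" "lim_rel Y Z"
    then show "lim_rel X Z"
      using vanish_add[of "\<lambda>n. X n - Y n" "\<lambda>n. Y n - Z n"] by (simp add: lim_rel_def)
  qed
qed

instantiation rr :: (linordered_semidom) linordered_idom
begin

lift_definition zero_rr :: "'a rr" is "\<lambda>_. 0" by (simp add: lim_rel_def cauchy_const)

lift_definition one_rr :: "'a rr" is "\<lambda>_. 1" by (simp add: lim_rel_def cauchy_const)

lift_definition plus_rr :: "'a rr \<Rightarrow> 'a rr \<Rightarrow> 'a rr" is "\<lambda>X Y n. X n + Y n"
proof -
  fix X X' Y Y' :: "'a \<Rightarrow> 'a qq"
  assume "lim_rel X X'" "lim_rel Y Y'"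
  then show "lim_rel (\<lambda>n. X n + Y n) (\<lambda>n. X' n + Y' n)"
    using vanish_add[of "\<lambda>n. X n - X' n" "\<lambda>n. Y n - Y' n"]
    by (simp add: lim_rel_def cauchy_add algebra_simps)
qed

lift_definition uminus_rr :: "'a rr \<Rightarrow> 'a rr" is "\<lambda>X n. - X n"
  using vanish_minus by (force simp: lim_rel_def cauchy_minus vanish_diff_commute)

lift_definition times_rr :: "'a rr \<Rightarrow> 'a rr \<Rightarrow> 'a rr" is "\<lambda>X Y n. X n * Y n"
proof -
  fix X X' Y Y' :: "'a \<Rightarrow> 'a qq"
  assume "lim_rel X X'" "lim_rel Y Y'"
  then have c: "cauchy X" "cauchy X'" "cauchy Y" "cauchy Y'"
    and v: "vanish (\<lambda>n. X n - X' n)" "vanish (\<lambda>n. Y n - Y' n)" by (auto simp: lim_rel_def)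
  have "vanish (\<lambda>n. X n * (Y n - Y' n) + Y' n * (X n - X' n))"
    by (intro vanish_add vanish_mult c v)
  moreover have "(\<lambda>n. X n * (Y n - Y' n) + Y' n * (X n - X' n)) = (\<lambda>n. X n * Y n - X' n * Y' n)"
    by (simp add: algebra_simps)
  ultimately show "lim_rel (\<lambda>n. X n * Y n) (\<lambda>n. X' n * Y' n)"
    by (simp add: lim_rel_def cauchy_mult c)
qed

lift_definition less_rr :: "'a rr \<Rightarrow> 'a rr \<Rightarrow> bool" is "\<lambda>X Y. positive (\<lambda>n. Y n - X n)"
proof -
  have *: "positive (\<lambda>n. Y' n - X' n)"
    if "lim_rel X X'" "lim_rel Y Y'" "positive (\<lambda>n. Y n - X n)" for X X' Y Y' :: "'a \<Rightarrow> 'a qq"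
    using that vanish_add[of "\<lambda>n. Y n - Y' n" "\<lambda>n. X' n - X n"] vanish_diff_commute[of X X']
    by (intro positive_add_vanish[OF that(3)]) (simp add: lim_rel_def algebra_simps)
  fix X X' Y Y' :: "'a \<Rightarrow> 'a qq"
  assume a: "lim_rel X X'" "lim_rel Y Y'"
  then have "lim_rel X' X" "lim_rel Y' Y" by (auto simp: lim_rel_def intro: vanish_diff_commute)
  then show "positive (\<lambda>n. Y n - X n) \<longleftrightarrow> positive (\<lambda>n. Y' n - X' n)" using a * by blast
qed

definition less_eq_rr :: "'a rr \<Rightarrow> 'a rr \<Rightarrow> bool" where "less_eq_rr x y \<longleftrightarrow> \<not> y < x"

definition minus_rr :: "'a rr \<Rightarrow> 'a rr \<Rightarrow> 'a rr" where "minus_rr x y = x + - y"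

definition abs_rr :: "'a rr \<Rightarrow> 'a rr" where "abs_rr x = (if x < 0 then - x else x)"

definition sgn_rr :: "'a rr \<Rightarrow> 'a rr" where "sgn_rr x = (if x = 0 then 0 else if 0 < x then 1 else - 1)"

instance
proof
  have tri: "x < y \<or> x = y \<or> y < x" for x y :: "'a rr"
  proof transfer
    fix X Y :: "'a \<Rightarrow> 'a qq"
    assume "lim_rel X X" "lim_rel Y Y"
    then show "positive (\<lambda>n. Y n - X n) \<or> lim_rel X Y \<or> positive (\<lambda>n. X n - Y n)"
      using not_vanish[of "\<lambda>n. X n - Y n"] cauchy_add[of X "\<lambda>n. - Y n"]
      by (auto simp: lim_rel_def cauchy_minus)
  qed
  have tr: "x < z" if "x < y" "y < z" for x y z :: "'a rr"
    using that by transfer (use positive_add in fastforce)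
  have irr: "\<not> x < x" for x :: "'a rr"
    by transfer (use positive_not_vanish in fastforce)
  fix x y z :: "'a rr"
  show "x + y + z = x + (y + z)" by transfer (simp add: lim_rel_def cauchy_add algebra_simps)
  show "x + y = y + x" by transfer (simp add: lim_rel_def cauchy_add algebra_simps)
  show "0 + x = x" by transfer (simp add: lim_rel_def)
  show "- x + x = 0" by transfer (simp add: lim_rel_def cauchy_const)
  show "x - y = x + - y" by (rule minus_rr_def)
  show "x + y - x = y" unfolding minus_rr_def by transfer (simp add: lim_rel_def)
  show "x - y - z = x - (y + z)"
    unfolding minus_rr_def by transfer (simp add: lim_rel_def cauchy_add cauchy_minus cauchy_diff algebra_simps)
  show "0 * x = 0" "x * 0 = 0" by (transfer; simp add: lim_rel_def cauchy_const)+
  show "x * y * z = x * (y * z)" by transfer (simp add: lim_rel_def cauchy_mult algebra_simps)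
  show "x * y = y * x" by transfer (simp add: lim_rel_def cauchy_mult algebra_simps)
  show "1 * x = x" by transfer (simp add: lim_rel_def)
  show "(x + y) * z = x * z + y * z"
    by transfer (simp add: lim_rel_def cauchy_mult cauchy_add algebra_simps)
  show "(0 :: 'a rr) \<noteq> 1"
    by transfer (auto simp: lim_rel_def vanish_def eventually_at_top_linorder intro: exI[of _ 1])
  show "x < y \<longleftrightarrow> x \<le> y \<and> \<not> y \<le> x" unfolding less_eq_rr_def using tri irr tr by metis
  show "x \<le> x" using irr by (simp add: less_eq_rr_def)
  show "x \<le> y \<Longrightarrow> y \<le> z \<Longrightarrow> x \<le> z" using tri tr unfolding less_eq_rr_def by metis
  show "x \<le> y \<Longrightarrow> y \<le> x \<Longrightarrow> x = y" using tri unfolding less_eq_rr_def by metis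
  show "x \<le> y \<or> y \<le> x" using irr tr unfolding less_eq_rr_def by metis
  show "x \<le> y \<Longrightarrow> z + x \<le> z + y" unfolding less_eq_rr_def by transfer simp
  show "x < y \<Longrightarrow> 0 < z \<Longrightarrow> z * x < z * y"
  proof transfer
    fix X Y Z :: "'a \<Rightarrow> 'a qq"
    assume "positive (\<lambda>n. Y n - X n)" "positive (\<lambda>n. Z n - 0)"
    then show "positive (\<lambda>n. Z n * Y n - Z n * X n)"
      using positive_mult[of Z "\<lambda>n. Y n - X n"] by (simp add: algebra_simps)
  qed
  show "\<bar>x\<bar> = (if x < 0 then - x else x)" by (rule abs_rr_def)
  show "sgn x = (if x = 0 then 0 else if 0 < x then 1 else - 1)" by (rule sgn_rr_def)
qed

end

definition limr :: "('n::linordered_semidom \<Rightarrow> 'n qq) \<Rightarrow> 'n rr" where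
  "limr X = rr_abs X"

definition qr :: "'n::linordered_semidom qq \<Rightarrow> 'n rr" where
  "qr q = limr (\<lambda>_. q)"

lemma lim_rel_refl: "lim_rel X X \<longleftrightarrow> cauchy X"
  by (simp add: lim_rel_def)

lemma limr_add: "cauchy X \<Longrightarrow> cauchy Y \<Longrightarrow> limr X + limr Y = limr (\<lambda>n. X n + Y n)"
  unfolding limr_def by (rule plus_rr.abs_eq) (simp_all add: lim_rel_refl)

lemma limr_minus: "cauchy X \<Longrightarrow> - limr X = limr (\<lambda>n. - X n)"
  unfolding limr_def by (rule uminus_rr.abs_eq) (simp add: lim_rel_refl)

lemma limr_less: "cauchy X \<Longrightarrow> cauchy Y \<Longrightarrow> limr X < limr Y \<longleftrightarrow> positive (\<lambda>n. Y n - X n)"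
  unfolding limr_def by (rule less_rr.abs_eq) (simp_all add: lim_rel_refl)

lemma limr_cases: obtains X where "cauchy X" "x = limr X"
proof
  show "cauchy (rr_rep x)" using Quotient_rep_reflp[OF Quotient_rr, of x] by (simp add: lim_rel_def)
  show "x = limr (rr_rep x)" by (simp add: limr_def Quotient_abs_rep[OF Quotient_rr])
qed

lemma qr_simps [simp]:
  "qr 0 = 0" "qr 1 = 1" "qr (a + b) = qr a + qr b" "qr (- a) = - qr a" "qr (a - b) = qr a - qr b"
  "qr a < qr b \<longleftrightarrow> a < b" "qr a \<le> qr b \<longleftrightarrow> a \<le> b" "qr a = qr b \<longleftrightarrow> a = b" "qr \<bar>a\<bar> = \<bar>qr a\<bar>"
proof -
  show 0: "qr 0 = 0" by (simp add: qr_def limr_def zero_rr_def)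
  show "qr 1 = 1" by (simp add: qr_def limr_def one_rr_def)
  show p: "qr (a + b) = qr a + qr b" for a b by (simp add: qr_def limr_add cauchy_const)
  show m: "qr (- a) = - qr a" for a by (simp add: qr_def limr_minus cauchy_const)
  show "qr (a - b) = qr a - qr b" using p[of a "- b"] m[of b] by simp
  show l: "qr a < qr b \<longleftrightarrow> a < b" for a b
  proof -
    have "qr a < qr b \<longleftrightarrow> (\<exists>e>0. e < b - a)"
      by (auto simp: qr_def limr_less cauchy_const positive_def eventually_at_top_linorder)
    also have "\<dots> \<longleftrightarrow> a < b" using dense[of 0 "b - a"] by (auto intro: less_trans)
    finally show ?thesis .
  qed
  then show "qr a \<le> qr b \<longleftrightarrow> a \<le> b" for a b by (simp add: not_less[symmetric])
  then show "qr a = qr b \<longleftrightarrow> a = b" by (metis order_antisym order_refl)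
  show "qr \<bar>a\<bar> = \<bar>qr a\<bar>" using l[of a 0] by (simp add: abs_if m 0)
qed

lemma limr_ge:
  assumes "cauchy X" "\<And>n. n \<ge> k \<Longrightarrow> c \<le> X n" shows "qr c \<le> limr X"
proof -
  have "\<not> positive (\<lambda>n. c - X n)"
  proof
    assume "positive (\<lambda>n. c - X n)"
    then obtain e l where "0 < e" "\<And>n. n \<ge> l \<Longrightarrow> e < c - X n"
      by (auto simp: positive_def eventually_at_top_linorder)
    from this(1) this(2)[of "max k l"] assms(2)[of "max k l"] show False by simp
  qed
  then have "\<not> limr X < qr c" using assms(1) by (simp add: qr_def limr_less cauchy_const)
  then show ?thesis by simp
qed

lemma limr_le:
  assumes "cauchy X" "\<And>n. n \<ge> k \<Longrightarrow> X n \<le> c" shows "limr X \<le> qr c"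
  using limr_ge[of "\<lambda>n. - X n" k "- c"] assms by (simp add: cauchy_minus limr_minus[symmetric])

text \<open>Below every positive element of the completion there is a positive fraction, so the
  accuracies \<open>2^-n\<close> suffice in the completion as well.\<close>

lemma qr_below: 
  assumes "0 < x" obtains e where "0 < e" "qr e < x"
proof -
  obtain X where X: "cauchy X" "x = limr X" by (rule limr_cases)
  have "positive (\<lambda>n. X n - 0)"
    using assms X limr_less[of "\<lambda>_. 0" X] by (simp add: cauchy_const flip: qr_def)
  then obtain e l where e: "0 < e" "\<And>n. n \<ge> l \<Longrightarrow> e < X n"
    by (auto simp: positive_def eventually_at_top_linorder)
  have "qr e \<le> x" unfolding X by (rule limr_ge[OF X(1), of l]) (use e(2) in \<open>simp add: less_imp_le\<close>)
  \<comment> \<open>\<open>limr_ge\<close> gives a weak inequality only, hence the half.\<close>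
  then show ?thesis using e by (intro that[of "e / 2"]) (auto intro: less_le_trans[of _ "qr e"])
qed

section \<open>Arithmetic in a model\<close>

text \<open>The class \<open>linordered_semidom\<close> admits negative elements and does not fix a
  difference whose subtrahend is larger; \<open>nonneg\<close> and \<open>trunc\<close> settle both.
  Through \<open>emb\<close> the arithmetic of the model becomes arithmetic of a type class.\<close>

locale num_model = pra_model M for M :: "'u model" +
  fixes emb :: "'n::linordered_semidom \<Rightarrow> 'u"
  assumes emb_0: "emb 0 = zr M"
    and emb_Suc: "emb (n + 1) = su M \<bullet> emb n"
    and emb_add: "emb (a + b) = emb a \<oplus> emb b"
    and emb_mult: "emb (a * b) = emb a \<otimes> emb b"
    and emb_inj: "inj emb"
    and emb_range: "range emb = N"
    and nonneg [simp]: "0 \<le> (n :: 'n)"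
    and trunc: "(a :: 'n) \<le> b \<Longrightarrow> a - b = 0"
begin

definition un :: "'u \<Rightarrow> 'n" where "un = inv emb"

lemma un_emb [simp]: "un (emb n) = n"
  by (simp add: un_def emb_inj)

lemma emb_N [simp]: "emb n \<in> N"
  using emb_range by auto

lemma emb_un [simp]: "x \<in> N \<Longrightarrow> emb (un x) = x"
  using emb_range unfolding un_def by (metis f_inv_into_f)

lemma emb_eq [simp]: "emb a = emb b \<longleftrightarrow> a = b"
  using emb_inj by (auto dest: injD)

lemma emb_cases: assumes "x \<in> N" obtains n where "x = emb n"
  using assms emb_un by metis

lemma zr_emb [simp]: "zr M = emb 0"
  by (simp add: emb_0)

lemma su_emb [simp]: "su M \<bullet> emb n = emb (n + 1)"
  by (simp add: emb_Suc)

lemma add_emb [simp]: "emb a \<oplus> emb b = emb (a + b)"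
  by (simp add: emb_add)

lemma mult_emb [simp]: "emb a \<otimes> emb b = emb (a * b)"
  by (simp add: emb_mult)

lemma ball_N [simp]: "(\<forall>a\<in>N. P a) \<longleftrightarrow> (\<forall>n. P (emb n))"
  by (metis emb_N emb_un)

lemma bex_N [simp]: "(\<exists>a\<in>N. P a) \<longleftrightarrow> (\<exists>n. P (emb n))"
  by (metis emb_N emb_un)

definition at :: "'u \<Rightarrow> 'n \<Rightarrow> 'n" (infixl "\<star>" 90) where "x \<star> n = un (x \<bullet> emb n)"

lemma ap_emb: "x \<in> D1 \<Longrightarrow> x \<bullet> emb n = emb (x \<star> n)"
  by (simp add: at_def)

lemma D1_eqI: "x \<in> D1 \<Longrightarrow> y \<in> D1 \<Longrightarrow> (\<And>n. x \<star> n = y \<star> n) \<Longrightarrow> x = y"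
  by (rule extensional[of x T0 T0 y]) (auto elim!: emb_cases simp: ap_emb)

text \<open>These are the sets of numbers that the model itself contains. Induction is restricted to
  them, since an arbitrary predicate may single out the standard numbers.\<close>

definition internal :: "('n \<Rightarrow> bool) \<Rightarrow> bool" where
  "internal P \<longleftrightarrow> (\<exists>d\<in>D1. \<forall>n. d \<star> n = 0 \<longleftrightarrow> P n)"

lemma internalI:
  assumes "arith A" "wff A" "snd v = T0" "v \<noteq> vE" "v \<noteq> vG" "genv e"
    and "\<And>n. P n \<longleftrightarrow> S (e(v := emb n)) A"
  shows "internal P"
proof -
  obtain t where t: "typ_of [] t = Some T0" "\<And>e. genv e \<Longrightarrow> (V e t = zr M \<longleftrightarrow> S e A)"
    using arith_term[OF assms(1,2)] by auto
  let ?d = "V e (lam v t)"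
  have d: "?d \<in> D1" using t assms by (intro val_dom) simp_all
  have "?d \<star> n = 0 \<longleftrightarrow> P n" for n
  proof -
    have g: "genv (e(v := emb n))" using assms by simp
    have "?d \<bullet> emb n = V (e(v := emb n)) t" using t assms by (simp add: val_lam)
    then have "?d \<star> n = 0 \<longleftrightarrow> V (e(v := emb n)) t = zr M"
      using val_dom[OF t(1), of "e(v := emb n)" "\<lambda>_. zr M"] g by (auto simp: at_def elim!: emb_cases)
    then show ?thesis using t(2)[OF g] assms by simp
  qed
  then show ?thesis using d by (auto simp: internal_def)
qed

lemma internal_induct:
  assumes "internal P" "P 0" "\<And>n. P n \<Longrightarrow> P (n + 1)" shows "P n"
proof -
  obtain d where d: "d \<in> D1" "\<And>n. d \<star> n = 0 \<longleftrightarrow> P n" using assms(1) by (auto simp: internal_def)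
  have eq: "S (ge(vx := d, vn := emb n)) (Var vx \<cdot> Var vn \<^bold>= Zero) \<longleftrightarrow> P n" for n
    using d by (simp add: ap_emb)
  have "S (ge(vx := d, vn := emb n)) (Var vx \<cdot> Var vn \<^bold>= Zero)"
  proof (rule arith_induct)
    show "S (ge(vx := d, vn := zr M)) (Var vx \<cdot> Var vn \<^bold>= Zero)" using eq[of 0] assms by simp
    fix x assume "x \<in> N" and x: "S (ge(vx := d, vn := x)) (Var vx \<cdot> Var vn \<^bold>= Zero)"
    then obtain m where m: "x = emb m" by (elim emb_cases)
    then have "P m" using x eq by simp
    then show "S (ge(vx := d, vn := su M \<bullet> x)) (Var vx \<cdot> Var vn \<^bold>= Zero)"
      using eq[of "m + 1"] assms m by simp
  qed (use d in simp_all)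
  then show ?thesis using eq by simp
qed

lemma nn_cases: obtains "n = 0" | m where "(n::'n) = m + 1"
proof -
  have "emb n \<in> N" by simp
  then show ?thesis
  proof (cases rule: N_cases)
    case (2 x)
    then show ?thesis using that by (metis emb_cases su_emb emb_eq)
  qed (use that in simp)
qed

lemma less_Suc [simp]: "(a::'n) < b + 1 \<longleftrightarrow> a \<le> b"
proof
  assume "a < b + 1"
  show "a \<le> b"
  proof (rule ccontr)
    assume "\<not> a \<le> b"
    then obtain c where c: "a = b + c" "c \<noteq> 0"
      using le_add_diff_inverse[of b a] by (metis add.right_neutral nle_le)
    then obtain m where "c = m + 1" by (metis nn_cases)
    then have "b + 1 \<le> a" using c nonneg[of m] by (simp add: add_left_mono)
    then show False using \<open>a < b + 1\<close> by simp
  qed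
qed (simp add: le_less_trans)

lemma Suc_le: "(a::'n) + 1 \<le> b \<longleftrightarrow> a < b"
  using less_Suc[of b a] by (simp flip: not_less)

lemma diff_0 [simp]: "(a::'n) - b = 0 \<longleftrightarrow> a \<le> b"
proof
  assume "a - b = 0"
  show "a \<le> b"
  proof (rule ccontr)
    assume "\<not> a \<le> b"
    then have "a - b + b = a" by simp
    then show False using \<open>a - b = 0\<close> \<open>\<not> a \<le> b\<close> by simp
  qed
qed (rule trunc)

lemma nonpos [simp]: "(n::'n) \<le> 0 \<longleftrightarrow> n = 0"
  by (simp add: order_antisym_conv)

lemma not_less_0 [simp]: "\<not> (n::'n) < 0"
  by (simp add: not_less)

lemma le_exists: "(a::'n) \<le> b \<Longrightarrow> \<exists>c. b = a + c"
  using le_add_diff_inverse[of a b] by metis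

lemma le_add [simp]: "(a::'n) \<le> a + b" "a \<le> b + a"
  by simp_all

lemma zero_less_Suc [simp]: "(0::'n) < n + 1"
  by simp

lemma Suc_neq_0 [simp]: "(n::'n) + 1 \<noteq> 0"
  by (metis zero_less_Suc less_irrefl)

lemma PRED_emb [simp]: "cv PRED \<bullet> emb n = emb (n - 1)"
proof -
  have z: "cv PRED \<bullet> emb 0 = emb 0" and s: "cv PRED \<bullet> emb (m + 1) = emb m" for m
    using lam_rec[OF _ _ _ _ genv_env[OF genv_ge], where a = Zero and t = "Var vj" and b = "\<lambda>_. zr M"]
    by (simp_all add: cv_def PRED_def flip: zr_emb su_emb)
  show ?thesis by (cases n rule: nn_cases) (simp_all add: z s trunc)
qed

lemma MONUS_emb [simp]: "cv MONUS \<bullet> emb a \<bullet> emb b = emb (a - b)"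
proof -
  have e: "env M (ge(vm := emb a))" by simp
  have eq: "cv MONUS \<bullet> emb a = V (ge(vm := emb a)) (lam vn (Rec \<cdot> Var vn \<cdot> Var vm \<cdot> lam vi (lam vj (PRED \<cdot> Var vi))))"
    unfolding cv_def MONUS_def by (simp add: val_lam)
  have d: "cv MONUS \<bullet> emb a \<in> D1" by simp
  have z: "cv MONUS \<bullet> emb a \<star> 0 = a"
    using lam_rec[OF _ _ _ _ e, where a = "Var vm" and t = "PRED \<cdot> Var vi" and b = "\<lambda>_. zr M"]
    by (simp add: eq at_def del: PRED_emb)
  have s: "cv MONUS \<bullet> emb a \<star> (n + 1) = cv MONUS \<bullet> emb a \<star> n - 1" for n
  proof -
    have "cv MONUS \<bullet> emb a \<bullet> emb (n + 1) = cv PRED \<bullet> (cv MONUS \<bullet> emb a \<bullet> emb n)"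
      using lam_rec(2)[OF _ _ _ _ e, where a = "Var vm" and t = "PRED \<cdot> Var vi" and b = "\<lambda>_. zr M" and n = "emb n"]
      by (simp add: eq)
    then show ?thesis by (simp add: ap_emb)
  qed
  let ?m = "\<lambda>n. cv MONUS \<bullet> emb a \<star> n"
  \<comment> \<open>The invariant avoids subtraction: either \<open>n\<close> has reached
    \<open>a\<close> and the value is 0, or the value and \<open>n\<close> add up to
    \<open>a\<close>.\<close>
  let ?P = "\<lambda>n. (\<exists>k. a + k = n \<and> ?m n = 0) \<or> ?m n + n = a"
  have "?P b"
  proof (rule internal_induct[where P = ?P])
    show "internal ?P"
      by (rule internalI[of "(\<^bold>\<exists>vk. Var vm \<^bold>+ Var vk \<^bold>= Var vn \<^bold>\<and> Var vm \<^bold>- Var vn \<^bold>= Zero)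
          \<^bold>\<or> Var vm \<^bold>- Var vn \<^bold>+ Var vn \<^bold>= Var vm" vn "ge(vm := emb a)"]) (simp_all add: ap_emb[OF d])
    fix n assume P: "?P n"
    show "?P (n + 1)"
    proof (cases "?m n" rule: nn_cases)
      case 1
      then have "\<exists>k. a + k = n" using P by (auto intro: exI[of _ 0])
      then obtain k where "a + k = n" ..
      then have "a + (k + 1) = n + 1" by (simp add: algebra_simps)
      then show ?thesis using 1 s[of n] by (auto simp: trunc)
    next
      case (2 j)
      then have "?m n + n = a" using P Suc_neq_0[of j] by metis
      then have "j + (n + 1) = a" using 2 by (simp add: ac_simps)
      then show ?thesis using 2 s[of n] by simp
    qed
  qed (simp add: z)
  then have "?m b = a - b"
  proof
    assume "?m b + b = a"
    then show ?thesis by (metis add_diff_cancel_right')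
  qed (auto simp: trunc)
  then show ?thesis by (simp add: ap_emb)
qed

lemma at_constants [simp]: "cv PRED \<star> n = n - 1" "cv PLUS \<bullet> emb a \<star> n = a + n" "cv TIMES \<bullet> emb a \<star> n = a * n"
  "cv MONUS \<bullet> emb a \<star> n = a - n"
  by (simp_all add: at_def)

section \<open>Powers of two and Cantor pairing\<close>

definition "pw n = cv POW2 \<star> n"
definition "tri n = cv TRI \<star> n"
definition "trt n = cv TROOT \<star> n"
definition "fs n = n - tri (trt n)"
definition "sn n = trt n - fs n"
definition "pair m n = tri (m + n) + m"

lemma unary_emb [simp]: "cv POW2 \<bullet> emb n = emb (pw n)" "cv TRI \<bullet> emb n = emb (tri n)"
  "cv TROOT \<bullet> emb n = emb (trt n)"
  by (simp_all add: pw_def tri_def trt_def ap_emb)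

lemma pw_simps [simp]: "pw 0 = 1" "pw (n + 1) = pw n + pw n"
proof -
  note r = lam_rec[OF _ _ _ _ genv_env[OF genv_ge], where a = One and t = "Var vi \<^bold>+ Var vi" and b = "\<lambda>_. zr M"]
  have "cv POW2 \<bullet> emb 0 = emb 1" "cv POW2 \<bullet> emb (n + 1) = emb (pw n + pw n)"
    using r(1) r(2)[of "emb n"] by (simp_all add: cv_def[of POW2, symmetric] POW2_def[symmetric])
  then show "pw 0 = 1" "pw (n + 1) = pw n + pw n" by simp_all
qed

lemma tri_simps [simp]: "tri 0 = 0" "tri (n + 1) = tri n + (n + 1)"
proof -
  note r = lam_rec[OF _ _ _ _ genv_env[OF genv_ge], where a = Zero and t = "Var vi \<^bold>+ Succ \<cdot> Var vj" and b = "\<lambda>_. zr M"]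
  have "cv TRI \<bullet> emb 0 = emb 0" "cv TRI \<bullet> emb (n + 1) = emb (tri n + (n + 1))"
    using r(1) r(2)[of "emb n"] by (simp_all add: cv_def[of TRI, symmetric] TRI_def[symmetric])
  then show "tri 0 = 0" "tri (n + 1) = tri n + (n + 1)" by simp_all
qed

lemma trt_simps [simp]: "trt 0 = 0" "trt (n + 1) = trt n + (1 - (tri (trt n + 1) - (n + 1)))"
proof -
  note r = lam_rec[OF _ _ _ _ genv_env[OF genv_ge], where a = Zero
    and t = "Var vi \<^bold>+ (One \<^bold>- (TRI \<cdot> (Succ \<cdot> Var vi) \<^bold>- Succ \<cdot> Var vj))" and b = "\<lambda>_. zr M"]
  have "cv TROOT \<bullet> emb 0 = emb 0"
    "cv TROOT \<bullet> emb (n + 1) = emb (trt n + (1 - (tri (trt n + 1) - (n + 1))))"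
    using r(1) r(2)[of "emb n"]
    by (simp_all add: cv_def[of TROOT, symmetric] TROOT_def[symmetric] del: tri_simps)
  then show "trt 0 = 0" "trt (n + 1) = trt n + (1 - (tri (trt n + 1) - (n + 1)))"
    by (simp_all del: tri_simps)
qed

lemma FST_emb [simp]: "cv FST \<bullet> emb n = emb (fs n)"
  unfolding cv_def FST_def by (simp add: val_lam fs_def)

lemma SND_emb [simp]: "cv SND \<bullet> emb n = emb (sn n)"
  unfolding cv_def SND_def by (simp add: val_lam sn_def)

lemma PAIR_emb [simp]: "cv PAIR \<bullet> emb m \<bullet> emb n = emb (pair m n)"
  unfolding cv_def PAIR_def by (simp add: val_lam pair_def)

lemma pw_ge: "n + 1 \<le> pw n"
proof (rule internal_induct[where P = "\<lambda>n. n + 1 \<le> pw n"])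
  show "internal (\<lambda>n. n + 1 \<le> pw n)"
    by (rule internalI[of "Succ \<cdot> Var vn \<^bold>\<le> POW2 \<cdot> Var vn" vn ge]) simp_all
  fix n assume n: "n + 1 \<le> pw n"
  have "(n + 1) + 1 \<le> pw n + pw n" by (rule add_mono) (use n order_trans[of 1 "n + 1" "pw n"] in simp_all)
  then show "n + 1 + 1 \<le> pw (n + 1)" by simp
qed simp

lemma pw_pos [simp]: "0 < pw n"
  by (rule less_le_trans[OF zero_less_Suc pw_ge])

lemma pw_add: "pw (m + n) = pw m * pw n"
proof (rule internal_induct[where P = "\<lambda>n. pw (m + n) = pw m * pw n"])
  show "internal (\<lambda>n. pw (m + n) = pw m * pw n)"
    by (rule internalI[of "POW2 \<cdot> (Var vm \<^bold>+ Var vn) \<^bold>= POW2 \<cdot> Var vm \<^bold>* (POW2 \<cdot> Var vn)" vn "ge(vm := emb m)"])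
      simp_all
  fix n assume "pw (m + n) = pw m * pw n"
  then have "pw ((m + n) + 1) = pw m * pw (n + 1)" by (simp add: distrib_left)
  then show "pw (m + (n + 1)) = pw m * pw (n + 1)" by (simp add: add.assoc)
qed simp

lemma tri_mono: "tri m \<le> tri (m + n)"
proof (rule internal_induct[where P = "\<lambda>n. tri m \<le> tri (m + n)"])
  show "internal (\<lambda>n. tri m \<le> tri (m + n))"
    by (rule internalI[of "TRI \<cdot> Var vm \<^bold>\<le> TRI \<cdot> (Var vm \<^bold>+ Var vn)" vn "ge(vm := emb m)"]) simp_all
  fix n assume "tri m \<le> tri (m + n)"
  then have "tri m \<le> tri ((m + n) + 1)" by (simp add: add_increasing2)
  then show "tri m \<le> tri (m + (n + 1))" by (simp add: add.assoc)
qed simp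

text \<open>The root increases exactly when \<open>n + 1\<close> is the next triangular number.
  Before that, the truncated difference in its recursion is at least 1 and blocks the
  increment.\<close>

lemma trt_bounds: "tri (trt n) \<le> n \<and> n < tri (trt n + 1)"
proof (rule internal_induct[where P = "\<lambda>n. tri (trt n) \<le> n \<and> n < tri (trt n + 1)"])
  show "internal (\<lambda>n. tri (trt n) \<le> n \<and> n < tri (trt n + 1))"
    by (rule internalI[of "TRI \<cdot> (TROOT \<cdot> Var vn) \<^bold>\<le> Var vn \<^bold>\<and> Var vn \<^bold>< TRI \<cdot> (Succ \<cdot> (TROOT \<cdot> Var vn))" vn ge])
      (simp_all add: Suc_le del: tri_simps)
  fix n assume n: "tri (trt n) \<le> n \<and> n < tri (trt n + 1)"
  show "tri (trt (n + 1)) \<le> n + 1 \<and> n + 1 < tri (trt (n + 1) + 1)"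
  proof (cases "tri (trt n + 1) \<le> n + 1")
    case True
    then have eq: "tri (trt n + 1) = n + 1" using n by (metis Suc_le order_antisym)
    have "trt (n + 1) = trt n + 1" unfolding trt_simps eq by simp
    then show ?thesis unfolding \<open>trt (n + 1) = trt n + 1\<close> tri_simps(2)[of "trt n + 1"] eq by simp
  next
    case False
    have "n + 1 \<le> tri (trt n + 1)" using n by (simp add: Suc_le del: tri_simps)
    then have "tri (trt n + 1) - (n + 1) \<noteq> 0" using False by (simp del: tri_simps)
    then obtain j where "tri (trt n + 1) - (n + 1) = j + 1" by (metis nn_cases)
    then have "trt (n + 1) = trt n" by (simp add: trunc del: tri_simps)
    then show ?thesis using n False by (auto simp: not_le add_increasing2 simp del: tri_simps trt_simps)
  qed
qed (use tri_simps(2)[of 0] in simp)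

lemma trt_unique:
  assumes "tri s \<le> n" "n < tri (s + 1)" shows "trt n = s"
proof (rule ccontr)
  have le: "tri (a + 1) \<le> tri b" if "a < b" for a b
    using that tri_mono[of "a + 1"] le_exists[of "a + 1" b] by (auto simp: Suc_le simp del: tri_simps)
  assume "trt n \<noteq> s"
  then consider "trt n < s" | "s < trt n" by (meson neq_iff)
  then show False
    using le[of "trt n" s] le[of s "trt n"] assms trt_bounds[of n] by cases (auto dest: less_le_trans)
qed

lemma fs_pair [simp]: "fs (pair m n) = m" and sn_pair [simp]: "sn (pair m n) = n"
proof -
  have "trt (pair m n) = m + n"
    by (rule trt_unique) (simp_all add: pair_def)
  then show f: "fs (pair m n) = m" by (simp add: fs_def pair_def)
  with \<open>trt (pair m n) = m + n\<close> show "sn (pair m n) = n" by (simp add: sn_def)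
qed

section \<open>Codes of rational numbers\<close>

definition "nu q = sn (fs q)"
definition "de q = sn q + 1"
definition "ps q = nu q * (1 - fs (fs q))"
definition "ng q = nu q * (1 - (1 - fs (fs q)))"
definition "cr p q = ps p * de q + ng q * de p"
definition "mq p q = pair (pair (cr q p - cr p q) ((cr p q - cr q p) + (cr q p - cr p q))) (de p * de q - 1)"
definition "aq q = pair (pair 0 (nu q)) (sn q)"
definition "dy m n = pair (pair 0 m) (pw n - 1)"

lemma rat_emb [simp]:
  "cv SGN \<bullet> emb q = emb (fs (fs q))" "cv NUM \<bullet> emb q = emb (nu q)" "cv DEN \<bullet> emb q = emb (de q)"
  "cv POS \<bullet> emb q = emb (ps q)" "cv NEG \<bullet> emb q = emb (ng q)" "cv CROSS \<bullet> emb p \<bullet> emb q = emb (cr p q)"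
  "cv MINUSQ \<bullet> emb p \<bullet> emb q = emb (mq p q)" "cv ABSQ \<bullet> emb q = emb (aq q)"
  "cv DYADIC \<bullet> emb p \<bullet> emb q = emb (dy p q)"
proof -
  show s: "cv SGN \<bullet> emb q = emb (fs (fs q))" for q unfolding cv_def SGN_def by (simp add: val_lam)
  show n: "cv NUM \<bullet> emb q = emb (nu q)" for q unfolding cv_def NUM_def by (simp add: val_lam nu_def)
  show d: "cv DEN \<bullet> emb q = emb (de q)" for q unfolding cv_def DEN_def by (simp add: val_lam de_def)
  show p: "cv POS \<bullet> emb q = emb (ps q)" for q unfolding cv_def POS_def by (simp add: val_lam ps_def s n)
  show g: "cv NEG \<bullet> emb q = emb (ng q)" for q unfolding cv_def NEG_def by (simp add: val_lam ng_def s n)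
  show c: "cv CROSS \<bullet> emb p \<bullet> emb q = emb (cr p q)" for p q
    unfolding cv_def CROSS_def by (simp add: val_lam cr_def p g d)
  show "cv MINUSQ \<bullet> emb p \<bullet> emb q = emb (mq p q)"
    unfolding cv_def MINUSQ_def by (simp add: Let_def val_lam mq_def c d)
  show "cv ABSQ \<bullet> emb q = emb (aq q)" unfolding cv_def ABSQ_def by (simp add: val_lam aq_def n)
  show "cv DYADIC \<bullet> emb p \<bullet> emb q = emb (dy p q)" unfolding cv_def DYADIC_def by (simp add: val_lam dy_def)
qed

definition qv :: "'n \<Rightarrow> 'n qq" where "qv q = (qn (ps q) - qn (ng q)) / qn (de q)"

lemma de_pos [simp]: "0 < de q"
  by (simp add: de_def)

lemma qn_de_pos [simp]: "0 < qn (de q)"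
  using qn_simps(7)[of 0 "de q"] by simp

lemma qn_pw_pos [simp]: "0 < qn (pw n)"
  using qn_simps(7)[of 0 "pw n"] by simp

lemma cr_less: "cr p q < cr q p \<longleftrightarrow> qv p < qv q"
proof -
  have frac: "A / d < B / e \<longleftrightarrow> A * e < B * d" if "0 < d" "0 < e" for A B d e :: "'n qq"
    using that by (simp add: pos_divide_less_eq pos_less_divide_eq)
  have "qv p < qv q \<longleftrightarrow> (qn (ps p) - qn (ng p)) * qn (de q) < (qn (ps q) - qn (ng q)) * qn (de p)"
    unfolding qv_def by (rule frac) simp_all
  also have "\<dots> \<longleftrightarrow> qn (cr p q) < qn (cr q p)"
    unfolding cr_def qn_simps(3,4) by (simp only: left_diff_distrib) (simp add: algebra_simps less_diff_eq diff_less_eq)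
  finally show ?thesis by simp
qed

lemma cr_le: "cr p q \<le> cr q p \<longleftrightarrow> qv p \<le> qv q"
  using cr_less[of q p] by (simp flip: not_less)

lemma qn_diff: "b \<le> a \<Longrightarrow> qn (a - b) = qn a - qn b"
  using qn_simps(3)[of "a - b" b] by (simp del: qn_simps(3))

lemma nonzero_ge_1: "(n::'n) \<noteq> 0 \<Longrightarrow> 1 \<le> n"
  by (metis nn_cases le_add(2))

lemma qv_pair: "qv (pair (pair s a) c) = (if s = 0 then qn a else - qn a) / qn (c + 1)"
  using nonzero_ge_1[of s] by (auto simp: qv_def ps_def ng_def nu_def de_def trunc)

lemma qv_cases: "qv q = qn (nu q) / qn (de q) \<or> qv q = - qn (nu q) / qn (de q)"
  using nonzero_ge_1[of "fs (fs q)"] by (cases "fs (fs q) = 0") (auto simp: qv_def ps_def ng_def trunc)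

text \<open>At least one of the two truncated differences is 0. So their sum is the absolute value
  of the numerator, and the one in the sign position is nonzero exactly for a negative result. The
  predecessor of the denominator appears because a code \<open>c\<close> means the denominator
  \<open>c + 1\<close>.\<close>

lemma qv_mq [simp]: "qv (mq p q) = qv p - qv q"
proof -
  have 1: "de p * de q - 1 + 1 = de p * de q"
    by (intro le_add_diff_inverse2 nonzero_ge_1) (metis de_pos less_irrefl no_zero_divisors)
  have n: "qn (cr p q) - qn (cr q p) = (qn (ps p) - qn (ng p)) * qn (de q) - (qn (ps q) - qn (ng q)) * qn (de p)"
    by (simp add: cr_def algebra_simps)
  have "qv (mq p q) = (qn (cr p q) - qn (cr q p)) / (qn (de p) * qn (de q))"
    unfolding mq_def qv_pair 1 by (auto simp: trunc qn_diff less_imp_le not_le)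
  then show ?thesis unfolding n qv_def by (simp add: divide_simps less_imp_neq[symmetric])
qed

lemma qv_aq [simp]: "qv (aq q) = \<bar>qv q\<bar>"
proof -
  have "0 \<le> qn (nu q) / qn (de q)" using qn_simps(5)[of 0 "nu q"] by (simp add: less_imp_le)
  moreover have "qv (aq q) = qn (nu q) / qn (de q)" unfolding aq_def qv_pair by (simp add: de_def)
  ultimately show ?thesis using qv_cases[of q] by (metis abs_minus_cancel abs_of_nonneg minus_divide_left)
qed

definition ep :: "'n \<Rightarrow> 'n qq" where "ep n = 1 / qn (pw n)"

lemma qv_dy [simp]: "qv (dy m n) = qn m * ep n"
proof -
  have "pw n - 1 + 1 = pw n" by (intro le_add_diff_inverse2 nonzero_ge_1) (metis pw_pos less_irrefl)
  then show ?thesis unfolding dy_def qv_pair by (simp add: ep_def)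
qed

lemma ep_pos [simp]: "0 < ep n"
  by (simp add: ep_def)

lemma ep_0 [simp]: "ep 0 = 1"
  by (simp add: ep_def)

lemma ep_Suc: "ep (n + 1) + ep (n + 1) = ep n"
  unfolding ep_def pw_simps qn_simps using qn_pw_pos[of n] by (simp add: field_simps)

lemma ep_add_le: "ep (m + n) \<le> ep m"
proof -
  have "pw m * 1 \<le> pw (m + n)"
    unfolding pw_add by (intro mult_left_mono nonzero_ge_1) (metis pw_pos less_irrefl, simp)
  then have "qn (pw m) \<le> qn (pw (m + n))" by simp
  then show ?thesis unfolding ep_def by (intro divide_left_mono) simp_all
qed

lemma ep_mono: "m \<le> n \<Longrightarrow> ep n \<le> ep m"
  using ep_add_le le_exists by blast

text \<open>The numerator of a positive fraction is at least 1, as the numbers are discretely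
  ordered, and the denominator is at most some number \<open>b1\<close>, which is less than
  \<open>2^b1\<close>. In this sense the field is archimedean relative to the numbers of the
  model.\<close>

lemma ep_small: 
  assumes "0 < e" obtains n where "ep n < e"
proof -
  have "\<exists>a b. e = Fract a b \<and> 0 < b" by (induction e rule: fract_induct_pos) auto
  then obtain a b where ab: "e = Fract a b" "0 < b" by blast
  have a: "0 < a" using assms ab by (simp add: zero_less_Fract_iff)
  obtain a1 a2 where a12: "a = of_N a1 - of_N a2" by (rule gz_cases)
  obtain b1 b2 where b12: "b = of_N b1 - of_N b2" by (rule gz_cases)
  have "a2 < a1" using a a12 by simp
  then have "a2 + 1 \<le> a1" by (simp only: Suc_le)
  then have "of_N (a2 + 1) \<le> of_N a1" by (simp only: of_N_simps(5))
  then have a1: "1 \<le> a" using a12 by (simp add: algebra_simps)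
  have "b \<le> of_N b1" using b12 of_N_simps(5)[of 0 b2] by simp
  also have "of_N b1 < of_N (pw b1) * 1" using pw_ge[of b1] by (simp add: Suc_le)
  also have "of_N (pw b1) * 1 \<le> of_N (pw b1) * a"
    using a1 of_N_simps(5)[of 0 "pw b1"] by (intro mult_left_mono) simp_all
  finally have "b < of_N (pw b1) * a" by simp
  moreover have p: "0 < of_N (pw b1)" using of_N_less[of 0 "pw b1"] by simp
  ultimately have "b * (of_N (pw b1) * b) < of_N (pw b1) * a * (of_N (pw b1) * b)"
    using ab(2) by (intro mult_strict_right_mono) simp_all
  then have "Fract 1 (of_N (pw b1)) < Fract a b"
    by (subst less_fract) (use p ab(2) in \<open>auto simp only: mult_1_left mult.commute mult.left_commute\<close>)
  moreover have "ep b1 = Fract 1 (of_N (pw b1))"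
    by (simp add: ep_def qn_def One_fract_def)
  ultimately have "ep b1 < e" by (simp only: ab(1))
  then show ?thesis by (rule that)
qed

end

section \<open>Real numbers in a model\<close>

lemma lcf_real [simp]: "lct 0 s \<Longrightarrow> lcf 0 (is_real s)" "lct 0 s \<Longrightarrow> lct 0 t \<Longrightarrow> lcf 0 (s =\<^sub>R t)"
  "lct 0 s \<Longrightarrow> lct 0 t \<Longrightarrow> lcf 0 (s <\<^sub>R t)" "lct 0 s \<Longrightarrow> lcf 0 (in_unit s)"
  by (simp_all add: is_real_def eqR_def lessR_def in_unit_def)

lemma arith_real [simp]: "arith (is_real s)" "arith (s =\<^sub>R t)" "arith (s <\<^sub>R t)" "arith (in_unit s)"
  by (simp_all add: is_real_def eqR_def lessR_def in_unit_def)

lemma wff_real [simp]: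
  "typ_of [] s = Some ty1 \<Longrightarrow> wff (is_real s)"
  "typ_of [] s = Some ty1 \<Longrightarrow> typ_of [] t = Some ty1 \<Longrightarrow> wff (s =\<^sub>R t)"
  "typ_of [] s = Some ty1 \<Longrightarrow> typ_of [] t = Some ty1 \<Longrightarrow> wff (s <\<^sub>R t)"
  "typ_of [] s = Some ty1 \<Longrightarrow> wff (in_unit s)"
  by (simp_all add: is_real_def eqR_def lessR_def in_unit_def)

context num_model
begin

abbreviation "D11 \<equiv> dom M (ty1 \<rightarrowtail> ty1)"
abbreviation "D01 \<equiv> dom M (T0 \<rightarrowtail> ty1)"

lemma ap_D11 [simp]: "f \<in> D11 \<Longrightarrow> x \<in> D1 \<Longrightarrow> f \<bullet> x \<in> D1"
  by (rule ap_dom)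

lemma ap_D01 [simp]: "f \<in> D01 \<Longrightarrow> x \<in> N \<Longrightarrow> f \<bullet> x \<in> D1"
  by (rule ap_dom)

lemma ap_D2 [simp]: "f \<in> D2 \<Longrightarrow> x \<in> D1 \<Longrightarrow> f \<bullet> x \<in> N"
  by (rule ap_dom)

definition "xs x n = qv (x \<star> n)"
definition "isr x \<longleftrightarrow> (\<forall>n i. \<bar>xs x n - xs x (n + i)\<bar> < ep n)"
text \<open>In the completion, equality of reals becomes identity and their order becomes that of
  the ring; see \<open>eqr_iff\<close> and \<open>ltr_iff\<close>.\<close>

definition "rv x = limr (xs x)"
definition "er n = qr (ep n)"
definition "ltr x y \<longleftrightarrow> (\<exists>n. 2 * ep n < xs y n - xs x n)"
definition "eqr x y \<longleftrightarrow> (\<forall>n. \<bar>xs x n - xs y n\<bar> \<le> 2 * ep n)"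
definition "inU x \<longleftrightarrow> isr x \<and> 0 \<le> rv x \<and> rv x \<le> 1"

lemma inU_isr [simp]: "inU x \<Longrightarrow> isr x"
  by (simp add: inU_def)

lemma S_ratio [simp]:
  "cr p q + 1 \<le> cr q p \<longleftrightarrow> qv p < qv q" "cr p q \<le> cr q p \<longleftrightarrow> qv p \<le> qv q"
  by (simp_all add: Suc_le cr_less cr_le)

lemma rat_at [simp]:
  "cv PAIR \<bullet> emb p \<star> q = pair p q" "cv CROSS \<bullet> emb p \<star> q = cr p q" "cv MINUSQ \<bullet> emb p \<star> q = mq p q"
  "cv DYADIC \<bullet> emb p \<star> q = dy p q" "cv ABSQ \<star> q = aq q"
  by (simp_all add: at_def)

lemma qn_2 [simp]: "qn (2::'n) = 2"
  using qn_simps(3)[of "1::'n" 1] by simp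

lemma S_is_real [simp]:
  "lct 0 s \<Longrightarrow> val M e b s \<in> D1 \<Longrightarrow> sat M e b (is_real s) \<longleftrightarrow> isr (val M e b s)"
  by (simp add: is_real_def isr_def xs_def ap_emb)

lemma S_eqR_lessR [simp]:
  assumes "lct 0 s" "lct 0 t" "val M e b s \<in> D1" "val M e b t \<in> D1"
  shows "sat M e b (s =\<^sub>R t) \<longleftrightarrow> eqr (val M e b s) (val M e b t)"
    and "sat M e b (s <\<^sub>R t) \<longleftrightarrow> ltr (val M e b s) (val M e b t)"
  using assms by (simp_all add: xs_def eqR_def eqr_def lessR_def ltr_def ap_emb)

lemma qr_ep [simp]: "qr (ep n) = er n"
  by (simp add: er_def)

lemma er_pos [simp]: "0 < er n"
  using qr_simps(6)[of 0 "ep n"] by (simp add: er_def del: qr_ep)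

lemma er_0 [simp]: "er 0 = 1"
  by (simp add: er_def del: qr_ep)

lemma er_Suc: "er (n + 1) + er (n + 1) = er n"
  unfolding er_def by (simp only: flip: qr_simps(3)) (simp only: ep_Suc)

lemma er_mono: "m \<le> n \<Longrightarrow> er n \<le> er m"
  by (simp add: er_def ep_mono del: qr_ep)

lemma er_less: "m < n \<Longrightarrow> er n < er m"
proof -
  assume "m < n"
  then have "er n \<le> er (m + 1)" by (intro er_mono) (simp add: Suc_le)
  then show ?thesis using er_Suc[of m] er_pos[of "m + 1"] by linarith
qed

lemma er_less_iff: "er n < er m \<longleftrightarrow> m < n"
  using er_less[of m n] er_mono[of n m] by (auto simp: not_less[symmetric])

lemma er_small: 
  assumes "0 < k" obtains n where "er n < k"
proof -
  obtain r where r: "0 < r" "qr r < k" using qr_below assms by blast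
  obtain n where "ep n < r" using ep_small r by blast
  then have "er n < qr r" by (simp only: er_def qr_simps)
  then have "er n < k" using r by simp
  then show ?thesis by (rule that)
qed

text \<open>Four summands are what \<open>eqr_iff\<close> accumulates: two approximation errors and
  the tolerance \<open>2 * ep n\<close> in the definition of equality.\<close>

lemma er_zero: assumes "\<And>n. x \<le> er n + er n + er n + er n" shows "x \<le> 0"
proof (rule ccontr)
  assume "\<not> x \<le> 0"
  then obtain n where "er n < x" by (meson er_small not_le)
  then show False using assms[of "n + 1 + 1"] er_Suc[of n] er_Suc[of "n + 1"] by linarith
qed

lemma isr_cauchy: assumes "isr x" shows "cauchy (xs x)"
  unfolding cauchy_def
proof (intro allI impI)
  fix e :: "'n qq" assume "0 < e"
  then obtain k where k: "ep k < e / 2" using ep_small[of "e / 2"] by auto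
  have "\<bar>xs x m - xs x n\<bar> < e" if mn: "m \<ge> k" "n \<ge> k" for m n
  proof -
    obtain i j where "m = k + i" "n = k + j" using mn le_exists by metis
    then have "\<bar>xs x k - xs x m\<bar> < ep k" "\<bar>xs x k - xs x n\<bar> < ep k" using assms by (auto simp: isr_def)
    then show ?thesis using k by linarith
  qed
  then show "\<exists>k. \<forall>m\<ge>k. \<forall>n\<ge>k. \<bar>xs x m - xs x n\<bar> < e" by blast
qed

lemma rv_approx: assumes "isr x" shows "\<bar>qr (xs x n) - rv x\<bar> \<le> er n"
proof -
  have *: "\<bar>xs x n - xs x m\<bar> < ep n" if "m \<ge> n" for m
    using assms le_exists[OF that] by (auto simp: isr_def)
  have "qr (xs x n - ep n) \<le> rv x"
    unfolding rv_def by (rule limr_ge[OF isr_cauchy[OF assms], of n]) (use * in \<open>force simp: abs_if split: if_splits\<close>)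
  moreover have "rv x \<le> qr (xs x n + ep n)"
    unfolding rv_def by (rule limr_le[OF isr_cauchy[OF assms], of n]) (use * in \<open>force simp: abs_if split: if_splits\<close>)
  ultimately show ?thesis by (simp add: abs_le_iff)
qed

lemma rv_unique: 
  assumes "isr x" "\<And>n. \<bar>qr (xs x n) - r\<bar> \<le> er n + er n" shows "rv x = r"
proof -
  have "\<bar>rv x - r\<bar> \<le> er n + er n + er n + er n" for n
    using rv_approx[OF assms(1), of n] assms(2)[of n] er_pos[of n] by linarith
  then have "\<bar>rv x - r\<bar> \<le> 0" by (rule er_zero)
  then show ?thesis by simp
qed

lemma qr_2ep: "qr (2 * ep n) = er n + er n"
  by (simp only: mult_2 qr_simps er_def)

lemma two_ep: "2 * ep n < a \<longleftrightarrow> er n + er n < qr a" "a \<le> 2 * ep n \<longleftrightarrow> qr a \<le> er n + er n"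
  by (simp_all only: qr_2ep[symmetric] qr_simps)

lemma ltr_iff [simp]:
  assumes "isr x" "isr y" shows "ltr x y \<longleftrightarrow> rv x < rv y"
proof
  assume "ltr x y"
  then obtain n where "2 * ep n < xs y n - xs x n" by (auto simp: ltr_def)
  then have "er n + er n < qr (xs y n) - qr (xs x n)" by (simp only: two_ep qr_simps)
  then show "rv x < rv y"
    using rv_approx[OF assms(1), of n] rv_approx[OF assms(2), of n] by linarith
next
  assume "rv x < rv y"
  then obtain k where "er k < rv y - rv x" using er_small[of "rv y - rv x"] by auto
  \<comment> \<open>The gap exceeds \<open>er k\<close>, which is four times
    \<open>er (k + 1 + 1)\<close>; two of these are lost to the approximations and two
    remain.\<close>
  then have "er (k + 1 + 1) + er (k + 1 + 1) < qr (xs y (k + 1 + 1)) - qr (xs x (k + 1 + 1))"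
    using rv_approx[OF assms(1), of "k + 1 + 1"] rv_approx[OF assms(2), of "k + 1 + 1"]
      er_Suc[of k] er_Suc[of "k + 1"] by linarith
  then have "2 * ep (k + 1 + 1) < xs y (k + 1 + 1) - xs x (k + 1 + 1)"
    by (simp only: two_ep qr_simps)
  then show "ltr x y" unfolding ltr_def by blast
qed

lemma eqr_iff [simp]:
  assumes "isr x" "isr y" shows "eqr x y \<longleftrightarrow> rv x = rv y"
proof -
  have *: "\<bar>xs x n - xs y n\<bar> \<le> 2 * ep n \<longleftrightarrow> \<bar>qr (xs x n) - qr (xs y n)\<bar> \<le> er n + er n" for n
    by (simp only: two_ep qr_simps)
  show ?thesis
  proof
    assume "eqr x y"
    then have d: "\<bar>qr (xs x n) - qr (xs y n)\<bar> \<le> er n + er n" for n using * by (simp add: eqr_def)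
    have "\<bar>rv x - rv y\<bar> \<le> er n + er n + er n + er n" for n
      using rv_approx[OF assms(1), of n] rv_approx[OF assms(2), of n] d[of n] by linarith
    then have "\<bar>rv x - rv y\<bar> \<le> 0" by (rule er_zero)
    then show "rv x = rv y" by simp
  next
    assume eq: "rv x = rv y"
    have "\<bar>qr (xs x n) - qr (xs y n)\<bar> \<le> er n + er n" for n
      using rv_approx[OF assms(1), of n] rv_approx[OF assms(2), of n] eq by linarith
    then show "eqr x y" using * by (simp add: eqr_def)
  qed
qed

lemma MINUSR_dom [simp]: "x \<in> D1 \<Longrightarrow> y \<in> D1 \<Longrightarrow> cv MINUSR \<bullet> x \<bullet> y \<in> D1"
  by (intro ap_dom[OF ap_dom[OF cv_dom]]) simp_all

lemma ABSR_dom [simp]: "x \<in> D1 \<Longrightarrow> cv ABSR \<bullet> x \<in> D1"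
  by (intro ap_dom[OF cv_dom]) simp_all

lemma RATR_at [simp]: "cv RATR \<bullet> emb q \<star> n = q"
  unfolding cv_def RATR_def by (simp add: at_def val_lam)

lemma MINUSR_at: "x \<in> D1 \<Longrightarrow> y \<in> D1 \<Longrightarrow> cv MINUSR \<bullet> x \<bullet> y \<star> n = mq (x \<star> (n + 1)) (y \<star> (n + 1))"
proof -
  assume "x \<in> D1" "y \<in> D1"
  then have "cv MINUSR \<bullet> x \<bullet> y \<bullet> emb n = emb (mq (x \<star> (n + 1)) (y \<star> (n + 1)))"
    unfolding cv_def MINUSR_def by (simp add: val_lam ap_emb)
  then show ?thesis by (subst at_def) simp
qed

lemma ABSR_at: "x \<in> D1 \<Longrightarrow> cv ABSR \<bullet> x \<star> n = aq (x \<star> n)"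
proof -
  assume "x \<in> D1"
  then have "cv ABSR \<bullet> x \<bullet> emb n = emb (aq (x \<star> n))"
    unfolding cv_def ABSR_def by (simp add: val_lam ap_emb)
  then show ?thesis by (subst at_def) simp
qed

lemma isr_RATR [simp]: "isr (cv RATR \<bullet> emb q)"
  by (simp add: isr_def xs_def)

lemma rv_RATR [simp]: "rv (cv RATR \<bullet> emb q) = qr (qv q)"
  by (rule rv_unique) (simp_all add: xs_def less_imp_le)

lemma isr_MINUSR [simp]:
  assumes "x \<in> D1" "y \<in> D1" "isr x" "isr y" shows "isr (cv MINUSR \<bullet> x \<bullet> y)"
  unfolding isr_def
proof (intro allI)
  fix n i
  have "\<bar>xs x (n + 1) - xs x (n + 1 + i)\<bar> < ep (n + 1)" "\<bar>xs y (n + 1) - xs y (n + 1 + i)\<bar> < ep (n + 1)"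
    using assms by (auto simp: isr_def)
  then have "\<bar>(xs x (n + 1) - xs y (n + 1)) - (xs x (n + 1 + i) - xs y (n + 1 + i))\<bar> < ep n"
    using ep_Suc[of n] by linarith
  then show "\<bar>xs (cv MINUSR \<bullet> x \<bullet> y) n - xs (cv MINUSR \<bullet> x \<bullet> y) (n + i)\<bar> < ep n"
    using assms by (simp add: xs_def MINUSR_at ac_simps)
qed

lemma rv_MINUSR [simp]:
  assumes "x \<in> D1" "y \<in> D1" "isr x" "isr y" shows "rv (cv MINUSR \<bullet> x \<bullet> y) = rv x - rv y"
proof (rule rv_unique)
  fix n
  have "qr (xs (cv MINUSR \<bullet> x \<bullet> y) n) = qr (xs x (n + 1)) - qr (xs y (n + 1))"
    using assms by (simp add: xs_def MINUSR_at)
  then show "\<bar>qr (xs (cv MINUSR \<bullet> x \<bullet> y) n) - (rv x - rv y)\<bar> \<le> er n + er n"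
    using rv_approx[OF assms(3), of "n + 1"] rv_approx[OF assms(4), of "n + 1"] er_Suc[of n] er_pos[of n]
    by linarith
qed (use assms in simp)

lemma isr_ABSR [simp]:
  assumes "x \<in> D1" "isr x" shows "isr (cv ABSR \<bullet> x)"
  unfolding isr_def
proof (intro allI)
  fix n i
  have "\<bar>xs x n - xs x (n + i)\<bar> < ep n" using assms by (auto simp: isr_def)
  then have "\<bar>\<bar>xs x n\<bar> - \<bar>xs x (n + i)\<bar>\<bar> < ep n" by linarith
  then show "\<bar>xs (cv ABSR \<bullet> x) n - xs (cv ABSR \<bullet> x) (n + i)\<bar> < ep n"
    using assms by (simp add: xs_def ABSR_at)
qed

lemma rv_ABSR [simp]:
  assumes "x \<in> D1" "isr x" shows "rv (cv ABSR \<bullet> x) = \<bar>rv x\<bar>"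
proof (rule rv_unique)
  fix n
  have "qr (xs (cv ABSR \<bullet> x) n) = \<bar>qr (xs x n)\<bar>" using assms by (simp add: xs_def ABSR_at)
  then show "\<bar>qr (xs (cv ABSR \<bullet> x) n) - \<bar>rv x\<bar>\<bar> \<le> er n + er n"
    using rv_approx[OF assms(2), of n] er_pos[of n] by linarith
qed (use assms in simp)

lemma S_in_unit [simp]:
  assumes "lct 0 s" "val M e b s \<in> D1"
  shows "sat M e b (in_unit s) \<longleftrightarrow> inU (val M e b s)"
  using assms by (auto simp: in_unit_def inU_def not_less)

section \<open>Semantic counterparts of limits, continuity and height functions\<close>

definition "unitf F \<longleftrightarrow> (\<forall>x\<in>D1. inU x \<longrightarrow> isr (F \<bullet> x)) \<and>
  (\<forall>x\<in>D1. \<forall>y\<in>D1. inU x \<and> inU y \<and> rv x = rv y \<longrightarrow> rv (F \<bullet> x) = rv (F \<bullet> y))"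

definition "llim F x y \<longleftrightarrow> (\<forall>k. \<exists>n. \<forall>z\<in>D1. inU z \<and> rv z < rv x \<and> \<bar>rv x - rv z\<bar> < er n
  \<longrightarrow> \<bar>rv (F \<bullet> z) - rv y\<bar> < er k)"

definition "rlim F x y \<longleftrightarrow> (\<forall>k. \<exists>n. \<forall>z\<in>D1. inU z \<and> rv x < rv z \<and> \<bar>rv x - rv z\<bar> < er n
  \<longrightarrow> \<bar>rv (F \<bullet> z) - rv y\<bar> < er k)"

definition "regul F \<longleftrightarrow> (\<forall>x\<in>D1. inU x \<longrightarrow>
  (\<exists>y\<in>D1. isr y \<and> llim F x y) \<and> (\<exists>y\<in>D1. isr y \<and> rlim F x y))"

definition "cont F x \<longleftrightarrow> (\<forall>k. \<exists>n. \<forall>z\<in>D1. inU z \<and> \<bar>rv x - rv z\<bar> < er n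
  \<longrightarrow> \<bar>rv (F \<bullet> x) - rv (F \<bullet> z)\<bar> < er k)"

lemma unitf_isr [simp]: "unitf F \<Longrightarrow> x \<in> D1 \<Longrightarrow> inU x \<Longrightarrow> isr (F \<bullet> x)"
  by (simp add: unitf_def)

text \<open>Statements about reals translate correctly only for arguments that satisfy
  \<open>isr\<close>. The rule \<open>conj_cong\<close> makes the relativizing conjuncts available
  while the others are rewritten.\<close>

lemma S_unit_function:
  assumes "e vf \<in> D11" shows "sat M e b (unit_function (Var vf)) \<longleftrightarrow> unitf (e vf)"
  using assms by (simp add: unit_function_def unitf_def cong: conj_cong)

lemma S_left_limit:
  assumes "e vf \<in> D11" "unitf (e vf)" "e vx \<in> D1" "e vy \<in> D1" "isr (e vx)" "isr (e vy)"
  shows "sat M e b (left_limit (Var vf) (Var vx) (Var vy)) \<longleftrightarrow> llim (e vf) (e vx) (e vy)"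
  using assms by (simp add: left_limit_def llim_def cong: conj_cong)

lemma S_right_limit:
  assumes "e vf \<in> D11" "unitf (e vf)" "e vx \<in> D1" "e vy \<in> D1" "isr (e vx)" "isr (e vy)"
  shows "sat M e b (right_limit (Var vf) (Var vx) (Var vy)) \<longleftrightarrow> rlim (e vf) (e vx) (e vy)"
  using assms by (simp add: right_limit_def rlim_def cong: conj_cong)

lemma lcf_limits [simp]:
  "lcf 0 (unit_function (Var vf))" "lcf 0 (left_limit (Var vf) (Var vx) (Var vy))"
  "lcf 0 (right_limit (Var vf) (Var vx) (Var vy))" "lcf 0 (regulated (Var vf))"
  "lcf 0 (continuous_at (Var vf) (Var vx))"
  by (simp_all add: unit_function_def left_limit_def right_limit_def regulated_def continuous_at_def)

lemma S_regulated:
  assumes "e vf \<in> D11" "unitf (e vf)"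
  shows "sat M e b (regulated (Var vf)) \<longleftrightarrow> regul (e vf)"
  using assms by (simp add: regulated_def regul_def S_left_limit S_right_limit cong: conj_cong)

lemma S_continuous_at:
  assumes "e vf \<in> D11" "unitf (e vf)" "e vx \<in> D1" "inU (e vx)"
  shows "sat M e b (continuous_at (Var vf) (Var vx)) \<longleftrightarrow> cont (e vf) (e vx)"
  using assms by (simp add: continuous_at_def cont_def cong: conj_cong)

lemma S_continuity_point:
  "sat M e b regulated_has_continuity_point \<longleftrightarrow>
    (\<forall>F\<in>D11. unitf F \<and> regul F \<longrightarrow> (\<exists>x\<in>D1. inU x \<and> cont F x))"
  by (simp add: regulated_has_continuity_point_def S_unit_function S_regulated S_continuous_at cong: conj_cong)

definition "resp H \<longleftrightarrow> (\<forall>x\<in>D1. \<forall>y\<in>D1. isr x \<and> isr y \<and> rv x = rv y \<longrightarrow> H \<bullet> x = H \<bullet> y)"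

definition "rset A \<longleftrightarrow> resp A \<and> (\<forall>x\<in>D1. isr x \<longrightarrow> A \<bullet> x = emb 0 \<or> A \<bullet> x = emb 1)"

definition "fin A \<longleftrightarrow> (\<exists>n. \<forall>w\<in>D01. (\<forall>i. i \<le> n \<longrightarrow> isr (w \<bullet> emb i)) \<and>
   (\<forall>i j. i \<le> n \<and> j \<le> n \<and> i \<noteq> j \<longrightarrow> rv (w \<bullet> emb i) \<noteq> rv (w \<bullet> emb j)) \<longrightarrow>
   (\<exists>i. i \<le> n \<and> A \<bullet> (w \<bullet> emb i) \<noteq> emb 1))"

definition "height H A \<longleftrightarrow> resp H \<and> (\<forall>n. \<exists>B\<in>D2. rset B \<and>
   (\<forall>x\<in>D1. isr x \<longrightarrow> (B \<bullet> x = emb 1 \<longleftrightarrow> A \<bullet> x = emb 1 \<and> un (H \<bullet> x) < n)) \<and> fin B)"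

lemma S_real_to_nat:
  assumes "e v \<in> D2" "snd v = ty2" shows "sat M e b (real_to_nat (Var v)) \<longleftrightarrow> resp (e v)"
  using assms by (simp add: real_to_nat_def resp_def cong: conj_cong)

lemma lcf_height [simp]:
  "lcf 0 (real_to_nat (Var v))" "lcf 0 (real_set (Var v))" "lcf 0 (finite_set (Var v))"
  "lcf 0 (height_function (Var vH) (Var vA))" "lcf 0 (height_countable (Var v))"
  by (simp_all add: real_to_nat_def real_set_def finite_set_def height_function_def height_countable_def)

lemma S_real_set:
  assumes "e v \<in> D2" "snd v = ty2" shows "sat M e b (real_set (Var v)) \<longleftrightarrow> rset (e v)"
  using assms by (simp add: real_set_def rset_def S_real_to_nat cong: conj_cong)

lemma S_finite_set:
  assumes "e v \<in> D2" "snd v = ty2" shows "sat M e b (finite_set (Var v)) \<longleftrightarrow> fin (e v)"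
proof -
  have "(\<forall>i j. i \<le> n \<and> j \<le> n \<and> i \<noteq> j \<longrightarrow> \<not> eqr (w \<bullet> emb i) (w \<bullet> emb j)) \<longleftrightarrow>
      (\<forall>i j. i \<le> n \<and> j \<le> n \<and> i \<noteq> j \<longrightarrow> rv (w \<bullet> emb i) \<noteq> rv (w \<bullet> emb j))"
    if "\<forall>i. i \<le> n \<longrightarrow> isr (w \<bullet> emb i)" for n :: 'n and w
    using that by auto
  then show ?thesis using assms by (simp add: finite_set_def fin_def cong: conj_cong)
qed

lemma S_height:
  assumes "e vH \<in> D2" "e vA \<in> D2"
  shows "sat M e b (height_function (Var vH) (Var vA)) \<longleftrightarrow> height (e vH) (e vA)"
proof -
  have m: "cv MONUS \<bullet> (su M \<bullet> a) \<bullet> emb n = emb 0 \<longleftrightarrow> un a < n" if "a \<in> N" for a n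
    using that by (auto elim!: emb_cases simp: Suc_le)
  show ?thesis
    using assms by (simp add: height_function_def height_def S_real_to_nat S_real_set S_finite_set m cong: conj_cong)
qed

lemma S_NIN_alt:
  "sat M e b NIN_alt \<longleftrightarrow> (\<forall>A\<in>D2. rset A \<and> (\<forall>x\<in>D1. isr x \<longrightarrow> (A \<bullet> x = emb 1 \<longleftrightarrow> inU x))
    \<longrightarrow> \<not> (\<exists>H\<in>D2. height H A))"
  by (simp add: NIN_alt_def height_countable_def S_real_set S_height cong: conj_cong)

end

section \<open>Choice and comprehension for arithmetical formulas\<close>

context num_model
begin

lemma monus_less [simp]: "a \<in> N \<Longrightarrow> cv MONUS \<bullet> (su M \<bullet> a) \<bullet> emb n = emb 0 \<longleftrightarrow> un a < n"
  by (auto elim!: emb_cases simp: Suc_le)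

text \<open>The axiom covers quantifier-free formulas; the characteristic term turns an arithmetical
  formula into an equation.\<close>

lemma choice_01:
  assumes A: "arith A" "wff A" and v: "snd f = ty1" "snd n = T0" and e: "genv e"
    and ex: "\<And>y. \<exists>x\<in>D1. S (e(n := emb y, f := x)) A"
  shows "\<exists>g\<in>D01. \<forall>y. S (e(n := emb y, f := g \<bullet> emb y)) A"
proof -
  obtain t where t: "typ_of [] t = Some T0" "\<And>e. genv e \<Longrightarrow> (V e t = zr M \<longleftrightarrow> S e A)"
    using arith_term[OF A] by auto
  have ne: "f \<noteq> vE" "f \<noteq> vG" "n \<noteq> vE" "n \<noteq> vG" using v by auto
  have eq: "S (e(n := y, f := x)) (t \<^bold>= Zero) \<longleftrightarrow> S (e(n := y, f := x)) A" if "y \<in> N" "x \<in> D1" for x y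
    using t(2)[of "e(n := y, f := x)"] e v ne that by simp
  have "\<exists>g\<in>D01. \<forall>y\<in>N. S (e(n := y, f := g \<bullet> y)) (t \<^bold>= Zero)"
  proof (rule qf_choice_01)
    fix y assume "y \<in> N"
    then show "\<exists>x\<in>D1. S (e(n := y, f := x)) (t \<^bold>= Zero)" using ex eq by (metis emb_cases)
  qed (use t v e in simp_all)
  then obtain g where g: "g \<in> D01" "\<forall>y\<in>N. S (e(n := y, f := g \<bullet> y)) (t \<^bold>= Zero)" by blast
  then have "S (e(n := emb y, f := g \<bullet> emb y)) A" for y
    using eq[of "emb y" "g \<bullet> emb y"] by simp
  then show ?thesis using g by blast
qed

lemma choice_10:
  assumes A: "arith A" "wff A" and v: "snd f = ty1" "snd n = T0" and e: "genv e"
    and ex: "\<And>x. x \<in> D1 \<Longrightarrow> \<exists>y. S (e(f := x, n := emb y)) A"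
  shows "\<exists>g\<in>D2. \<forall>x\<in>D1. S (e(f := x, n := g \<bullet> x)) A"
proof -
  obtain t where t: "typ_of [] t = Some T0" "\<And>e. genv e \<Longrightarrow> (V e t = zr M \<longleftrightarrow> S e A)"
    using arith_term[OF A] by auto
  have ne: "f \<noteq> vE" "f \<noteq> vG" "n \<noteq> vE" "n \<noteq> vG" using v by auto
  have eq: "S (e(f := x, n := y)) (t \<^bold>= Zero) \<longleftrightarrow> S (e(f := x, n := y)) A" if "y \<in> N" "x \<in> D1" for x y
    using t(2)[of "e(f := x, n := y)"] e v ne that by simp
  have "\<exists>g\<in>D2. \<forall>x\<in>D1. S (e(f := x, n := g \<bullet> x)) (t \<^bold>= Zero)"
  proof (rule qf_choice_10)
    fix x assume "x \<in> D1"
    then show "\<exists>y\<in>N. S (e(f := x, n := y)) (t \<^bold>= Zero)" using ex eq by (metis emb_N)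
  qed (use t v e in simp_all)
  then obtain g where g: "g \<in> D2" "\<forall>x\<in>D1. S (e(f := x, n := g \<bullet> x)) (t \<^bold>= Zero)" by blast
  then have "S (e(f := x, n := g \<bullet> x)) A" if "x \<in> D1" for x
    using eq[of "g \<bullet> x" x] that by simp
  then show ?thesis using g by blast
qed

text \<open>Choice of numbers reduces to choice of sequences: the number is read off as the value at
  0, and constant sequences serve as witnesses.\<close>

lemma choice_00:
  assumes A: "arith A" "wff A" and v: "snd m = T0" "snd n = T0" "m \<noteq> n" and e: "genv e"
    and ex: "\<And>y. \<exists>z. S (e(n := emb y, m := emb z)) A"
  shows "\<exists>g\<in>D1. \<forall>y. S (e(n := emb y, m := emb (g \<star> y))) A"
proof -
  obtain f where f: "snd f = ty1" "f \<notin> fv A" using ex_fresh[of "fv A" ty1] by auto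
  let ?A = "subst (Var(m := Var f \<cdot> Zero)) A"
  have ne: "f \<noteq> n" "f \<noteq> m" using f v by auto
  have S: "S (e(n := emb y, f := x)) ?A \<longleftrightarrow> S (e(n := emb y, m := emb (x \<star> 0))) A" if "x \<in> D1" for x y
  proof -
    have "S (e(n := emb y, f := x)) ?A \<longleftrightarrow> S (e(n := emb y, f := x, m := emb (x \<star> 0))) A"
      using that f by (simp add: ap_emb)
    also have "\<dots> \<longleftrightarrow> S (e(n := emb y, m := emb (x \<star> 0))) A"
      using f(2) ne by (intro sat_fv_cong) auto
    finally show ?thesis .
  qed
  have "\<exists>g\<in>D01. \<forall>y. S (e(n := emb y, f := g \<bullet> emb y)) ?A"
  proof (rule choice_01)
    fix y
    obtain z where "S (e(n := emb y, m := emb z)) A" using ex by blast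
    then have "S (e(n := emb y, f := cv RATR \<bullet> emb z)) ?A" by (subst S) simp_all
    then show "\<exists>x\<in>D1. S (e(n := emb y, f := x)) ?A" by (rule bexI) simp
  qed (use A f v e in simp_all)
  then obtain g where g: "g \<in> D01" "\<And>y. S (e(n := emb y, f := g \<bullet> emb y)) ?A" by blast
  let ?g = "V (ge(vw := g)) (lam vn (Var vw \<cdot> Var vn \<cdot> Zero))"
  have d: "?g \<in> D1" using g by (intro val_dom) simp_all
  have "?g \<star> y = g \<bullet> emb y \<star> 0" for y
    using g by (subst at_def) (simp add: val_lam ap_emb)
  then show ?thesis using g S[of "g \<bullet> emb _"] d by (intro bexI[of _ ?g]) simp_all
qed

text \<open>The values are chosen by a formula that forces 1 or 0 in the two cases, so the choice
  functional is the characteristic function.\<close>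

lemma char_10:
  assumes A: "arith A" "wff A" and v: "snd f = ty1" and e: "genv e"
  shows "\<exists>g\<in>D2. \<forall>x\<in>D1. g \<bullet> x = (if S (e(f := x)) A then emb 1 else emb 0)"
proof -
  obtain n where n: "snd n = T0" "n \<notin> fv A" using ex_fresh[of "fv A" T0] by auto
  let ?A = "(A \<^bold>\<longrightarrow> Var n \<^bold>= One) \<^bold>\<and> (\<^bold>\<not> A \<^bold>\<longrightarrow> Var n \<^bold>= Zero)"
  have S: "S (e(f := x, n := y)) ?A \<longleftrightarrow> y = (if S (e(f := x)) A then emb 1 else emb 0)" for x y
  proof -
    have "S (e(f := x, n := y)) A \<longleftrightarrow> S (e(f := x)) A" using n by (intro sat_fv_cong) auto
    then show ?thesis by auto
  qed
  have "\<exists>g\<in>D2. \<forall>x\<in>D1. S (e(f := x, n := g \<bullet> x)) ?A"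
  proof (rule choice_10)
    fix x
    have "S (e(f := x, n := emb (if S (e(f := x)) A then 1 else 0))) ?A" by (subst S) simp
    then show "\<exists>y. S (e(f := x, n := emb y)) ?A" by (rule exI)
  qed (use A v n e in simp_all)
  then show ?thesis unfolding S .
qed

lemma er_simps [simp]: "er n \<noteq> 0" "\<bar>er n\<bar> = er n"
  using er_pos[of n] by (simp_all only: less_imp_neq[THEN not_sym] abs_of_pos not_False_eq_True)

section \<open>Height functions yield totally discontinuous regulated functions\<close>

text \<open>This is \<open>x + 2^-m\<close>; there are terms for subtracting reals but none for
  adding them.\<close>

definition "xp x m = cv MINUSR \<bullet> x \<bullet> (cv MINUSR \<bullet> (cv RATR \<bullet> emb (dy 0 0)) \<bullet> (cv RATR \<bullet> emb (dy 1 m)))"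
definition "xm x m = cv MINUSR \<bullet> x \<bullet> (cv RATR \<bullet> emb (dy 1 m))"

lemma xp_xm [simp]:
  assumes "x \<in> D1"
  shows "xp x m \<in> D1" "xm x m \<in> D1" 
    and "isr x \<Longrightarrow> isr (xp x m)" "isr x \<Longrightarrow> isr (xm x m)"
    and "isr x \<Longrightarrow> rv (xp x m) = rv x + er m" "isr x \<Longrightarrow> rv (xm x m) = rv x - er m"
  using assms by (simp_all add: xp_def xm_def)

text \<open>If both \<open>x + 2^-(n+1)\<close> and \<open>x - 2^-(n+1)\<close> were outside the
  unit interval, its length would be less than \<open>2^-n\<close>.\<close>

lemma near_point:
  assumes "x \<in> D1" "inU x"
  shows "\<exists>z\<in>D1. inU z \<and> rv z \<noteq> rv x \<and> \<bar>rv x - rv z\<bar> < er n"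
proof -
  have n: "er (n + 1) < er n" by (simp add: er_less)
  have h: "er (n + 1) + er (n + 1) \<le> 1" unfolding er_Suc using er_mono[of 0 n] by simp
  have p: "0 < er (n + 1)" by simp
  show ?thesis
  proof (cases "rv x + er (n + 1) \<le> 1")
    case True
    moreover have "0 \<le> rv x" using assms by (simp add: inU_def)
    then have "0 \<le> rv x + er (n + 1)" using p by linarith
    ultimately have "inU (xp x (n + 1))" using assms by (simp add: inU_def)
    then show ?thesis using assms n p by (intro bexI[of _ "xp x (n + 1)"]) simp_all
  next
    case False
    then have "0 \<le> rv x - er (n + 1)" using h by linarith
    moreover have "rv x \<le> 1" using assms by (simp add: inU_def)
    then have "rv x - er (n + 1) \<le> 1" using p by linarith
    ultimately have "inU (xm x (n + 1))" using assms by (simp add: inU_def)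
    then show ?thesis using assms n p by (intro bexI[of _ "xm x (n + 1)"]) simp_all
  qed
qed

text \<open>Otherwise choice would give a sequence of points of bounded height that converges to \<open>x\<close>,
  and a subsequence approaching \<open>x\<close> strictly consists of distinct points.\<close>

lemma height_isolated:
  assumes A: "\<And>x. x \<in> D1 \<Longrightarrow> isr x \<Longrightarrow> A \<bullet> x = emb 1 \<longleftrightarrow> inU x"
    and H: "H \<in> D2" "height H A" and x: "x \<in> D1" "isr x"
  shows "\<exists>n. \<forall>z\<in>D1. inU z \<and> rv z \<noteq> rv x \<and> \<bar>rv x - rv z\<bar> < er n \<longrightarrow> k \<le> un (H \<bullet> z)"
proof (rule ccontr)
  assume "\<not> ?thesis"
  then have ex: "\<exists>z\<in>D1. inU z \<and> rv z \<noteq> rv x \<and> \<bar>rv x - rv z\<bar> < er n \<and> un (H \<bullet> z) < k" for n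
    by (force simp: not_le)
  let ?F = "in_unit (Var vz) \<^bold>\<and> \<^bold>\<not> Var vz =\<^sub>R Var vx \<^bold>\<and> distR (Var vx) (Var vz) <\<^sub>R epsR (Var vn)
      \<^bold>\<and> Var vH \<cdot> Var vz \<^bold>< Var vk"
  let ?e = "ge(vx := x, vH := H, vk := emb k)"
  have F: "S (?e(vn := emb n, vz := z)) ?F \<longleftrightarrow>
      inU z \<and> rv z \<noteq> rv x \<and> \<bar>rv x - rv z\<bar> < er n \<and> un (H \<bullet> z) < k" if "z \<in> D1" for n z
    using that x H by (simp cong: conj_cong)
  have "\<exists>Z\<in>D01. \<forall>n. S (?e(vn := emb n, vz := Z \<bullet> emb n)) ?F"
    by (rule choice_01) (use x H ex F in simp_all)
  then obtain Z where Z: "Z \<in> D01" "\<And>n. inU (Z \<bullet> emb n)" "\<And>n. rv (Z \<bullet> emb n) \<noteq> rv x"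
    "\<And>n. \<bar>rv x - rv (Z \<bullet> emb n)\<bar> < er n" "\<And>n. un (H \<bullet> (Z \<bullet> emb n)) < k"
    using F by fastforce
  \<comment> \<open>\<open>g n\<close> is chosen so that \<open>2^-(g n)\<close> is below the
    distance of the \<open>n\<close>-th point from \<open>x\<close>; the point with index
    \<open>g n\<close> is then strictly closer.\<close>
  let ?G = "epsR (Var vm) <\<^sub>R distR (Var vx) (Var vw \<cdot> Var vn)"
  let ?e = "ge(vx := x, vw := Z)"
  have G: "S (?e(vn := emb n, vm := emb m)) ?G \<longleftrightarrow> er m < \<bar>rv x - rv (Z \<bullet> emb n)\<bar>" for n m
    using x Z by simp
  have "\<exists>g\<in>D1. \<forall>n. S (?e(vn := emb n, vm := emb (g \<star> n))) ?G"
  proof (rule choice_00)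
    fix n
    have "0 < \<bar>rv x - rv (Z \<bullet> emb n)\<bar>" using Z(3)[of n] by simp
    then obtain m where "er m < \<bar>rv x - rv (Z \<bullet> emb n)\<bar>" by (rule er_small)
    then show "\<exists>m. S (?e(vn := emb n, vm := emb m)) ?G" using G by blast
  qed (use x Z in simp_all)
  then obtain g where g: "g \<in> D1" "\<And>n. er (g \<star> n) < \<bar>rv x - rv (Z \<bullet> emb n)\<bar>" using G by auto
  \<comment> \<open>The indices 0, \<open>g 0\<close>, \<open>g (g 0)\<close> and so on. The
    iteration is a recursion inside the model, so that it also has nonstandard stages.\<close>
  define m where "m = V (ge(vy := g)) (lam vn (Rec \<cdot> Var vn \<cdot> Zero \<cdot> lam vi (lam vj (Var vy \<cdot> Var vi))))"
  have mu: "m \<in> D1" unfolding m_def using g by (intro val_dom) simp_all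
  have mu_Suc: "m \<star> (n + 1) = g \<star> (m \<star> n)" for n
  proof -
    have e: "env M (ge(vy := g))" using g by simp
    have "m \<bullet> emb (n + 1) = g \<bullet> (m \<bullet> emb n)"
      using lam_rec(2)[OF _ _ _ _ e, where a = Zero and t = "Var vy \<cdot> Var vi" and n = "emb n" and b = "\<lambda>_. zr M"]
      unfolding m_def by simp
    then show ?thesis using g(1) mu by (simp add: ap_emb)
  qed
  define d where "d n = \<bar>rv x - rv (Z \<bullet> emb (m \<star> n))\<bar>" for n
  have d_Suc: "d (n + 1) < d n" for n
    using Z(4)[of "m \<star> (n + 1)"] g(2)[of "m \<star> n"] by (simp add: d_def mu_Suc)
  \<comment> \<open>Descent between consecutive indices extends to arbitrary ones by induction on
    their difference, for which the comparison of distances must be written as a formula.\<close>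
  have d_less: "d (i + (n + 1)) < d i" for i n
  proof (rule internal_induct[where P = "\<lambda>n. d (i + (n + 1)) < d i"])
    show "internal (\<lambda>n. d (i + (n + 1)) < d i)"
      by (rule internalI[of "distR (Var vx) (Var vw \<cdot> (Var vy \<cdot> (Var vi \<^bold>+ Succ \<cdot> Var vn)))
          <\<^sub>R distR (Var vx) (Var vw \<cdot> (Var vy \<cdot> Var vi))" vn "ge(vx := x, vw := Z, vy := m, vi := emb i)"])
        (use x Z mu in \<open>simp_all add: d_def ap_emb[OF mu]\<close>)
    show "d (i + (n + 1 + 1)) < d i" if "d (i + (n + 1)) < d i" for n
      using that d_Suc[of "i + (n + 1)"] by (simp add: add.assoc)
  qed (use d_Suc[of i] in simp)
  define w where "w = V (ge(vw := Z, vy := m)) (lam vi (Var vw \<cdot> (Var vy \<cdot> Var vi)))"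
  have w: "w \<in> D01" unfolding w_def using Z mu by (intro val_dom) simp_all
  have w_at: "w \<bullet> emb i = Z \<bullet> emb (m \<star> i)" for i
    unfolding w_def using Z mu by (simp add: val_lam ap_emb[OF mu])
  have dist: "rv (w \<bullet> emb i) \<noteq> rv (w \<bullet> emb j)" if "i \<noteq> j" for i j
  proof -
    have *: "d j < d i" if ij: "i < j" for i j
    proof -
      obtain c where "j = i + 1 + c" using le_exists[of "i + 1" j] ij by (auto simp: Suc_le)
      then have "j = i + (c + 1)" by (simp add: ac_simps)
      then show ?thesis using d_less by simp
    qed
    have "d i \<noteq> d j" using *[of i j] *[of j i] that by (metis neq_iff)
    then show ?thesis unfolding w_at d_def by metis
  qed
  have "\<exists>B\<in>D2. rset B \<and> (\<forall>y\<in>D1. isr y \<longrightarrow>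
      (B \<bullet> y = emb 1 \<longleftrightarrow> A \<bullet> y = emb 1 \<and> un (H \<bullet> y) < k)) \<and> fin B"
    using H(2) unfolding height_def by blast
  then obtain B where B: "\<And>y. y \<in> D1 \<Longrightarrow> isr y \<Longrightarrow> B \<bullet> y = emb 1 \<longleftrightarrow> A \<bullet> y = emb 1 \<and> un (H \<bullet> y) < k" "fin B"
    by blast
  obtain n where n: "\<And>w. w \<in> D01 \<Longrightarrow> (\<forall>i. i \<le> n \<longrightarrow> isr (w \<bullet> emb i)) \<Longrightarrow>
      (\<forall>i j. i \<le> n \<and> j \<le> n \<and> i \<noteq> j \<longrightarrow> rv (w \<bullet> emb i) \<noteq> rv (w \<bullet> emb j)) \<Longrightarrow>
      \<exists>i. i \<le> n \<and> B \<bullet> (w \<bullet> emb i) \<noteq> emb 1"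
    using B(2) unfolding fin_def by blast
  have inU: "inU (w \<bullet> emb i)" for i unfolding w_at by (rule Z)
  obtain i where "B \<bullet> (w \<bullet> emb i) \<noteq> emb 1" using n[OF w] dist inU by auto
  moreover have "B \<bullet> (w \<bullet> emb i) = emb 1"
    unfolding w_at using B(1)[of "Z \<bullet> emb (m \<star> i)"] A[of "Z \<bullet> emb (m \<star> i)"] Z by simp
  ultimately show False by simp
qed

lemma continuity_imp_NIN:
  assumes cp: "\<And>F. F \<in> D11 \<Longrightarrow> unitf F \<Longrightarrow> regul F \<Longrightarrow> \<exists>x\<in>D1. inU x \<and> cont F x"
    and A: "A \<in> D2" "\<And>x. x \<in> D1 \<Longrightarrow> isr x \<Longrightarrow> A \<bullet> x = emb 1 \<longleftrightarrow> inU x"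
    and H: "H \<in> D2" "height H A"
  shows False
proof -
  define F where "F = V (ge(vH := H)) (lam vx (RATR \<cdot> (DYADIC \<cdot> One \<cdot> (Var vH \<cdot> Var vx))))"
  note iso = height_isolated[OF A(2) H]
  have F: "F \<in> D11" unfolding F_def using H by (intro val_dom) simp_all
  have Fx: "F \<bullet> x = cv RATR \<bullet> emb (dy 1 (un (H \<bullet> x)))" if "x \<in> D1" for x
  proof -
    have "F \<bullet> x = cv RATR \<bullet> (cv DYADIC \<bullet> emb 1 \<bullet> (H \<bullet> x))"
      unfolding F_def using that H by (simp add: val_lam)
    also have "H \<bullet> x = emb (un (H \<bullet> x))" using that H by simp
    finally show ?thesis by simp
  qed
  have rvF: "rv (F \<bullet> x) = er (un (H \<bullet> x))" if "x \<in> D1" for x using that by (simp add: Fx)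
  have "resp H" using H(2) unfolding height_def by blast
  have unit: "unitf F" unfolding unitf_def
  proof (intro conjI ballI impI)
    fix x y assume xy: "x \<in> D1" "y \<in> D1" "inU x \<and> inU y \<and> rv x = rv y"
    then have "H \<bullet> x = H \<bullet> y" using \<open>resp H\<close> inU_isr unfolding resp_def by blast
    then show "rv (F \<bullet> x) = rv (F \<bullet> y)" using xy by (simp add: Fx)
  qed (simp add: Fx)
  let ?z = "cv RATR \<bullet> emb (dy 0 0)"
  \<comment> \<open>An estimate on a deleted neighbourhood gives both one-sided limits at
    once.\<close>
  have lim: "\<exists>n. \<forall>z\<in>D1. inU z \<and> rv z \<noteq> rv x \<and> \<bar>rv x - rv z\<bar> < er n \<longrightarrow> \<bar>rv (F \<bullet> z) - rv ?z\<bar> < er k"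
    if x: "x \<in> D1" "inU x" for x k
  proof -
    obtain n where n: "\<And>z. z \<in> D1 \<Longrightarrow> inU z \<Longrightarrow> rv z \<noteq> rv x \<Longrightarrow> \<bar>rv x - rv z\<bar> < er n \<Longrightarrow> k + 1 \<le> un (H \<bullet> z)"
      using iso[of x "k + 1"] x by auto
    have "\<bar>rv (F \<bullet> z) - rv ?z\<bar> < er k" if "z \<in> D1" "inU z" "rv z \<noteq> rv x" "\<bar>rv x - rv z\<bar> < er n" for z
      using n[OF that] that(1) er_pos[of "un (H \<bullet> z)"] by (simp add: rvF er_less_iff Suc_le abs_of_pos)
    then show ?thesis by blast
  qed
  have "regul F" unfolding regul_def
  proof (intro ballI impI conjI)
    fix x assume x: "x \<in> D1" "inU x"
    have "llim F x ?z" "rlim F x ?z"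
      unfolding llim_def rlim_def using lim[OF x] by (metis less_irrefl)+
    then show "\<exists>y\<in>D1. isr y \<and> llim F x y" "\<exists>y\<in>D1. isr y \<and> rlim F x y"
      by (auto intro!: bexI[of _ ?z])
  qed
  then obtain x where x: "x \<in> D1" "inU x" "cont F x" using cp F unit by blast
  let ?h = "un (H \<bullet> x)"
  obtain n where n: "\<And>z. z \<in> D1 \<Longrightarrow> inU z \<Longrightarrow> \<bar>rv x - rv z\<bar> < er n \<Longrightarrow> \<bar>rv (F \<bullet> x) - rv (F \<bullet> z)\<bar> < er (?h + 1)"
    using x unfolding cont_def by blast
  obtain m where m: "\<And>z. z \<in> D1 \<Longrightarrow> inU z \<Longrightarrow> rv z \<noteq> rv x \<Longrightarrow> \<bar>rv x - rv z\<bar> < er m \<Longrightarrow> ?h + 1 \<le> un (H \<bullet> z)"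
    using iso[of x "?h + 1"] x by auto
  obtain z where z: "z \<in> D1" "inU z" "rv z \<noteq> rv x" "\<bar>rv x - rv z\<bar> < er (n + m)"
    using near_point x by blast
  have "er (n + m) \<le> er n" "er (n + m) \<le> er m" by (simp_all add: er_mono)
  then have z': "\<bar>rv x - rv z\<bar> < er n" "\<bar>rv x - rv z\<bar> < er m" using z(4) by simp_all
  \<comment> \<open>At the nearby point \<open>z\<close> the height exceeds \<open>?h\<close>, so
    the value there is at most half of the value \<open>er ?h\<close> at \<open>x\<close>. The two
    differ by at least \<open>er (?h + 1)\<close>, against continuity.\<close>
  have "\<bar>er ?h - er (un (H \<bullet> z))\<bar> < er (?h + 1)" using n[OF z(1,2) z'(1)] x z by (simp add: rvF)
  moreover have "er (un (H \<bullet> z)) \<le> er (?h + 1)" using m[OF z(1-3) z'(2)] by (rule er_mono)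
  ultimately show False using er_Suc[of ?h] by linarith
qed

end

section \<open>Jumps of regulated functions\<close>

abbreviation "vc \<equiv> (''c'', T0 \<rightarrowtail> T0 \<rightarrowtail> T0 \<rightarrowtail> ty1)"

abbreviation "plusE s m \<equiv> MINUSR \<cdot> s \<cdot> (MINUSR \<cdot> zeroR \<cdot> epsR m)"
abbreviation "minusE s m \<equiv> MINUSR \<cdot> s \<cdot> epsR m"

text \<open>A quantifier over all points near \<open>x\<close> would range over reals. For a
  regulated function it is enough to probe the points at distance \<open>2^-n\<close> on either
  side, for arbitrarily large \<open>n\<close>, and this makes the formula arithmetical.\<close>

definition jumpF :: fm where
  "jumpF = (\<^bold>\<forall>vm. \<^bold>\<exists>vn. Var vm \<^bold>\<le> Var vn \<^bold>\<and>
    ((in_unit (plusE (Var vx) (Var vn)) \<^bold>\<and>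
        epsR (Var vk) <\<^sub>R distR (Var vf \<cdot> Var vx) (Var vf \<cdot> plusE (Var vx) (Var vn)))
    \<^bold>\<or> (in_unit (minusE (Var vx) (Var vn)) \<^bold>\<and>
        epsR (Var vk) <\<^sub>R distR (Var vf \<cdot> Var vx) (Var vf \<cdot> minusE (Var vx) (Var vn)))))"

lemma jumpF [simp]: "arith jumpF" "wff jumpF" "lcf 0 jumpF"
  by (simp_all add: jumpF_def)

text \<open>The number of zeros of a sequence below a bound: the truncated difference from 1 is 1
  exactly at a zero. Zero is the truth value true of characteristic terms.\<close>

definition CNT :: tm where
  "CNT = lam vx (lam vn (Rec \<cdot> Var vn \<cdot> Zero \<cdot> lam vi (lam vj (Var vi \<^bold>+ (One \<^bold>- Var vx \<cdot> Var vj)))))"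

lemma CNT [simp]: "typ_of [] CNT = Some (ty1 \<rightarrowtail> ty1)" "lct k CNT" "fvt CNT = {}"
proof -
  show t: "typ_of [] CNT = Some (ty1 \<rightarrowtail> ty1)" by (simp add: CNT_def)
  show "lct k CNT" by (rule lct_typ[OF t])
  show "fvt CNT = {}" by (auto simp: CNT_def)
qed

context num_model
begin

lemma xp_xm_fold [simp]:
  "cv MINUSR \<bullet> x \<bullet> (cv RATR \<bullet> emb (dy 1 m)) = xm x m"
  "cv MINUSR \<bullet> x \<bullet> xm (cv RATR \<bullet> emb (dy 0 0)) m = xp x m"
  by (simp_all add: xm_def xp_def)

definition "jmp F x k \<longleftrightarrow> (\<forall>m. \<exists>n. m \<le> n \<and> (\<exists>z\<in>{xp x n, xm x n}. inU z \<and>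
  er k < \<bar>rv (F \<bullet> x) - rv (F \<bullet> z)\<bar>))"

lemma S_jumpF:
  assumes "e vf = F" "F \<in> D11" "unitf F" "e vx = x" "x \<in> D1" "inU x" "e vk = emb k"
  shows "sat M e b jumpF \<longleftrightarrow> jmp F x k"
  using assms by (simp add: jumpF_def jmp_def cong: conj_cong)

text \<open>Otherwise induction on \<open>n\<close> shows that no \<open>j \<le> n\<close> satisfies
  \<open>P\<close>; the bounded quantifier is arithmetical.\<close>

lemma internal_least:
  assumes "internal P" "P n"
  shows "\<exists>m. P m \<and> (\<forall>j<m. \<not> P j)"
proof (rule ccontr)
  assume none: "\<not> ?thesis"
  obtain d where d: "d \<in> D1" "\<And>n. d \<star> n = 0 \<longleftrightarrow> P n" using assms(1) by (auto simp: internal_def)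
  have "\<forall>j\<le>n. \<not> P j"
  proof (rule internal_induct[where P = "\<lambda>n. \<forall>j\<le>n. \<not> P j"])
    show "internal (\<lambda>n. \<forall>j\<le>n. \<not> P j)"
      by (rule internalI[of "\<^bold>\<forall>vj. Var vj \<^bold>\<le> Var vn \<^bold>\<longrightarrow> \<^bold>\<not> Var vx \<cdot> Var vj \<^bold>= Zero" vn "ge(vx := d)"])
        (use d in \<open>simp_all add: ap_emb\<close>)
    show "\<forall>j\<le>0. \<not> P j" using none by auto
    fix n assume n: "\<forall>j\<le>n. \<not> P j"
    then have "\<not> P (n + 1)" using none by auto
    then show "\<forall>j\<le>n + 1. \<not> P j" using n by (metis less_Suc nless_le)
  qed
  then show False using assms(2) by blast
qed

text \<open>A height function has to respect equality of reals, so the jump sizes at a point must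
  not depend on the sequence that represents it.\<close>

lemma jmp_cong:
  assumes "unitf F" "x \<in> D1" "y \<in> D1" "inU x" "inU y" "rv x = rv y" "jmp F x k"
  shows "jmp F y k"
  unfolding jmp_def
proof
  fix m
  have cong: "rv (F \<bullet> z) = rv (F \<bullet> z')" if "z \<in> D1" "z' \<in> D1" "inU z" "inU z'" "rv z = rv z'" for z z'
    using assms(1) that unfolding unitf_def by blast
  obtain n z where n: "m \<le> n" "z \<in> {xp x n, xm x n}" "inU z" "er k < \<bar>rv (F \<bullet> x) - rv (F \<bullet> z)\<bar>"
    using assms(7) unfolding jmp_def by blast
  have x: "rv (F \<bullet> x) = rv (F \<bullet> y)" using assms by (intro cong) auto
  consider "z = xp x n" | "z = xm x n" using n by blast
  then have "\<exists>z'\<in>{xp y n, xm y n}. inU z' \<and> er k < \<bar>rv (F \<bullet> y) - rv (F \<bullet> z')\<bar>"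
  proof cases
    case 1
    have "inU (xp y n)" using n(3) 1 assms by (simp add: inU_def)
    moreover have "rv (F \<bullet> xp x n) = rv (F \<bullet> xp y n)" using n(3) 1 assms calculation by (intro cong) simp_all
    ultimately show ?thesis using n 1 x by auto
  next
    case 2
    have "inU (xm y n)" using n(3) 2 assms by (simp add: inU_def)
    moreover have "rv (F \<bullet> xm x n) = rv (F \<bullet> xm y n)" using n(3) 2 assms calculation by (intro cong) simp_all
    ultimately show ?thesis using n 2 x by auto
  qed
  then show "\<exists>n. m \<le> n \<and> (\<exists>z\<in>{xp y n, xm y n}. inU z \<and> er k < \<bar>rv (F \<bullet> y) - rv (F \<bullet> z)\<bar>)"
    using n(1) by blast
qed

text \<open>If a one-sided limit differs from the value at \<open>x\<close> by more than
  \<open>2^-k\<close>, then all late probes on that side differ from the value by more than half of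
  this. At an end point the outer limit is unconstrained, but no points of the interval lie on that
  side; hence the side conditions on \<open>rv x\<close>.\<close>

lemma discontinuity_jump:
  assumes F: "F \<in> D11" "unitf F" "regul F" and x: "x \<in> D1" "inU x" "\<not> cont F x"
  shows "\<exists>k. jmp F x k"
proof -
  have xr: "isr x" "0 \<le> rv x" "rv x \<le> 1" using x by (simp_all add: inU_def)
  obtain l r where l: "l \<in> D1" "isr l" "llim F x l" and r: "r \<in> D1" "isr r" "rlim F x r"
    using F(3) x unfolding regul_def by blast
  have right: "\<exists>k. jmp F x k" if ne: "rv r \<noteq> rv (F \<bullet> x)" and lt: "rv x < 1"
  proof -
    obtain k where "er k < \<bar>rv (F \<bullet> x) - rv r\<bar>" using er_small[of "\<bar>rv (F \<bullet> x) - rv r\<bar>"] ne by auto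
    then have k: "er (k + 1) + er (k + 1) < \<bar>rv (F \<bullet> x) - rv r\<bar>" by (simp only: er_Suc)
    obtain n0 where n0: "\<And>z. z \<in> D1 \<Longrightarrow> inU z \<Longrightarrow> rv x < rv z \<Longrightarrow> \<bar>rv x - rv z\<bar> < er n0 \<Longrightarrow>
        \<bar>rv (F \<bullet> z) - rv r\<bar> < er (k + 1)"
      using r(3) unfolding rlim_def by blast
    obtain n1 where n1: "er n1 < 1 - rv x" using er_small[of "1 - rv x"] lt by auto
    have "\<exists>n. m \<le> n \<and> (\<exists>z\<in>{xp x n, xm x n}. inU z \<and> er (k + 1) < \<bar>rv (F \<bullet> x) - rv (F \<bullet> z)\<bar>)" for m
    proof -
      \<comment> \<open>Large enough to be beyond \<open>m\<close>, strictly within the range of the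
        limit estimate and with the probe still in the unit interval.\<close>
      let ?n = "m + (n0 + 1 + n1)"
      have n: "er ?n \<le> er n1" "er ?n < er n0" "0 < er ?n"
        by (auto intro!: er_mono er_less simp: ac_simps add_increasing Suc_le[symmetric])
      have "0 \<le> rv x + er ?n" "rv x + er ?n \<le> 1" using n n1 xr by linarith+
      then have U: "inU (xp x ?n)" using x xr by (simp add: inU_def)
      have "\<bar>rv (F \<bullet> xp x ?n) - rv r\<bar> < er (k + 1)" using n x xr U by (intro n0) simp_all
      then have "er (k + 1) < \<bar>rv (F \<bullet> x) - rv (F \<bullet> xp x ?n)\<bar>" using k by linarith
      then show ?thesis using U by (intro exI[of _ ?n]) simp
    qed
    then show ?thesis unfolding jmp_def by blast
  qed
  have left: "\<exists>k. jmp F x k" if ne: "rv l \<noteq> rv (F \<bullet> x)" and lt: "0 < rv x"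
  proof -
    obtain k where "er k < \<bar>rv (F \<bullet> x) - rv l\<bar>" using er_small[of "\<bar>rv (F \<bullet> x) - rv l\<bar>"] ne by auto
    then have k: "er (k + 1) + er (k + 1) < \<bar>rv (F \<bullet> x) - rv l\<bar>" by (simp only: er_Suc)
    obtain n0 where n0: "\<And>z. z \<in> D1 \<Longrightarrow> inU z \<Longrightarrow> rv z < rv x \<Longrightarrow> \<bar>rv x - rv z\<bar> < er n0 \<Longrightarrow>
        \<bar>rv (F \<bullet> z) - rv l\<bar> < er (k + 1)"
      using l(3) unfolding llim_def by blast
    obtain n1 where n1: "er n1 < rv x" using er_small lt by blast
    have "\<exists>n. m \<le> n \<and> (\<exists>z\<in>{xp x n, xm x n}. inU z \<and> er (k + 1) < \<bar>rv (F \<bullet> x) - rv (F \<bullet> z)\<bar>)" for m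
    proof -
      let ?n = "m + (n0 + 1 + n1)"
      have n: "er ?n \<le> er n1" "er ?n < er n0" "0 < er ?n"
        by (auto intro!: er_mono er_less simp: ac_simps add_increasing Suc_le[symmetric])
      have "0 \<le> rv x - er ?n" "rv x - er ?n \<le> 1" using n n1 xr by linarith+
      then have U: "inU (xm x ?n)" using x xr by (simp add: inU_def)
      have "\<bar>rv (F \<bullet> xm x ?n) - rv l\<bar> < er (k + 1)" using n x xr U by (intro n0) simp_all
      then have "er (k + 1) < \<bar>rv (F \<bullet> x) - rv (F \<bullet> xm x ?n)\<bar>" using k by linarith
      then show ?thesis using U by (intro exI[of _ ?n]) simp
    qed
    then show ?thesis unfolding jmp_def by blast
  qed
  show ?thesis
  proof (rule ccontr)
    assume none: "\<not> ?thesis"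
    have rr: "rv r = rv (F \<bullet> x)" if "rv x < 1" using right none that by blast
    have ll: "rv l = rv (F \<bullet> x)" if "0 < rv x" using left none that by blast
    have "cont F x" unfolding cont_def
    proof
      fix k
      obtain n where n: "\<And>z. z \<in> D1 \<Longrightarrow> inU z \<Longrightarrow> rv z < rv x \<Longrightarrow> \<bar>rv x - rv z\<bar> < er n \<Longrightarrow>
          \<bar>rv (F \<bullet> z) - rv l\<bar> < er k"
        using l(3) unfolding llim_def by blast
      obtain m where m: "\<And>z. z \<in> D1 \<Longrightarrow> inU z \<Longrightarrow> rv x < rv z \<Longrightarrow> \<bar>rv x - rv z\<bar> < er m \<Longrightarrow>
          \<bar>rv (F \<bullet> z) - rv r\<bar> < er k"
        using r(3) unfolding rlim_def by blast
      have "\<bar>rv (F \<bullet> x) - rv (F \<bullet> z)\<bar> < er k"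
        if z: "z \<in> D1" "inU z" "\<bar>rv x - rv z\<bar> < er (n + m)" for z
      proof -
        have "er (n + m) \<le> er n" "er (n + m) \<le> er m" by (simp_all add: er_mono)
        then have d: "\<bar>rv x - rv z\<bar> < er n" "\<bar>rv x - rv z\<bar> < er m" using z(3) by simp_all
        have zU: "0 \<le> rv z" "rv z \<le> 1" using z(2) by (simp_all add: inU_def)
        consider "rv z < rv x" | "rv z = rv x" | "rv x < rv z" by fastforce
        then show ?thesis
        proof cases
          case 1
          then show ?thesis using n[OF z(1,2) 1 d(1)] ll zU by (simp add: abs_minus_commute)
        next
          case 2
          then have "rv (F \<bullet> x) = rv (F \<bullet> z)" using F(2) x z unfolding unitf_def by metis
          then show ?thesis by simp
        next
          case 3
          then show ?thesis using m[OF z(1,2) 3 d(2)] rr zU by (simp add: abs_minus_commute)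
        qed
      qed
      then show "\<exists>n. \<forall>z\<in>D1. inU z \<and> \<bar>rv x - rv z\<bar> < er n \<longrightarrow> \<bar>rv (F \<bullet> x) - rv (F \<bullet> z)\<bar> < er k" by blast
    qed
    then show False using x by simp
  qed
qed

text \<open>The height of \<open>x\<close> is the least \<open>k\<close> such that \<open>F\<close> jumps by more than \<open>2^-k\<close> at \<open>x\<close>.\<close>

lemma ex_jump_height:
  assumes F: "F \<in> D11" "unitf F" and ex: "\<And>x. x \<in> D1 \<Longrightarrow> inU x \<Longrightarrow> \<exists>k. jmp F x k"
  shows "\<exists>H\<in>D2. resp H \<and> (\<forall>x\<in>D1. inU x \<longrightarrow> jmp F x (un (H \<bullet> x)))"
proof -
  let ?A = "(in_unit (Var vx) \<^bold>\<longrightarrow> jumpF \<^bold>\<and> (\<^bold>\<forall>vj. Var vj \<^bold>< Var vk \<^bold>\<longrightarrow> \<^bold>\<not> subst (Var(vk := Var vj)) jumpF))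
    \<^bold>\<and> (\<^bold>\<not> in_unit (Var vx) \<^bold>\<longrightarrow> Var vk \<^bold>= Zero)"
  let ?e = "ge(vf := F)"
  \<comment> \<open>The default 0 outside the unit interval makes the height total and dependent on
    the value of the real alone.\<close>
  define least where "least x k \<longleftrightarrow> (if inU x then jmp F x k \<and> (\<forall>j<k. \<not> jmp F x j) else k = 0)" for x k
  have S: "S (?e(vx := x, vk := emb k)) ?A \<longleftrightarrow> least x k" if "x \<in> D1" for x k
    using that F by (simp add: S_jumpF[where F = F and x = x] least_def Suc_le)
  have ex_least: "\<exists>k. least x k" if "x \<in> D1" for x
  proof (cases "inU x")
    case True
    have "internal (jmp F x)"
      by (rule internalI[of jumpF vk "?e(vx := x)"])
        (use F that True in \<open>simp_all add: S_jumpF[where F = F and x = x]\<close>)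
    then show ?thesis using internal_least ex[OF that True] True unfolding least_def by metis
  qed (simp add: least_def)
  have "\<exists>H\<in>D2. \<forall>x\<in>D1. S (?e(vx := x, vk := H \<bullet> x)) ?A"
  proof (rule choice_10)
    fix x assume "x \<in> D1"
    then show "\<exists>k. S (?e(vx := x, vk := emb k)) ?A" using ex_least S by blast
  qed (use F in simp_all)
  then obtain H where H: "H \<in> D2" "\<forall>x\<in>D1. S (?e(vx := x, vk := H \<bullet> x)) ?A" by blast
  have least: "least x (un (H \<bullet> x))" if "x \<in> D1" for x
    using S[OF that, of "un (H \<bullet> x)"] H that by simp
  have uniq: "k = l" if "least x k" "least y l" "x \<in> D1" "y \<in> D1" "isr x" "isr y" "rv x = rv y" for x y k l
  proof (cases "inU x")
    case True
    then have y: "inU y" using that by (simp add: inU_def)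
    have "jmp F x j \<longleftrightarrow> jmp F y j" for j using jmp_cong[OF F(2)] that True y by metis
    then show ?thesis using that(1,2) True y unfolding least_def by (metis neq_iff)
  next
    case False
    then have "\<not> inU y" using that by (simp add: inU_def)
    then show ?thesis using that False by (simp add: least_def)
  qed
  have "resp H" unfolding resp_def
  proof (intro ballI impI)
    fix x y assume xy: "x \<in> D1" "y \<in> D1" "isr x \<and> isr y \<and> rv x = rv y"
    then have "un (H \<bullet> x) = un (H \<bullet> y)" using uniq least by blast
    then show "H \<bullet> x = H \<bullet> y" using H xy by (metis ap_D2 emb_un)
  qed
  then show ?thesis using H least unfolding least_def by (intro bexI[of _ H]) auto
qed

text \<open>Close to \<open>x\<close> and on one side of it, all values of \<open>F\<close> are
  within \<open>2^-(h+1)\<close> of the limit and so differ from each other by less than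
  \<open>2^-h\<close>. A jump at \<open>y\<close> with \<open>k \<le> h\<close> would be witnessed
  by two points of that side.\<close>

lemma no_cluster:
  assumes F: "F \<in> D11" "unitf F" "regul F" and x: "x \<in> D1" "inU x"
  shows "\<exists>n. \<forall>y\<in>D1. \<forall>k. inU y \<and> rv y \<noteq> rv x \<and> \<bar>rv y - rv x\<bar> < er n \<and> k \<le> h \<longrightarrow> \<not> jmp F y k"
proof -
  obtain l r where l: "l \<in> D1" "isr l" "llim F x l" and r: "r \<in> D1" "isr r" "rlim F x r"
    using F(3) x unfolding regul_def by blast
  obtain n1 where n1: "\<And>z. z \<in> D1 \<Longrightarrow> inU z \<Longrightarrow> rv z < rv x \<Longrightarrow> \<bar>rv x - rv z\<bar> < er n1 \<Longrightarrow>
      \<bar>rv (F \<bullet> z) - rv l\<bar> < er (h + 1)"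
    using l(3) unfolding llim_def by blast
  obtain n2 where n2: "\<And>z. z \<in> D1 \<Longrightarrow> inU z \<Longrightarrow> rv x < rv z \<Longrightarrow> \<bar>rv x - rv z\<bar> < er n2 \<Longrightarrow>
      \<bar>rv (F \<bullet> z) - rv r\<bar> < er (h + 1)"
    using r(3) unfolding rlim_def by blast
  have n: "er (n1 + n2) \<le> er n1" "er (n1 + n2) \<le> er n2" by (simp_all add: er_mono)
  have "\<not> jmp F y k" if y: "y \<in> D1" "inU y" "rv y \<noteq> rv x" "\<bar>rv y - rv x\<bar> < er (n1 + n2)" "k \<le> h" for y k
  proof
    assume j: "jmp F y k"
    \<comment> \<open>Points at distance at most \<open>2^-m\<close> from \<open>y\<close> stay on
      the same side of \<open>x\<close> as \<open>y\<close> and inside the neighbourhood.\<close>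
    obtain m where "er m < min \<bar>rv y - rv x\<bar> (er (n1 + n2) - \<bar>rv y - rv x\<bar>)"
      using er_small[of "min \<bar>rv y - rv x\<bar> (er (n1 + n2) - \<bar>rv y - rv x\<bar>)"] y by auto
    then have m: "er m < \<bar>rv y - rv x\<bar>" "er m < er (n1 + n2) - \<bar>rv y - rv x\<bar>" by simp_all
    obtain i z where z: "m \<le> i" "z \<in> {xp y i, xm y i}" "inU z" "er k < \<bar>rv (F \<bullet> y) - rv (F \<bullet> z)\<bar>"
      using j unfolding jmp_def by blast
    have i: "er i \<le> er m" "0 < er i" using z(1) by (simp_all add: er_mono)
    have zD: "z \<in> D1" using z(2) y by auto
    have zy: "\<bar>rv z - rv y\<bar> = er i" using z(2) y by auto
    have k: "er (h + 1) + er (h + 1) \<le> er k" unfolding er_Suc using y(5) by (rule er_mono)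
    consider "rv y < rv x" | "rv x < rv y" using y(3) by fastforce
    then show False
    proof cases
      case 1
      have "rv z < rv x" "\<bar>rv x - rv z\<bar> < er n1" "\<bar>rv x - rv y\<bar> < er n1"
        using 1 zy i m n y(4) by linarith+
      then show False using n1[OF y(1,2) 1] n1[OF zD z(3)] z(4) k by linarith
    next
      case 2
      have "rv x < rv z" "\<bar>rv x - rv z\<bar> < er n2" "\<bar>rv x - rv y\<bar> < er n2"
        using 2 zy i m n y(4) by linarith+
      then show False using n2[OF y(1,2) 2] n2[OF zD z(3)] z(4) k by linarith
    qed
  qed
  then show ?thesis by blast
qed

section \<open>Counting\<close>

definition "cnt d n = cv CNT \<bullet> d \<star> n"

lemma val_CNT [simp]: "val M e b CNT = cv CNT"
  by (rule val_closed) simp_all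

lemma CNT_dom [simp]: "d \<in> D1 \<Longrightarrow> cv CNT \<bullet> d \<in> D1"
  by (rule ap_dom[OF cv_dom]) simp_all

lemma CNT_emb [simp]: "d \<in> D1 \<Longrightarrow> cv CNT \<bullet> d \<bullet> emb n = emb (cnt d n)"
  by (simp add: cnt_def ap_emb)

lemma cnt_simps [simp]:
  assumes "d \<in> D1"
  shows "cnt d 0 = 0" "cnt d (n + 1) = cnt d n + (if d \<star> n = 0 then 1 else 0)"
proof -
  have e: "env M (ge(vx := d))" using assms by simp
  have eq: "cv CNT \<bullet> d = V (ge(vx := d)) (lam vn (Rec \<cdot> Var vn \<cdot> Zero \<cdot>
      lam vi (lam vj (Var vi \<^bold>+ (One \<^bold>- Var vx \<cdot> Var vj)))))"
    unfolding cv_def CNT_def using assms by (simp add: val_lam)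
  note r = lam_rec[OF _ _ _ _ e, where a = Zero and t = "Var vi \<^bold>+ (One \<^bold>- Var vx \<cdot> Var vj)"
      and b = "\<lambda>_. zr M", folded eq]
  have "cv CNT \<bullet> d \<bullet> emb 0 = emb 0" using r(1) by simp
  then show "cnt d 0 = 0" using assms by simp
  have "cv CNT \<bullet> d \<bullet> emb (n + 1) = emb (cnt d n + (1 - d \<star> n))"
    using r(2)[of "emb n"] assms by (simp add: ap_emb[OF assms])
  then show "cnt d (n + 1) = cnt d n + (if d \<star> n = 0 then 1 else 0)"
    using assms nonzero_ge_1[of "d \<star> n"] by (auto simp: trunc)
qed

text \<open>A single exceptional index \<open>i0\<close> raises the count by at most one, and not at
  all if it is outside the range. One induction proves both, as the weaker bound beyond
  \<open>i0\<close> starts from the sharper one up to \<open>i0\<close>.\<close>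

lemma cnt_le:
  assumes d: "d \<in> D1" "d' \<in> D1" and le: "\<And>i. i < n0 \<Longrightarrow> i \<noteq> i0 \<Longrightarrow> d \<star> i = 0 \<Longrightarrow> d' \<star> i = 0"
  shows "cnt d n0 \<le> cnt d' n0 + 1" "n0 \<le> i0 \<Longrightarrow> cnt d n0 \<le> cnt d' n0"
proof -
  let ?P = "\<lambda>n. n \<le> n0 \<longrightarrow> cnt d n \<le> cnt d' n + 1 \<and> (n \<le> i0 \<longrightarrow> cnt d n \<le> cnt d' n)"
  have "?P n0"
  proof (rule internal_induct[where P = ?P])
    show "internal ?P"
      by (rule internalI[of "Var vn \<^bold>\<le> Var vm \<^bold>\<longrightarrow> CNT \<cdot> Var vx \<cdot> Var vn \<^bold>\<le> Succ \<cdot> (CNT \<cdot> Var vy \<cdot> Var vn) \<^bold>\<and>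
          (Var vn \<^bold>\<le> Var vi \<^bold>\<longrightarrow> CNT \<cdot> Var vx \<cdot> Var vn \<^bold>\<le> CNT \<cdot> Var vy \<cdot> Var vn)" vn
          "ge(vx := d, vy := d', vm := emb n0, vi := emb i0)"]) (use d in simp_all)
    fix n assume IH: "?P n"
    show "?P (n + 1)"
    proof
      assume n: "n + 1 \<le> n0"
      then have "n < n0" by (simp only: Suc_le)
      then have IH': "cnt d n \<le> cnt d' n + 1" "n \<le> i0 \<Longrightarrow> cnt d n \<le> cnt d' n" using IH by auto
      show "cnt d (n + 1) \<le> cnt d' (n + 1) + 1 \<and> (n + 1 \<le> i0 \<longrightarrow> cnt d (n + 1) \<le> cnt d' (n + 1))"
      proof (cases "n = i0")
        case True
        then have "cnt d n \<le> cnt d' n" using IH' by simp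
        then show ?thesis using d True by (auto simp: Suc_le add_increasing2)
      next
        case False
        then have imp: "d \<star> n = 0 \<Longrightarrow> d' \<star> n = 0" using le \<open>n < n0\<close> by blast
        have "n \<le> i0" if "n + 1 \<le> i0" using that by (simp only: Suc_le less_imp_le)
        then show ?thesis using d imp IH' by (auto simp: add_increasing2)
      qed
    qed
  qed (use d in simp)
  then show "cnt d n0 \<le> cnt d' n0 + 1" "n0 \<le> i0 \<Longrightarrow> cnt d n0 \<le> cnt d' n0" by simp_all
qed

lemma cnt_all:
  assumes d: "d \<in> D1" and all: "\<And>i. i < n0 \<Longrightarrow> d \<star> i = 0"
  shows "cnt d n0 = n0"
proof -
  let ?P = "\<lambda>n. n \<le> n0 \<longrightarrow> cnt d n = n"
  have "?P n0"
  proof (rule internal_induct[where P = ?P])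
    show "internal ?P"
      by (rule internalI[of "Var vn \<^bold>\<le> Var vm \<^bold>\<longrightarrow> CNT \<cdot> Var vx \<cdot> Var vn \<^bold>= Var vn" vn
          "ge(vx := d, vm := emb n0)"]) (use d in simp_all)
    show "?P (n + 1)" if "?P n" for n
      using that d all[of n] by (auto simp: Suc_le)
  qed (use d in simp)
  then show ?thesis by simp
qed

lemma cnt_none:
  assumes d: "d \<in> D1" and none: "\<And>i. i < n0 \<Longrightarrow> d \<star> i \<noteq> 0"
  shows "cnt d n0 = 0"
proof -
  let ?P = "\<lambda>n. n \<le> n0 \<longrightarrow> cnt d n = 0"
  have "?P n0"
  proof (rule internal_induct[where P = ?P])
    show "internal ?P"
      by (rule internalI[of "Var vn \<^bold>\<le> Var vm \<^bold>\<longrightarrow> CNT \<cdot> Var vx \<cdot> Var vn \<^bold>= Zero" vn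
          "ge(vx := d, vm := emb n0)"]) (use d in simp_all)
    show "?P (n + 1)" if "?P n" for n
      using that d none[of n] by (auto simp: Suc_le)
  qed (use d in simp)
  then show ?thesis by simp
qed

end

section \<open>Sets that are not finite have cluster points\<close>

context num_model
begin

text \<open>A number-indexed sequence of objects of type 1 is coded by a single object of type 1, as choice
  only provides the latter; \<open>row f i\<close> decodes its entry with index \<open>i\<close>.\<close>

definition "row f i = V (ge(vy := f, vi := emb i)) (lam vp (Var vy \<cdot> (PAIR \<cdot> Var vi \<cdot> Var vp)))"

lemma row_dom [simp]: "f \<in> D1 \<Longrightarrow> row f i \<in> D1"
  unfolding row_def by (rule val_dom) simp_all

lemma row_at: "f \<in> D1 \<Longrightarrow> row f i \<star> n = f \<star> pair i n"
  unfolding row_def by (subst at_def) (simp add: val_lam ap_emb)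

text \<open>Lets formulas about the entries of a coded sequence be evaluated by rewriting.\<close>

lemma val_row [simp]:
  assumes s: "typ_of [] s = Some ty1" "vp \<notin> fvt s" and e: "env M e" and v: "snd v = T0" "v \<noteq> vp"
  shows "val M e b (lam vp (s \<cdot> (PAIR \<cdot> Var v \<cdot> Var vp))) = row (val M e b s) (un (e v))"
proof (rule D1_eqI)
  let ?r = "val M e b (lam vp (s \<cdot> (PAIR \<cdot> Var v \<cdot> Var vp)))"
  have sD: "val M e b s \<in> D1" using s e by (intro val_dom)
  show "?r \<in> D1" using assms by (intro val_dom) simp_all
  show "row (val M e b s) (un (e v)) \<in> D1" using sD by simp
  fix n
  have eq: "val M (e(vp := emb n)) b s = val M e b s" using s by (intro val_fv_cong) auto
  have "e v \<in> N" using env_dom[OF e, of v] v by simp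
  then obtain i where "e v = emb i" by (elim emb_cases)
  then have "?r \<bullet> emb n = emb (val M e b s \<star> pair i n)"
    using s e v eq sD by (simp add: val_lam ap_emb)
  then show "?r \<star> n = row (val M e b s) (un (e v)) \<star> n"
    using sD \<open>e v = emb i\<close> by (simp add: row_at) (simp add: at_def)
qed

text \<open>The cluster point is approached from above by \<open>\<kappa> \<star> m / 2^m\<close>,
  where \<open>\<kappa> \<star> m\<close> is the least numerator at level \<open>m\<close> with
  unbounded counts. The grid interval just below contains two distinct points of some
  \<open>W n\<close>, and at least one of them is not \<open>x\<close>.\<close>

lemma not_fin_cluster:
  assumes B: "B \<in> D2" "\<And>y. y \<in> D1 \<Longrightarrow> isr y \<Longrightarrow> B \<bullet> y = emb 1 \<Longrightarrow> inU y" and nf: "\<not> fin B"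
  shows "\<exists>x\<in>D1. inU x \<and> (\<forall>j. \<exists>y\<in>D1. inU y \<and> B \<bullet> y = emb 1 \<and> rv y \<noteq> rv x \<and> \<bar>rv y - rv x\<bar> < er j)"
proof -
  let ?R = "\<lambda>v. lam vp (Var vy \<cdot> (PAIR \<cdot> Var v \<cdot> Var vp))"
  let ?C = "(\<^bold>\<forall>vi. Var vi \<^bold>\<le> Var vN \<^bold>\<longrightarrow> is_real (?R vi) \<^bold>\<and> Var vB \<cdot> ?R vi \<^bold>= One)
    \<^bold>\<and> (\<^bold>\<forall>vi. \<^bold>\<forall>vj. Var vi \<^bold>\<le> Var vN \<^bold>\<and> Var vj \<^bold>\<le> Var vN \<^bold>\<and> \<^bold>\<not> Var vi \<^bold>= Var vj \<^bold>\<longrightarrow> \<^bold>\<not> ?R vi =\<^sub>R ?R vj)"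
  define good where "good w n \<longleftrightarrow> (\<forall>i\<le>n. isr (w i) \<and> B \<bullet> w i = emb 1) \<and>
    (\<forall>i j. i \<le> n \<and> j \<le> n \<and> i \<noteq> j \<longrightarrow> rv (w i) \<noteq> rv (w j))" for w and n :: 'n
  have C: "S (ge(vB := B, vN := emb n, vy := f)) ?C \<longleftrightarrow> good (row f) n" if "f \<in> D1" for n f
  proof -
    have "S (ge(vB := B, vN := emb n, vy := f)) ?C \<longleftrightarrow> (\<forall>i\<le>n. isr (row f i) \<and> B \<bullet> row f i = emb 1) \<and>
        (\<forall>i j. i \<le> n \<and> j \<le> n \<and> i \<noteq> j \<longrightarrow> \<not> eqr (row f i) (row f j))"
      using that B(1) by simp
    moreover have "(\<forall>i j. i \<le> n \<and> j \<le> n \<and> i \<noteq> j \<longrightarrow> \<not> eqr (row f i) (row f j)) \<longleftrightarrow>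
        (\<forall>i j. i \<le> n \<and> j \<le> n \<and> i \<noteq> j \<longrightarrow> rv (row f i) \<noteq> rv (row f j))"
      if "\<forall>i\<le>n. isr (row f i)"
      using that by auto
    ultimately show ?thesis unfolding good_def by metis
  qed
  \<comment> \<open>The failure of finiteness yields an object of type
    \<open>T0 \<rightarrowtail> ty1\<close>, which pairing flattens to one of type 1.\<close>
  have "\<exists>f\<in>D1. good (row f) n" for n
  proof -
    have "\<not> (\<forall>w\<in>D01. (\<forall>i. i \<le> n \<longrightarrow> isr (w \<bullet> emb i)) \<and>
        (\<forall>i j. i \<le> n \<and> j \<le> n \<and> i \<noteq> j \<longrightarrow> rv (w \<bullet> emb i) \<noteq> rv (w \<bullet> emb j)) \<longrightarrow>
        (\<exists>i. i \<le> n \<and> B \<bullet> (w \<bullet> emb i) \<noteq> emb 1))"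
      using nf unfolding fin_def by (rule contrapos_nn) (rule exI)
    then obtain w where w: "w \<in> D01" "good (\<lambda>i. w \<bullet> emb i) n"
      unfolding good_def by (simp only: bex_simps ball_simps) blast
    define f where "f = V (ge(vw := w)) (lam vp (Var vw \<cdot> (FST \<cdot> Var vp) \<cdot> (SND \<cdot> Var vp)))"
    have f: "f \<in> D1" unfolding f_def using w by (intro val_dom) simp_all
    have fa: "f \<star> m = w \<bullet> emb (fs m) \<star> sn m" for m
      unfolding f_def using w(1) by (subst at_def) (simp add: val_lam ap_emb)
    have "row f i = w \<bullet> emb i" for i
      using f w(1) by (intro D1_eqI) (simp_all add: row_at fa)
    then have "row f = (\<lambda>i. w \<bullet> emb i)" by (rule HOL.ext)
    then show ?thesis using f w(2) by metis
  qed
  then have "\<exists>f\<in>D1. S (ge(vB := B, vN := emb n, vy := f)) ?C" for n using C by blast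
  then have "\<exists>G\<in>D01. \<forall>n. S (ge(vB := B, vN := emb n, vy := G \<bullet> emb n)) ?C"
    by (intro choice_01) (use B in simp_all)
  then obtain G where G: "G \<in> D01" "\<And>n. S (ge(vB := B, vN := emb n, vy := G \<bullet> emb n)) ?C" by blast
  have GD: "G \<bullet> emb n \<in> D1" for n using G(1) by simp
  have G_good: "good (row (G \<bullet> emb n)) n" for n using C[OF GD] G(2) by blast
  define W where "W n i = row (G \<bullet> emb n) i" for n i
  have WD: "W n i \<in> D1" for n i using GD by (simp add: W_def)
  have W: "isr (W n i)" "B \<bullet> W n i = emb 1" "inU (W n i)" if "i \<le> n" for n i
    using G_good[of n] that B(2)[OF WD] by (auto simp: good_def W_def)
  have W_inj: "rv (W n i) \<noteq> rv (W n j)" if "i \<le> n" "j \<le> n" "i \<noteq> j" for n i j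
    using G_good[of n] that by (auto simp: good_def W_def)

  let ?L = "lam vp (Var vw \<cdot> Var vN \<cdot> (PAIR \<cdot> Var vj \<cdot> Var vp)) <\<^sub>R RATR \<cdot> (DYADIC \<cdot> Var vk \<cdot> Var vm)"
  obtain t where t: "typ_of [] t = Some T0" "\<And>e. genv e \<Longrightarrow> (V e t = zr M \<longleftrightarrow> S e ?L)"
    using arith_term[of ?L] by auto
  \<comment> \<open>All comparisons with dyadic rationals are collected in one object, to be held by
    the variable \<open>vc\<close>, so that formulas can speak about the counts.\<close>
  define Q where "Q = V (ge(vw := G)) (lam vN (lam vk (lam vm (lam vj t))))"
  have QD: "Q \<in> dom M (snd vc)" unfolding Q_def using G t by (intro val_dom) simp_all
  define D where "D n k m = Q \<bullet> emb n \<bullet> emb k \<bullet> emb m" for n k m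
  have "Q \<in> dom M (T0 \<rightarrowtail> T0 \<rightarrowtail> T0 \<rightarrowtail> ty1)" using QD by simp
  then have DD [simp]: "D n k m \<in> D1" for n k m
    unfolding D_def by (rule ap_dom[OF ap_dom[OF ap_dom]]) (rule emb_N)+
  define q where "q k m = qr (qn k * ep m)" for k m
  have D_at: "D n k m \<star> j = 0 \<longleftrightarrow> rv (W n j) < q k m" if "j \<le> n" for n k m j
  proof -
    let ?e = "ge(vw := G, vN := emb n, vk := emb k, vm := emb m, vj := emb j)"
    have e: "genv ?e" using G by simp
    have "D n k m \<bullet> emb j = V ?e t" unfolding D_def Q_def using G t(1) by (simp add: val_lam)
    then have "emb (D n k m \<star> j) = V ?e t" by (simp only: ap_emb[OF DD])
    then have "D n k m \<star> j = 0 \<longleftrightarrow> V ?e t = zr M" by (metis emb_eq zr_emb)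
    also have "\<dots> \<longleftrightarrow> ltr (W n j) (cv RATR \<bullet> emb (dy k m))"
      unfolding t(2)[OF e] using G(1) e by (simp add: W_def)
    finally show ?thesis using W(1)[OF that] by (simp add: q_def)
  qed
  define c where "c n k m = cnt (D n k m) (n + 1)" for n k m
  define unb where "unb k m \<longleftrightarrow> (\<forall>a. \<exists>n. a \<le> c n k m)" for k m
  define UF where "UF = (\<^bold>\<forall>vq. \<^bold>\<exists>vN. Var vq \<^bold>\<le> CNT \<cdot> (Var vc \<cdot> Var vN \<cdot> Var vk \<cdot> Var vm) \<cdot> (Succ \<cdot> Var vN))"
  have UF: "arith UF" "wff UF" "lcf 0 UF" unfolding UF_def by simp_all
  have U: "sat M e b UF \<longleftrightarrow> unb k m" if "e vc = Q" "e vk = emb k" "e vm = emb m" for e b k m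
  proof -
    have "cv CNT \<bullet> (Q \<bullet> emb n \<bullet> emb k \<bullet> emb m) \<bullet> emb (n + 1) = emb (c n k m)" for n
      unfolding c_def D_def[symmetric] by (rule CNT_emb) (rule DD)
    then show ?thesis using that by (simp add: unb_def UF_def)
  qed
  have mono: "unb k' m'" if "q k m \<le> q k' m'" "unb k m" for k m k' m'
  proof -
    have "c n k m \<le> c n k' m'" for n
      unfolding c_def using that(1) by (intro cnt_le(2)[where ?i0.0 = "n + 1"]) (auto simp: D_at)
    then show ?thesis using that(2) unfolding unb_def by (meson order_trans)
  qed
  \<comment> \<open>This grid point is 2: all points lie strictly below it, whereas 1 may be
    attained.\<close>
  have unb_top: "unb (pw m + pw m) m" for m
  proof -
    have q2: "q (pw m + pw m) m = 1 + 1"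
    proof -
      have "qn (pw m) \<noteq> 0" using qn_pw_pos[of m] by (metis less_irrefl)
      then have "qn (pw m) * ep m = 1" by (simp add: ep_def)
      then have "qn (pw m + pw m) * ep m = 1 + 1" by (simp only: qn_simps distrib_right)
      then show ?thesis unfolding q_def by (simp only: qr_simps)
    qed
    have "c n (pw m + pw m) m = n + 1" for n
      unfolding c_def
    proof (rule cnt_all)
      fix i assume "i < n + 1"
      then have i: "i \<le> n" by simp
      then have "rv (W n i) \<le> 1" using W(3) by (simp add: inU_def)
      then show "D n (pw m + pw m) m \<star> i = 0" unfolding D_at[OF i] q2 by (rule le_less_trans) simp
    qed simp
    then show ?thesis unfolding unb_def by (metis le_add(1))
  qed
  have unb_0: "\<not> unb 0 m" for m
  proof
    assume "unb 0 m"
    then obtain n where "1 \<le> c n 0 m" unfolding unb_def by blast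
    moreover have "c n 0 m = 0"
      unfolding c_def
    proof (rule cnt_none)
      fix i assume "i < n + 1"
      then have i: "i \<le> n" by simp
      then have "0 \<le> rv (W n i)" using W(3) by (simp add: inU_def)
      then show "D n 0 m \<star> i \<noteq> 0" unfolding D_at[OF i] by (simp add: q_def)
    qed simp
    ultimately show False by simp
  qed
  let ?K = "UF \<^bold>\<and> (\<^bold>\<forall>vi. Var vi \<^bold>< Var vk \<^bold>\<longrightarrow> \<^bold>\<not> subst (Var(vk := Var vi)) UF)"
  have K: "S (ge(vc := Q, vm := emb m, vk := emb k)) ?K \<longleftrightarrow> unb k m \<and> (\<forall>i<k. \<not> unb i m)" for m k
    using QD UF by (simp add: U Suc_le)
  have "\<exists>\<kappa>\<in>D1. \<forall>m. S (ge(vc := Q, vm := emb m, vk := emb (\<kappa> \<star> m))) ?K"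
  proof (rule choice_00)
    fix m
    have "internal (\<lambda>k. unb k m)"
      by (rule internalI[of UF vk "ge(vc := Q, vm := emb m)"]) (use QD UF in \<open>simp_all add: U\<close>)
    then have "\<exists>k. unb k m \<and> (\<forall>i<k. \<not> unb i m)" using unb_top by (rule internal_least)
    then show "\<exists>k. S (ge(vc := Q, vm := emb m, vk := emb k)) ?K" unfolding K .
  qed (use QD UF in simp_all)
  then obtain \<kappa> where \<kappa>: "\<kappa> \<in> D1" "\<And>m. unb (\<kappa> \<star> m) m" "\<And>m i. i < \<kappa> \<star> m \<Longrightarrow> \<not> unb i m"
    unfolding K by blast
  define x where "x = V (ge(vy := \<kappa>)) (lam vm (DYADIC \<cdot> (Var vy \<cdot> Var vm) \<cdot> Var vm))"
  have x: "x \<in> D1" unfolding x_def using \<kappa> by (intro val_dom) simp_all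
  have xs: "xs x m = qn (\<kappa> \<star> m) * ep m" for m
  proof -
    have "x \<bullet> emb m = emb (dy (\<kappa> \<star> m) m)" unfolding x_def using \<kappa>(1) by (simp add: val_lam ap_emb)
    then show ?thesis by (simp add: xs_def at_def)
  qed
  have pred: "\<exists>p. \<kappa> \<star> m = p + 1 \<and> \<not> unb p m" for m
  proof (cases "\<kappa> \<star> m" rule: nn_cases)
    case 1
    then show ?thesis using \<kappa>(2)[of m] unb_0 by simp
  next
    case (2 p)
    then show ?thesis using \<kappa>(3)[of p m] by simp
  qed
  \<comment> \<open>Refining the grid turns \<open>\<kappa> \<star> m\<close> into a numerator that
    still has unbounded counts, so the approximations decrease. The grid point preceding
    \<open>\<kappa> \<star> m / 2^m\<close> has bounded counts and by monotonicity lies strictly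
    below all later approximations.\<close>
  have isr: "isr x" unfolding isr_def
  proof (intro allI)
    fix m i
    have "qn (pw i) \<noteq> 0" using qn_pw_pos[of i] by (metis less_irrefl)
    then have eq: "qn (\<kappa> \<star> m * pw i) * ep (m + i) = xs x m"
      unfolding xs ep_def pw_add qn_simps by (simp add: field_simps)
    have "q (\<kappa> \<star> m) m \<le> q (\<kappa> \<star> m * pw i) (m + i)" by (simp only: q_def eq xs[symmetric] order_refl)
    then have "unb (\<kappa> \<star> m * pw i) (m + i)" using mono \<kappa>(2) by blast
    then have "\<kappa> \<star> (m + i) \<le> \<kappa> \<star> m * pw i" using \<kappa>(3) by (meson not_le)
    then have "qn (\<kappa> \<star> (m + i)) * ep (m + i) \<le> qn (\<kappa> \<star> m * pw i) * ep (m + i)"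
      by (intro mult_right_mono) (simp_all add: less_imp_le del: qn_simps(4))
    then have 1: "xs x (m + i) \<le> xs x m" unfolding eq xs[of "m + i"] .
    obtain p where p: "\<kappa> \<star> m = p + 1" "\<not> unb p m" using pred by blast
    have "\<not> q (\<kappa> \<star> (m + i)) (m + i) \<le> q p m" using mono \<kappa>(2) p(2) by blast
    then have "qn p * ep m < xs x (m + i)" unfolding q_def xs by (simp only: qr_simps not_le)
    moreover have "xs x m = qn p * ep m + ep m" unfolding xs p(1) by (simp add: algebra_simps)
    ultimately show "\<bar>xs x m - xs x (m + i)\<bar> < ep m" using 1 by (simp add: abs_if)
  qed
  have near: "\<exists>y\<in>D1. inU y \<and> B \<bullet> y = emb 1 \<and> rv y \<noteq> rv x \<and> \<bar>rv y - rv x\<bar> < er j" for j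
  proof -
    \<comment> \<open>The length of the grid interval and the distance of \<open>x\<close> from its
      right end are at most \<open>er ?m\<close> each, together \<open>er (j + 1)\<close>.\<close>
    let ?m = "j + 1 + 1"
    obtain p where p: "\<kappa> \<star> ?m = p + 1" "\<not> unb p ?m" using pred by blast
    obtain a where a: "\<And>n. c n p ?m < a" using p(2) unfolding unb_def by (meson not_le)
    \<comment> \<open>Counts at the left end stay below \<open>a\<close>, so a count of at least
      \<open>a + 1\<close> at the right end takes two points in between.\<close>
    obtain n where n: "a + 1 \<le> c n (p + 1) ?m" using \<kappa>(2)[of ?m] unfolding unb_def p(1) by blast
    let ?in = "\<lambda>i. i \<le> n \<and> q p ?m \<le> rv (W n i) \<and> rv (W n i) < q (p + 1) ?m"
    have two: "\<exists>i i'. ?in i \<and> ?in i' \<and> i \<noteq> i'"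
    proof (rule ccontr)
      assume none: "\<not> ?thesis"
      obtain i0 where i0: "\<And>i. i \<noteq> i0 \<Longrightarrow> \<not> ?in i"
      proof (cases "\<exists>i. ?in i")
        case True
        then obtain i0 where "?in i0" by blast
        then show ?thesis using none that by blast
      qed (use that in blast)
      have "c n (p + 1) ?m \<le> c n p ?m + 1"
        unfolding c_def
      proof (rule cnt_le(1)[where ?i0.0 = i0])
        fix i assume "i < n + 1" and ne: "i \<noteq> i0" and "D n (p + 1) ?m \<star> i = 0"
        then have i: "i \<le> n" "rv (W n i) < q (p + 1) ?m" by (simp_all add: D_at)
        then have "rv (W n i) < q p ?m" using i0[OF ne] by (meson not_le)
        then show "D n p ?m \<star> i = 0" using i(1) by (simp add: D_at)
      qed simp_all
      also have "c n p ?m + 1 < a + 1" using a[of n] by (simp add: Suc_le)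
      finally show False using n by (meson leD)
    qed
    have close: "\<bar>rv (W n i) - rv x\<bar> < er j" if "?in i" for i
    proof -
      have "qr (xs x ?m) = q (p + 1) ?m" unfolding xs p(1) q_def ..
      then have r: "\<bar>q (p + 1) ?m - rv x\<bar> \<le> er ?m" using rv_approx[OF isr, of ?m] by simp
      have "qn (p + 1) * ep ?m = qn p * ep ?m + ep ?m" by (simp add: algebra_simps)
      then have "q (p + 1) ?m = q p ?m + er ?m" unfolding q_def by (simp only: qr_simps er_def)
      then have "\<bar>rv (W n i) - rv x\<bar> \<le> er ?m + er ?m" using r that by linarith
      also have "er ?m + er ?m = er (j + 1)" by (rule er_Suc)
      also have "\<dots> < er j" by (simp add: er_less)
      finally show ?thesis .
    qed
    obtain i i' where ii: "?in i" "?in i'" "i \<noteq> i'" using two by blast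
    then have "rv (W n i) \<noteq> rv (W n i')" using W_inj by blast
    then consider "rv (W n i) \<noteq> rv x" | "rv (W n i') \<noteq> rv x" by fastforce
    then show ?thesis
    proof cases
      case 1
      then show ?thesis using close[OF ii(1)] W[of i n] ii(1) WD by blast
    next
      case 2
      then show ?thesis using close[OF ii(2)] W[of i' n] ii(2) WD by blast
    qed
  qed
  \<comment> \<open>The unit interval is closed, and \<open>x\<close> is a limit of its points. One
    summand would suffice; four are written to match \<open>er_zero\<close>.\<close>
  have "- rv x \<le> er j + er j + er j + er j" "rv x - 1 \<le> er j + er j + er j + er j" for j
  proof -
    obtain y where y: "inU y" "\<bar>rv y - rv x\<bar> < er j" using near by blast
    then have "0 \<le> rv y" "rv y \<le> 1" by (simp_all add: inU_def)
    then show "- rv x \<le> er j + er j + er j + er j" "rv x - 1 \<le> er j + er j + er j + er j"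
      using y(2) er_pos[of j] by linarith+
  qed
  then have "- rv x \<le> 0" "rv x - 1 \<le> 0" by (blast intro: er_zero)+
  then have "inU x" using isr by (simp add: inU_def)
  then show ?thesis using x near by blast
qed

text \<open>The definition of a height function demands the level sets as objects of the model. They
  and the unit interval are supplied by \<open>char_10\<close>, since membership in them is
  arithmetical in \<open>H\<close>.\<close>

lemma NIN_imp_continuity:
  assumes NIN: "\<And>A H. A \<in> D2 \<Longrightarrow> rset A \<Longrightarrow> (\<And>x. x \<in> D1 \<Longrightarrow> isr x \<Longrightarrow> A \<bullet> x = emb 1 \<longleftrightarrow> inU x)
      \<Longrightarrow> H \<in> D2 \<Longrightarrow> \<not> height H A"
    and F: "F \<in> D11" "unitf F" "regul F"
  shows "\<exists>x\<in>D1. inU x \<and> cont F x"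
proof (rule ccontr)
  assume "\<not> ?thesis"
  then have "\<exists>k. jmp F x k" if "x \<in> D1" "inU x" for x
    using discontinuity_jump[OF F] that by blast
  then obtain H where H: "H \<in> D2" "resp H" "\<And>x. x \<in> D1 \<Longrightarrow> inU x \<Longrightarrow> jmp F x (un (H \<bullet> x))"
    using ex_jump_height[OF F(1,2)] by blast
  obtain A where A: "A \<in> D2" "\<And>x. x \<in> D1 \<Longrightarrow> A \<bullet> x = (if inU x then emb 1 else emb 0)"
    using char_10[of "in_unit (Var vx)" vx ge] by auto
  have inU_cong: "inU x \<longleftrightarrow> inU y" if "isr x" "isr y" "rv x = rv y" for x y
    using that by (simp add: inU_def)
  have "rset A" unfolding rset_def resp_def
  proof (intro conjI ballI impI)
    fix x y assume xy: "x \<in> D1" "y \<in> D1" "isr x \<and> isr y \<and> rv x = rv y"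
    then show "A \<bullet> x = A \<bullet> y" using A(2) inU_cong[of x y] by simp
  qed (use A in auto)
  moreover have "A \<bullet> x = emb 1 \<longleftrightarrow> inU x" if "x \<in> D1" for x using A that by simp
  ultimately have "\<not> height H A" using NIN A(1) H(1) by blast
  moreover have "height H A" unfolding height_def
  proof (intro conjI allI)
    fix h
    obtain B where B: "B \<in> D2" "\<And>x. x \<in> D1 \<Longrightarrow> B \<bullet> x = (if inU x \<and> un (H \<bullet> x) < h then emb 1 else emb 0)"
      using char_10[of "in_unit (Var vx) \<^bold>\<and> Var vH \<cdot> Var vx \<^bold>< Var vk" vx "ge(vH := H, vk := emb h)"] H(1) by auto
    have B1: "B \<bullet> x = emb 1 \<longleftrightarrow> inU x \<and> un (H \<bullet> x) < h" if "x \<in> D1" for x using B that by simp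
    have "fin B"
    proof (rule ccontr)
      assume "\<not> fin B"
      then obtain x where x: "x \<in> D1" "inU x"
        "\<And>j. \<exists>y\<in>D1. inU y \<and> B \<bullet> y = emb 1 \<and> rv y \<noteq> rv x \<and> \<bar>rv y - rv x\<bar> < er j"
        using not_fin_cluster[OF B(1)] B1 by blast
      obtain n where n: "\<And>y k. y \<in> D1 \<Longrightarrow> inU y \<Longrightarrow> rv y \<noteq> rv x \<Longrightarrow> \<bar>rv y - rv x\<bar> < er n \<Longrightarrow> k \<le> h \<Longrightarrow> \<not> jmp F y k"
        using no_cluster[OF F x(1,2), of h] by blast
      obtain y where "y \<in> D1" "inU y" "B \<bullet> y = emb 1" "rv y \<noteq> rv x" "\<bar>rv y - rv x\<bar> < er n"
        using x(3) by blast
      then show False using n[of y "un (H \<bullet> y)"] H(3)[of y] B1[of y] by (simp add: less_imp_le)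
    qed
    moreover have "rset B" unfolding rset_def resp_def
    proof (intro conjI ballI impI)
      fix x y assume xy: "x \<in> D1" "y \<in> D1" "isr x \<and> isr y \<and> rv x = rv y"
      then have "H \<bullet> x = H \<bullet> y" using H(2) unfolding resp_def by blast
      then show "B \<bullet> x = B \<bullet> y" using B(2) xy inU_cong[of x y] by simp
    qed (use B in auto)
    moreover have "\<forall>x\<in>D1. isr x \<longrightarrow> (B \<bullet> x = emb 1 \<longleftrightarrow> A \<bullet> x = emb 1 \<and> un (H \<bullet> x) < h)"
      using B1 A(2) by simp
    ultimately show "\<exists>B\<in>D2. rset B \<and>
        (\<forall>x\<in>D1. isr x \<longrightarrow> (B \<bullet> x = emb 1 \<longleftrightarrow> A \<bullet> x = emb 1 \<and> un (H \<bullet> x) < h)) \<and> fin B"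
      using B(1) by blast
  qed (rule H(2))
  ultimately show False by blast
qed

theorem S_equivalence: "sat M e b (regulated_has_continuity_point \<^bold>\<longleftrightarrow> NIN_alt)"
  unfolding S_Iff S_continuity_point S_NIN_alt
proof
  assume cp: "\<forall>F\<in>D11. unitf F \<and> regul F \<longrightarrow> (\<exists>x\<in>D1. inU x \<and> cont F x)"
  show "\<forall>A\<in>D2. rset A \<and> (\<forall>x\<in>D1. isr x \<longrightarrow> (A \<bullet> x = emb 1 \<longleftrightarrow> inU x)) \<longrightarrow> \<not> (\<exists>H\<in>D2. height H A)"
  proof (intro ballI impI notI)
    fix A assume A: "A \<in> D2" "rset A \<and> (\<forall>x\<in>D1. isr x \<longrightarrow> (A \<bullet> x = emb 1 \<longleftrightarrow> inU x))"
    assume "\<exists>H\<in>D2. height H A"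
    then obtain H where "H \<in> D2" "height H A" by blast
    then show False using A by (intro continuity_imp_NIN[of A H]) (simp_all add: cp)
  qed
next
  assume nin: "\<forall>A\<in>D2. rset A \<and> (\<forall>x\<in>D1. isr x \<longrightarrow> (A \<bullet> x = emb 1 \<longleftrightarrow> inU x)) \<longrightarrow> \<not> (\<exists>H\<in>D2. height H A)"
  show "\<forall>F\<in>D11. unitf F \<and> regul F \<longrightarrow> (\<exists>x\<in>D1. inU x \<and> cont F x)"
  proof (intro ballI impI)
    fix F assume F: "F \<in> D11" "unitf F \<and> regul F"
    have "\<not> height H A" if "A \<in> D2" "rset A" "\<And>x. x \<in> D1 \<Longrightarrow> isr x \<Longrightarrow> A \<bullet> x = emb 1 \<longleftrightarrow> inU x" "H \<in> D2" for A H
      using nin[rule_format, of A] that by blast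
    then show "\<exists>x\<in>D1. inU x \<and> cont F x" using F by (intro NIN_imp_continuity) simp_all
  qed
qed

end

section \<open>The numbers of a countermodel as a type\<close>

lemma wff_QF_AC: "A \<in> QF_AC_10 \<Longrightarrow> wff A" "A \<in> QF_AC_01 \<Longrightarrow> wff A"
  by (auto elim!: QF_AC_10.cases QF_AC_01.cases)

lemma wff_axiom: "A \<in> ACA0_omega \<union> QF_AC_01 \<Longrightarrow> wff A"
  by (auto simp: ACA0_omega_def RCA0_omega_def exists2_def Let_def wff_E_PRA wff_QF_AC)

lemma wff_equivalence: "wff (regulated_has_continuity_point \<^bold>\<longleftrightarrow> NIN_alt)"
proof -
  have "wff (unit_function (Var vf))" "wff (left_limit (Var vf) (Var vx) (Var vy))"
    "wff (right_limit (Var vf) (Var vx) (Var vy))" "wff (continuous_at (Var vf) (Var vx))"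
    by (simp_all add: unit_function_def left_limit_def right_limit_def continuous_at_def)
  then have 1: "wff regulated_has_continuity_point"
    by (simp add: regulated_has_continuity_point_def regulated_def)
  have r: "snd v = ty2 \<Longrightarrow> wff (real_to_nat (Var v))" for v by (simp add: real_to_nat_def)
  have s: "snd v = ty2 \<Longrightarrow> wff (real_set (Var v))" for v by (simp add: real_set_def r)
  have f: "wff (finite_set (Var vB))" by (simp add: finite_set_def)
  have "wff NIN_alt" by (simp add: NIN_alt_def height_countable_def height_function_def r s f)
  with 1 show ?thesis by simp
qed

text \<open>A type definition cannot depend on a local assumption. With the assumption named by a
  constant and a countermodel fixed by choice, the numbers of the countermodel can become a
  type.\<close>

definition unprovable :: bool where
  "unprovable \<longleftrightarrow> \<not> ACA0_omega \<union> QF_AC_01 \<turnstile> (regulated_has_continuity_point \<^bold>\<longleftrightarrow> NIN_alt)"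

definition counter :: "tm model" where
  "counter = (SOME M. pra_model M \<and> \<not> valid M (regulated_has_continuity_point \<^bold>\<longleftrightarrow> NIN_alt))"

lemma counter:
  assumes unprovable
  shows "pra_model counter \<and> \<not> valid counter (regulated_has_continuity_point \<^bold>\<longleftrightarrow> NIN_alt)"
  unfolding counter_def
proof (rule someI_ex)
  have "E_PRA_omega \<subseteq> ACA0_omega \<union> QF_AC_01" by (auto simp: ACA0_omega_def RCA0_omega_def)
  from completeness[OF this wff_axiom wff_equivalence] assms
  show "\<exists>M::tm model. pra_model M \<and> \<not> valid M (regulated_has_continuity_point \<^bold>\<longleftrightarrow> NIN_alt)"
    unfolding unprovable_def pra_model_def pra_model_axioms_def by blast
qed

text \<open>The numbers of the countermodel; the standard numbers serve as a default if there is none,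
  so that the type can be an instance of \<^class>\<open>linordered_semidom\<close> unconditionally.\<close>

typedef nn = "if unprovable then Inl ` dom counter T0 else Inr ` (UNIV :: nat set)"
proof -
  have "zr counter \<in> dom counter T0" if unprovable
    using counter[OF that] by (auto simp: pra_model_def intro: ext_model.zr_dom)
  then show ?thesis by auto
qed

definition emb_nn :: "nn \<Rightarrow> tm" where "emb_nn x = projl (Rep_nn x)"
definition std_nn :: "nn \<Rightarrow> nat" where "std_nn x = projr (Rep_nn x)"

lemma emb_nn:
  assumes unprovable
  shows "emb_nn x \<in> dom counter T0" "inj emb_nn" "a \<in> dom counter T0 \<Longrightarrow> emb_nn (Abs_nn (Inl a)) = a"
proof -
  have R: "Rep_nn x \<in> Inl ` dom counter T0" for x using Rep_nn[of x] assms by simp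
  show "emb_nn x \<in> dom counter T0" using R[of x] by (auto simp: emb_nn_def)
  have "Rep_nn x = Inl (emb_nn x)" for x using R[of x] by (auto simp: emb_nn_def)
  then show "inj emb_nn" by (metis Rep_nn_inject injI)
  assume "a \<in> dom counter T0"
  then show "emb_nn (Abs_nn (Inl a)) = a" using assms by (simp add: emb_nn_def Abs_nn_inverse)
qed

lemma std_nn:
  assumes "\<not> unprovable"
  shows "inj std_nn" "std_nn (Abs_nn (Inr n)) = n"
proof -
  have R: "Rep_nn x \<in> range Inr" for x using Rep_nn[of x] assms by simp
  have "Rep_nn x = Inr (std_nn x)" for x using R[of x] by (auto simp: std_nn_def)
  then show "inj std_nn" by (metis Rep_nn_inject injI)
  show "std_nn (Abs_nn (Inr n)) = n" using assms by (simp add: std_nn_def Abs_nn_inverse)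
qed

section \<open>Order and arithmetic on the type of numbers\<close>

instantiation nn :: "{zero, one, plus, times, minus, ord}"
begin

definition zero_nn :: nn where
  "zero_nn = Abs_nn (if unprovable then Inl (zr counter) else Inr 0)"

definition one_nn :: nn where
  "one_nn = Abs_nn (if unprovable then Inl (ap counter (su counter) (zr counter)) else Inr 1)"

definition plus_nn :: "nn \<Rightarrow> nn \<Rightarrow> nn" where
  "plus_nn x y = Abs_nn (if unprovable
    then Inl (ap counter (ap counter (pra_model.cv counter PLUS) (emb_nn x)) (emb_nn y))
    else Inr (std_nn x + std_nn y))"

definition times_nn :: "nn \<Rightarrow> nn \<Rightarrow> nn" where
  "times_nn x y = Abs_nn (if unprovable
    then Inl (ap counter (ap counter (pra_model.cv counter TIMES) (emb_nn x)) (emb_nn y))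
    else Inr (std_nn x * std_nn y))"

text \<open>Defined through addition, the order needs no case distinction between the countermodel
  and the standard numbers.\<close>

definition less_eq_nn :: "nn \<Rightarrow> nn \<Rightarrow> bool" where
  "less_eq_nn x y \<longleftrightarrow> (\<exists>z. y = x + z)"

definition less_nn :: "nn \<Rightarrow> nn \<Rightarrow> bool" where
  "less_nn x y \<longleftrightarrow> x \<le> y \<and> x \<noteq> y"

text \<open>Uniqueness of the difference comes from cancellation; the value 0 in the other case is
  what \<open>num_model\<close> requires.\<close>

definition minus_nn :: "nn \<Rightarrow> nn \<Rightarrow> nn" where
  "minus_nn x y = (if y \<le> x then THE z. x = y + z else 0)"

instance ..

end

lemma emb_nn_ops:
  assumes u: unprovable
  shows "emb_nn 0 = zr counter" "emb_nn 1 = ap counter (su counter) (zr counter)"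
    "emb_nn (x + y) = ap counter (ap counter (pra_model.cv counter PLUS) (emb_nn x)) (emb_nn y)"
    "emb_nn (x * y) = ap counter (ap counter (pra_model.cv counter TIMES) (emb_nn x)) (emb_nn y)"
proof -
  interpret pra_model counter using counter[OF u] by blast
  show "emb_nn 0 = zr counter" "emb_nn 1 = ap counter (su counter) (zr counter)"
    "emb_nn (x + y) = ap counter (ap counter (pra_model.cv counter PLUS) (emb_nn x)) (emb_nn y)"
    "emb_nn (x * y) = ap counter (ap counter (pra_model.cv counter TIMES) (emb_nn x)) (emb_nn y)"
    using u emb_nn(1)[OF u] by (simp_all add: zero_nn_def one_nn_def plus_nn_def times_nn_def emb_nn(3))
qed

lemma std_nn_ops:
  assumes "\<not> unprovable"
  shows "std_nn 0 = 0" "std_nn 1 = 1" "std_nn (x + y) = std_nn x + std_nn y" "std_nn (x * y) = std_nn x * std_nn y"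
  using assms by (simp_all add: zero_nn_def one_nn_def plus_nn_def times_nn_def std_nn)

text \<open>The laws are proved once for the numbers of the countermodel and once for the standard
  numbers. From here on the two cases no longer need to be distinguished.\<close>

lemma
  fixes x y z :: nn
  shows nn_add_assoc: "x + y + z = x + (y + z)" and nn_add_commute: "x + y = y + x"
    and nn_add_0: "0 + x = x" and nn_add_cancel: "x + z = y + z \<Longrightarrow> x = y"
    and nn_total: "\<exists>z. y = x + z \<or> x = y + z" and nn_add_eq_0: "x + y = 0 \<Longrightarrow> y = 0"
    and nn_mult_assoc: "x * y * z = x * (y * z)" and nn_mult_commute: "x * y = y * x"
    and nn_mult_1: "1 * x = x" and nn_distrib: "(x + y) * z = x * z + y * z"
    and nn_mult_0: "0 * x = 0" and nn_mult_eq_0: "x * y = 0 \<Longrightarrow> x = 0 \<or> y = 0" and nn_0_neq_1: "0 \<noteq> (1 :: nn)"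
proof -
  have "x + y + z = x + (y + z) \<and> x + y = y + x \<and> 0 + x = x \<and> (x + z = y + z \<longrightarrow> x = y) \<and>
    (\<exists>z. y = x + z \<or> x = y + z) \<and> (x + y = 0 \<longrightarrow> y = 0) \<and> x * y * z = x * (y * z) \<and> x * y = y * x \<and>
    1 * x = x \<and> (x + y) * z = x * z + y * z \<and> 0 * x = 0 \<and> (x * y = 0 \<longrightarrow> x = 0 \<or> y = 0) \<and> 0 \<noteq> (1 :: nn)"
  proof (cases unprovable)
  case True
  interpret pra_model counter using counter[OF True] by blast
  note D = emb_nn(1)[OF True] and ops = emb_nn_ops[OF True]
  have eq: "x = y \<longleftrightarrow> emb_nn x = emb_nn y" for x y using emb_nn(2)[OF True] by (auto dest: injD)
  have tot: "\<exists>z. y = x + z \<or> x = y + z"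
  proof -
    obtain k where "k \<in> dom counter T0" "ap counter (ap counter (cv PLUS) (emb_nn x)) k = emb_nn y \<or>
        ap counter (ap counter (cv PLUS) (emb_nn y)) k = emb_nn x"
      using total_N[OF D D] by blast
    then show ?thesis
      by (intro exI[of _ "Abs_nn (Inl k)"]) (auto simp: eq ops emb_nn(3)[OF True])
  qed
  show ?thesis
    using tot D add_cancel_N[of "emb_nn z" "emb_nn x" "emb_nn y"] add_eq_0_N[of "emb_nn x" "emb_nn y"]
      mult_eq_0_N[of "emb_nn x" "emb_nn y"] su_nonzero[OF zr_dom, THEN not_sym]
    by (auto simp: eq ops add_assoc_N mult_assoc_N distrib_N intro: add_commute_N mult_commute_N)
next
  case False
  note ops = std_nn_ops[OF False]
  have eq: "x = y \<longleftrightarrow> std_nn x = std_nn y" for x y using std_nn(1)[OF False] by (auto dest: injD)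
  have tot: "\<exists>z. y = x + z \<or> x = y + z"
    by (intro exI[of _ "Abs_nn (Inr (max (std_nn x - std_nn y) (std_nn y - std_nn x)))"])
      (auto simp: eq ops std_nn(2)[OF False])
  show ?thesis
    using tot by (auto simp: eq ops algebra_simps)
  qed
  then show "x + y + z = x + (y + z)" "x + y = y + x" "0 + x = x" "x + z = y + z \<Longrightarrow> x = y"
    "\<exists>z. y = x + z \<or> x = y + z" "x + y = 0 \<Longrightarrow> y = 0" "x * y * z = x * (y * z)" "x * y = y * x"
    "1 * x = x" "(x + y) * z = x * z + y * z" "0 * x = 0" "x * y = 0 \<Longrightarrow> x = 0 \<or> y = 0" "0 \<noteq> (1 :: nn)"
    by blast+
qed

lemma nn_diff: "(x :: nn) + y - x = y"
proof -
  have "(THE z. x + y = x + z) = y"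
    by (rule the_equality) (metis nn_add_cancel nn_add_commute)+
  then show ?thesis by (auto simp: minus_nn_def less_eq_nn_def)
qed

lemma nn_le_diff: "(x :: nn) \<le> y \<Longrightarrow> x - y = 0"
proof -
  assume "x \<le> y"
  then obtain k where k: "y = x + k" by (auto simp: less_eq_nn_def)
  show "x - y = 0"
  proof (cases "y \<le> x")
    case True
    then obtain z where z: "x = y + z" by (auto simp: less_eq_nn_def)
    then have "(k + z) + x = 0 + x" using k by (metis nn_add_assoc nn_add_commute nn_add_0)
    then have "k + z = 0" by (rule nn_add_cancel)
    then have "z = 0" by (rule nn_add_eq_0)
    then show ?thesis using z nn_diff[of y 0] by simp
  qed (simp add: minus_nn_def)
qed

lemma nn_le_total: "(x :: nn) \<le> y \<or> y \<le> x"
  using nn_total[of y x] by (auto simp: less_eq_nn_def)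

lemma nn_le_cases:
  obtains z where "(y :: nn) = x + z" | z where "x = y + z"
  using nn_total[of y x] by blast

lemma nn_mult_add: "(x :: nn) * (y + z) = x * y + x * z"
  by (metis nn_distrib nn_mult_commute)

instance nn :: linordered_semidom
proof
  fix a b c :: nn
  have le_add: "a \<le> a + b" for a b :: nn by (auto simp: less_eq_nn_def)
  have z: "0 - a = 0" for a :: nn using le_add[of 0 a] by (intro nn_le_diff) (simp add: nn_add_0)
  have a0: "a + 0 = a" for a :: nn by (metis nn_add_0 nn_add_commute)
  have antisym: "a = b" if "a \<le> b" "b \<le> a" for a b :: nn
  proof -
    obtain k where k: "a = b + k" using \<open>b \<le> a\<close> by (auto simp: less_eq_nn_def)
    then have "a - b = k" by (simp add: nn_diff)
    then show ?thesis using nn_le_diff[OF \<open>a \<le> b\<close>] k a0 by simp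
  qed
  show "a + b + c = a + (b + c)" by (rule nn_add_assoc)
  show "a + b = b + a" by (rule nn_add_commute)
  show "0 + a = a" by (rule nn_add_0)
  show "a + b - a = b" by (rule nn_diff)
  show "a - b - c = a - (b + c)"
  proof (cases rule: nn_le_cases[of a b])
    case (1 w)
    show ?thesis
    proof (cases rule: nn_le_cases[of w c])
      case (1 v)
      then show ?thesis using \<open>a = b + w\<close> by (metis nn_add_assoc nn_diff)
    next
      case (2 v)
      then have "b + c = a + v" using \<open>a = b + w\<close> by (simp add: nn_add_assoc)
      then show ?thesis using \<open>a = b + w\<close> 2 by (metis le_add nn_diff nn_le_diff)
    qed
  next
    case (2 w)
    then have "a \<le> b" "a \<le> b + c" using le_add[of a w] le_add[of a "w + c"] by (simp_all add: nn_add_assoc)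
    then show ?thesis by (simp add: nn_le_diff z)
  qed
  show "a * b * c = a * (b * c)" by (rule nn_mult_assoc)
  show "a * b = b * a" by (rule nn_mult_commute)
  show "1 * a = a" by (rule nn_mult_1)
  show "(a + b) * c = a * c + b * c" by (rule nn_distrib)
  show "0 * a = 0" "a * 0 = 0" by (metis nn_mult_0 nn_mult_commute)+
  show "(0 :: nn) \<noteq> 1" by (rule nn_0_neq_1)
  show "a * (b - c) = a * b - a * c"
  proof (cases rule: nn_le_cases[of b c])
    case (1 w)
    then show ?thesis by (simp add: nn_mult_add nn_diff)
  next
    case (2 w)
    then have "a * b \<le> a * c" "b \<le> c" using le_add by (simp_all add: nn_mult_add)
    then show ?thesis by (simp add: nn_le_diff) (metis nn_mult_0 nn_mult_commute)
  qed
  show "a * (b + c) = a * b + a * c" by (rule nn_mult_add)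
  show "a \<noteq> 0 \<Longrightarrow> b \<noteq> 0 \<Longrightarrow> a * b \<noteq> 0" using nn_mult_eq_0 by blast
  show "a < b \<longleftrightarrow> a \<le> b \<and> \<not> b \<le> a" using antisym le_add[of a 0] by (auto simp: less_nn_def a0)
  show "a \<le> a" using le_add[of a 0] by (simp add: a0)
  show "a \<le> b \<Longrightarrow> b \<le> c \<Longrightarrow> a \<le> c" by (auto simp: less_eq_nn_def nn_add_assoc)
  show "a \<le> b \<Longrightarrow> b \<le> a \<Longrightarrow> a = b" by (rule antisym)
  show "a \<le> b \<or> b \<le> a" by (rule nn_le_total)
  show "a \<le> b \<Longrightarrow> c + a \<le> c + b" by (auto simp: less_eq_nn_def nn_add_assoc)
  show "a < b \<Longrightarrow> 0 < c \<Longrightarrow> c * a < c * b"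
  proof -
    assume "a < b" "0 < c"
    then obtain k where k: "b = a + k" "a \<noteq> b" "c \<noteq> 0" by (auto simp: less_nn_def less_eq_nn_def)
    then have "c * k \<noteq> 0" using nn_mult_eq_0 a0 by metis
    then have "c * a \<noteq> c * b" unfolding k(1) nn_mult_add by (metis a0 nn_diff)
    then show ?thesis using le_add k(1) by (simp add: less_nn_def nn_mult_add)
  qed
  show "(0 :: nn) < 1" using nn_0_neq_1 le_add[of 0 1] by (simp add: less_nn_def nn_add_0)
  show "b \<le> a \<Longrightarrow> a - b + b = a" by (auto simp: less_eq_nn_def nn_diff) (rule nn_add_commute)
qed

lemma num_model_counter:
  assumes u: unprovable shows "num_model counter emb_nn"
proof -
  interpret pra_model counter using counter[OF u] by blast
  note ops = emb_nn_ops[OF u] and D = emb_nn(1)[OF u]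
  show ?thesis
  proof
    fix n :: nn
    show "emb_nn (n + 1) = ap counter (su counter) (emb_nn n)" using D[of n] by (simp add: ops)
    show "0 \<le> n" unfolding less_eq_nn_def by (metis nn_add_0)
    show "range emb_nn = dom counter T0"
    proof
      show "dom counter T0 \<subseteq> range emb_nn" using emb_nn(3)[OF u] by (metis rangeI subsetI)
    qed (use D in auto)
  qed (auto simp: ops emb_nn(2)[OF u] nn_le_diff)
qed

theorem theorem3p6:
  shows "ACA0_omega \<union> QF_AC_01 \<turnstile> (regulated_has_continuity_point \<^bold>\<longleftrightarrow> NIN_alt)"
proof (rule ccontr)
  assume "\<not> ?thesis"
  then have u: unprovable by (simp add: unprovable_def)
  then have "valid counter (regulated_has_continuity_point \<^bold>\<longleftrightarrow> NIN_alt)"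
    unfolding valid_def using num_model.S_equivalence[OF num_model_counter] by blast
  then show False using counter[OF u] by blast
qed

end
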